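(* Let $\Omega\subset\mathbb{R}^N$, $\{a_p\}_{p\ge2}$, $\sigma$, $S_g$ and $F$ be as in the context, with $0<\sigma<\infty$. Let $f\in L^1(\Omega)$, let $g\in C^{0,1}(\partial\Omega)$ with $L\le\sigma$, and assume that there exists $\bar g\in S_g$ with $F(\bar g)<+\infty$ (i.e. with $\int_\Omega\Phi(|\nabla\bar g|)<+\infty$). Then $F$ has a unique minimizer $u$ in $S_g$.
   Context: $\Omega\subset\mathbb{R}^N$ ($N\ge1$) is a bounded, connected, open set with Lipschitz boundary. $\{a_p\}_{p\ge2}$ ($p$ integer) is a real sequence with $a_p\ge0$ for all $p$, $a_2>0$, and $a_p\ne0$ for infinitely many $p$; $\sigma\in[0,+\infty]$ is defined by $1/\sigma=\limsup_{p\to\infty}a_p^{1/p}$. For $t\in[0,\sigma]$ put $\Phi(t)=\sum_{p\ge2}\frac{a_p}{p}t^p\in[0,+\infty]$ (finite for $t<\sigma$, possibly $+\infty$ at $t=\sigma$). For $\xi\in\mathbb{R}^N$ put $G(\xi)=\Phi(|\xi|)$ if $|\xi|\le\sigma$ and $G(\xi)=+\infty$ if $|\xi|>\sigma$. For $g\in C^{0,1}(\partial\Omega)$ put $L=\sup_{x\ne y\in\partial\Omega}\frac{|g(x)-g(y)|}{|x-y|}$ and $S_g=\{v\in C^{0,1}(\overline\Omega):\ \|\nabla v\|_{L^\infty(\Omega)}\le\sigma,\ v=g\text{ on }\partial\Omega\}$. For $v\in S_g$, $F(v)=\int_\Omega G(\nabla v)-\int_\Omega fv=\sum_{p\ge2}\frac{a_p}{p}\int_\Omega|\nabla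 v|^p-\int_\Omega fv\in(-\infty,+\infty]$. *)

theory Defs
  imports "HOL-Analysis.Analysis" "HOL-Probability.Essential_Supremum"
begin

text \<open>
  Lipschitz functions on \<open>A\<close>, encoded as total functions that are \<open>undefined\<close> off \<open>A\<close>, so that
  HOL equality of two members is equality on \<open>A\<close>.
\<close>

definition lipschitz_space :: "'a::metric_space set \<Rightarrow> ('a \<Rightarrow> real) set"  (\<open>C\<^sup>0\<^sup>,\<^sup>1\<close>) where
  "C\<^sup>0\<^sup>,\<^sup>1 A = {v \<in> extensional A. \<exists>C. C-lipschitz_on A v}"

text \<open>
  The least Lipschitz constant of \<open>g\<close> on \<open>A\<close>; as an extended real, the supremum needs no
  boundedness side condition.
\<close>

definition lipschitz_const :: "'a::metric_space set \<Rightarrow> ('a \<Rightarrow> real) \<Rightarrow> ereal" where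
  "lipschitz_const A g =
     (SUP (x, y) \<in> {(x, y). x \<in> A \<and> y \<in> A \<and> x \<noteq> y}. ereal (\<bar>g x - g y\<bar> / dist x y))"

text \<open>
  Near each boundary point, \<open>\<Omega>\<close> is the part of a ball lying strictly above the graph of a
  Lipschitz function \<open>\<gamma>\<close> over the hyperplane orthogonal to a unit vector \<open>\<nu>\<close> (the vertical
  direction of a rotated coordinate system).
\<close>

definition lipschitz_boundary :: "'a::euclidean_space set \<Rightarrow> bool" where
  "lipschitz_boundary \<Omega> \<longleftrightarrow>
     (\<forall>x \<in> frontier \<Omega>. \<exists>\<nu> \<gamma> C r. norm \<nu> = 1 \<and> r > 0 \<and> C-lipschitz_on {z. z \<bullet> \<nu> = 0} \<gamma> \<and>
        \<Omega> \<inter> ball x r = {y \<in> ball x r. y \<bullet> \<nu> > \<gamma> (y - (y \<bullet> \<nu>) *\<^sub>R \<nu>)})"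

text \<open>
  The value \<open>0\<close> at points of non-differentiability is immaterial: for \<open>v\<close> Lipschitz on an open set
  these points form a null set (Rademacher), and the pointwise gradient represents the weak one.
\<close>

definition gradient :: "('a::euclidean_space \<Rightarrow> real) \<Rightarrow> 'a \<Rightarrow> 'a"  (\<open>\<nabla>\<close>) where
  "\<nabla> v x = (if \<exists>D. GDERIV v x :> D then THE D. GDERIV v x :> D else 0)"

text \<open>
  The radius \<open>\<sigma>\<close> with \<open>1 / \<sigma> = limsup a\<^sub>p\<^sup>1\<^sup>/\<^sup>p\<close> is \<open>conv_radius a\<close>, which is defined by exactly this
  formula (with \<open>\<bar>a\<^sub>p\<bar>\<close> for \<open>a\<^sub>p\<close>). The entries \<open>a 0\<close> and \<open>a 1\<close> affect none of the notions below.
\<close>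

definition \<Phi> :: "(nat \<Rightarrow> real) \<Rightarrow> real \<Rightarrow> ennreal" where
  "\<Phi> a t = (\<Sum>p. if 2 \<le> p then ennreal (a p / real p * t ^ p) else 0)"

definition G :: "(nat \<Rightarrow> real) \<Rightarrow> 'a::euclidean_space \<Rightarrow> ennreal" where
  "G a \<xi> = (if ereal (norm \<xi>) \<le> conv_radius a then \<Phi> a (norm \<xi>) else \<infinity>)"

definition S :: "'a::euclidean_space set \<Rightarrow> (nat \<Rightarrow> real) \<Rightarrow> ('a \<Rightarrow> real) \<Rightarrow> ('a \<Rightarrow> real) set" where
  "S \<Omega> a g =
     {v \<in> C\<^sup>0\<^sup>,\<^sup>1 (closure \<Omega>).
        esssup (lebesgue_on \<Omega>) (\<lambda>x. ereal (norm (\<nabla> v x))) \<le> conv_radius a \<and>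
        (\<forall>x \<in> frontier \<Omega>. v x = g x)}"

definition F ::
  "'a::euclidean_space set \<Rightarrow> (nat \<Rightarrow> real) \<Rightarrow> ('a \<Rightarrow> real) \<Rightarrow> ('a \<Rightarrow> real) \<Rightarrow> ereal" where
  "F \<Omega> a f v =
     enn2ereal (\<integral>\<^sup>+ x. G a (\<nabla> v x) \<partial>lebesgue_on \<Omega>) - ereal (LINT x|lebesgue_on \<Omega>. f x * v x)"

end

theory Submission
  imports Defs "HOL-Complex_Analysis.Great_Picard"
begin

text \<open>
  A competitor has gradient bounded by \<open>\<sigma>\<close> almost everywhere, so it is \<open>\<sigma>\<close>-Lipschitz along segments
  inside \<open>\<Omega>\<close>; a segment that leaves \<open>\<Omega>\<close> does so through boundary points, where \<open>L \<le> \<sigma>\<close> gives the same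
  bound. Hence \<open>S\<close> consists exactly of the \<open>\<sigma>\<close>-Lipschitz functions on the closure with boundary
  values \<open>g\<close>, a convex set that is compact for uniform convergence.

  Since \<open>a\<^sub>2 > 0\<close>, the parallelogram identity for the quadratic term makes \<open>F\<close> uniformly convex in the
  \<open>L\<^sup>2\<close> distance of the gradients. So minimizers have the same gradient, hence coincide, and the
  gradients of a minimizing sequence form a Cauchy sequence in \<open>L\<^sup>2\<close>. By Arzela--Ascoli a subsequence
  converges uniformly to some \<open>u\<close> in \<open>S\<close>; lower semicontinuity of the Dirichlet energy identifies the
  \<open>L\<^sup>2\<close> limit of the gradients with the gradient of \<open>u\<close>, and Fatou's lemma shows that \<open>u\<close> is a
  minimizer. That the pointwise gradient carries this information is Rademacher's theorem.
\<close>

section \<open>Lipschitz functions of one real variable\<close>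

text \<open>The gradient in \<open>F\<close> is pointwise, so differentiability almost everywhere
  has to precede everything else. It comes from Vitali coverings on the line and reaches the whole
  space by integration along lines.

  Competitors live on the closure, whereas translations need the whole space: single competitors are
  extended with the same Lipschitz constant, differences of two competitors by 0, which stays
  Lipschitz because both equal \<open>g\<close> on the boundary. For such differences one
  inequality, the energy of a difference quotient is at most the Dirichlet energy over \<Omega>,
  does the work of a Poincare inequality (zero gradient forces the zero function) and of weak lower
  semicontinuity (Fatou's lemma at a fixed step).

  \<open>\<Phi>\<close> may be infinite at \<sigma>, so continuity of the energy is out of reach.
  Uniform convexity upgrades the convergence of gradients to a strong one, hence to convergence
  almost everywhere along a subsequence; then it suffices that \<open>\<Phi>\<close>, a supremum of
  continuous partial sums, is lower semicontinuous pointwise.\<close>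

definition upper_slope :: "(real \<Rightarrow> real) \<Rightarrow> real \<Rightarrow> real set" where
  "upper_slope f q = {x. \<forall>\<delta>>0. \<exists>c d. c < x \<and> x < d \<and> d - c < \<delta> \<and> q * (d - c) < f d - f c}"

text \<open>Only chords whose open interval contains the point count. This makes the set a countable
  intersection of unions of open intervals, hence a G-delta for arbitrary \<open>f\<close>.\<close>

lemma upper_slope_borel: "upper_slope f q \<in> sets borel"
proof -
  define W where "W = (\<lambda>n::nat. \<Union>(c, d)\<in>{(c, d). d - c < inverse (Suc n) \<and> q * (d - c) < f d - f c}. {c<..<d})"
  have "upper_slope f q = (\<Inter>n. W n)"
  proof (intro set_eqI iffI)
    fix x assume "x \<in> upper_slope f q"
    then have "\<exists>c d. c < x \<and> x < d \<and> d - c < inverse (Suc n) \<and> q * (d - c) < f d - f c" for n :: nat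
      unfolding upper_slope_def using inverse_positive_iff_positive[of "real (Suc n)"] by simp
    then have "x \<in> W n" for n unfolding W_def by (simp add: Bex_def) blast
    then show "x \<in> (\<Inter>n. W n)" by blast
  next
    fix x assume *: "x \<in> (\<Inter>n. W n)"
    show "x \<in> upper_slope f q"
      unfolding upper_slope_def mem_Collect_eq
    proof (intro allI impI)
      fix \<delta> :: real assume "\<delta> > 0"
      then obtain n where n: "inverse (Suc n) < \<delta>" using reals_Archimedean by blast
      have "x \<in> W n" using * by blast
      then obtain c d where "d - c < inverse (Suc n)" "q * (d - c) < f d - f c" "c < x" "x < d"
        unfolding W_def by auto
      with n show "\<exists>c d. c < x \<and> x < d \<and> d - c < \<delta> \<and> q * (d - c) < f d - f c"
        by (intro exI[of _ c] exI[of _ d]) auto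
    qed
  qed
  moreover have "open (W n)" for n unfolding W_def by auto
  ultimately show ?thesis by auto
qed

text \<open>
  An increasing homeomorphism expands a set of steep points at least by the slope. Applied to the
  function and to its inverse, this makes points with two different limiting slopes a null set.
\<close>

lemma measure_upper_slope_le:
  fixes f g :: "real \<Rightarrow> real"
  assumes mono: "strict_mono f" and cf: "continuous_on UNIV f" and cg: "continuous_on UNIV g"
    and gf: "\<And>x. g (f x) = x" and fg: "\<And>y. f (g y) = y"
    and E: "E \<in> sets borel" "E \<subseteq> upper_slope f q" and q: "0 \<le> q"
  shows "ennreal q * emeasure lborel E \<le> emeasure lborel (g -` E)"
proof (rule ennreal_le_epsilon)
  fix e :: real assume e: "0 < e"
  have gm[measurable]: "g \<in> borel_measurable borel" using cg by (rule borel_measurable_continuous_onI)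
  have gE: "g -` E \<in> sets borel" using measurable_sets[OF gm E(1)] by simp
  \<comment> \<open>The preimage of \<open>E\<close> under \<open>g\<close> is the image of
    \<open>E\<close> under \<open>f\<close>. It is enclosed in an open \<open>T\<close> with excess
    below \<open>e\<close>; steep intervals are then taken inside \<open>U\<close>, so that their
    images stay in \<open>T\<close>.\<close>
  obtain T where T: "open T" "g -` E \<subseteq> T" "emeasure lborel (T - g -` E) < ennreal e"
    using outer_regular_lborel[OF gE e] by blast
  define U where "U = f -` T"
  have U: "open U" unfolding U_def using cf T(1) by (simp add: open_vimage)
  have EU: "E \<subseteq> U" unfolding U_def using T(2) gf by (auto simp: subset_iff)
  \<comment> \<open>The steep closed intervals inside \<open>U\<close>. They cover \<open>E\<close>
    in the sense of Vitali, so countably many disjoint ones exhaust \<open>E\<close> up to a null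
    set.\<close>
  define K where "K = {(c, d). c < d \<and> q * (d - c) < f d - f c \<and> {c..d} \<subseteq> U}"
  have cb: "cball ((c + d) / 2) ((d - c) / 2) = {c..d}" for c d :: real
    by (simp add: cball_eq_atLeastAtMost field_simps)
  obtain C where C: "countable C" "C \<subseteq> K"
     and disj: "pairwise (\<lambda>i j. disjnt (cball ((fst i + snd i) / 2) ((snd i - fst i) / 2)) (cball ((fst j + snd j) / 2) ((snd j - fst j) / 2))) C"
     and neg: "negligible (E - (\<Union>i \<in> C. cball ((fst i + snd i) / 2) ((snd i - fst i) / 2)))"
  proof (rule Vitali_covering_theorem_cballs[of K "\<lambda>i. (snd i - fst i) / 2" E "\<lambda>i. (fst i + snd i) / 2"])
    show "0 < (snd i - fst i) / 2" if "i \<in> K" for i using that by (auto simp: K_def)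
    fix x \<delta> :: real assume x: "x \<in> E" and \<delta>: "0 < \<delta>"
    obtain \<rho> where \<rho>: "\<rho> > 0" "ball x \<rho> \<subseteq> U" using U EU x by (meson openE subsetD)
    have "x \<in> upper_slope f q" using x E by auto
    moreover have "min \<delta> \<rho> > 0" using \<delta> \<rho> by auto
    ultimately obtain c d where cd: "c < x" "x < d" "d - c < min \<delta> \<rho>" "q * (d - c) < f d - f c"
      unfolding upper_slope_def by blast
    have "{c..d} \<subseteq> ball x \<rho>" using cd by (auto simp: dist_real_def)
    then have "(c, d) \<in> K" using cd \<rho> unfolding K_def by auto
    moreover have "x \<in> cball ((c + d) / 2) ((d - c) / 2)" unfolding cb using cd by auto
    ultimately show "\<exists>i. i \<in> K \<and> x \<in> cball ((fst i + snd i) / 2) ((snd i - fst i) / 2) \<and> (snd i - fst i) / 2 < \<delta>"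
      using cd \<delta> by (intro exI[of _ "(c, d)"]) auto
  qed
  define I where "I = (\<lambda>i::real \<times> real. {fst i..snd i})"
  have disj': "disjoint_family_on I C"
    using disj unfolding cb pairwise_def disjoint_family_on_def I_def disjnt_def by blast
  have Imeas: "(\<Union>i\<in>C. I i) \<in> sets lborel" unfolding I_def using C(1) by (auto intro!: sets.countable_UN')
  have neg': "E - (\<Union>i\<in>C. I i) \<in> null_sets lborel"
    using neg E(1) Imeas unfolding cb I_def[symmetric] negligible_iff_null_sets
    by (subst (asm) null_sets_completion_iff) auto
  have "ennreal q * emeasure lborel E \<le> ennreal q * emeasure lborel (\<Union>i\<in>C. I i)"
  proof (intro mult_left_mono)
    have "emeasure lborel E \<le> emeasure lborel ((\<Union>i\<in>C. I i) \<union> (E - (\<Union>i\<in>C. I i)))"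
      using Imeas E by (intro emeasure_mono) auto
    also have "\<dots> = emeasure lborel (\<Union>i\<in>C. I i)"
      using neg' Imeas by (rule emeasure_Un_null_set[rotated])
    finally show "emeasure lborel E \<le> emeasure lborel (\<Union>i\<in>C. I i)" .
  qed auto
  also have "emeasure lborel (\<Union>i\<in>C. I i) = (\<integral>\<^sup>+i. emeasure lborel (I i) \<partial>count_space C)"
    using C(1) disj' by (intro emeasure_UN_countable) (auto simp: I_def)
  also have "ennreal q * \<dots> = (\<integral>\<^sup>+i. ennreal q * emeasure lborel (I i) \<partial>count_space C)"
    by (simp add: nn_integral_cmult)
  \<comment> \<open>Each steep interval is stretched to \<open>{f c..f d}\<close>, whose length
    exceeds \<open>q\<close> times its own; disjoint intervals have disjoint images.\<close>
  also have "\<dots> \<le> (\<integral>\<^sup>+i. emeasure lborel (g -` I i) \<partial>count_space C)"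
  proof (rule nn_integral_mono)
    fix i assume "i \<in> space (count_space C)"
    then obtain c d where i: "i = (c, d)" and cd: "c < d" "q * (d - c) < f d - f c" using C(2) K_def by auto
    have "{f c..f d} \<subseteq> g -` I i"
    proof
      fix y assume "y \<in> {f c..f d}"
      then have "f c \<le> f (g y)" "f (g y) \<le> f d" by (auto simp: fg)
      then show "y \<in> g -` I i" using mono by (auto simp: I_def i strict_mono_less_eq)
    qed
    then have "emeasure lborel {f c..f d} \<le> emeasure lborel (g -` I i)"
      using measurable_sets[OF gm, of "I i"] by (intro emeasure_mono) (auto simp: I_def)
    moreover have "ennreal q * emeasure lborel (I i) \<le> emeasure lborel {f c..f d}"
      using cd mono q by (auto simp: I_def i strict_mono_less_eq ennreal_mult[symmetric] intro!: ennreal_leI)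
    ultimately show "ennreal q * emeasure lborel (I i) \<le> emeasure lborel (g -` I i)" by order
  qed
  also have "\<dots> = emeasure lborel (\<Union>i\<in>C. g -` I i)"
    using C(1) disj' measurable_sets[OF gm]
    by (intro emeasure_UN_countable[symmetric]) (auto simp: I_def disjoint_family_on_vimageI)
  also have "\<dots> \<le> emeasure lborel T"
  proof (intro emeasure_mono)
    show "(\<Union>i\<in>C. g -` I i) \<subseteq> T"
    proof
      fix y assume "y \<in> (\<Union>i\<in>C. g -` I i)"
      then obtain i where "i \<in> C" "g y \<in> I i" by auto
      moreover have "I i \<subseteq> U"
        using subsetD[OF C(2) \<open>i \<in> C\<close>] by (cases i) (simp add: I_def K_def)
      ultimately have "g y \<in> U" by blast
      then show "y \<in> T" by (simp add: U_def fg)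
    qed
  qed (use T in auto)
  also have "\<dots> \<le> emeasure lborel (g -` E \<union> (T - g -` E))"
    using T gE by (intro emeasure_mono) auto
  also have "\<dots> \<le> emeasure lborel (g -` E) + emeasure lborel (T - g -` E)"
    using T gE by (intro emeasure_subadditive) auto
  also have "\<dots> \<le> emeasure lborel (g -` E) + ennreal e"
    using T(3) by (intro add_left_mono) auto
  finally show "ennreal q * emeasure lborel E \<le> emeasure lborel (g -` E) + ennreal e" .
qed

text \<open>\<open>M\<close> makes \<open>h\<close> increase with slope at least 1, so that it has a
  1-Lipschitz inverse, and makes \<open>p + M\<close> positive. On the set in question
  \<open>h\<close> stretches measure by at least \<open>q + M\<close>, while its slopes below
  \<open>p + M\<close> are slopes above \<open>1 / (p + M)\<close> of the inverse. So the measure is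
  at least \<open>(q + M) / (p + M)\<close> times itself, a factor above 1, which a finite positive
  measure cannot satisfy.\<close>

lemma null_upper_lower_slope:
  fixes f :: "real \<Rightarrow> real"
  assumes f: "C-lipschitz_on UNIV f" and pq: "p < q"
  shows "upper_slope f q \<inter> upper_slope (\<lambda>x. - f x) (- p) \<in> null_sets lborel"
proof -
  define M where "M = C + 1 + \<bar>p\<bar>"
  have C: "0 \<le> C" using f by (rule lipschitz_on_nonneg)
  define h where "h x = f x + M * x" for x
  have slope: "d - c \<le> h d - h c" if "c \<le> d" for c d
  proof -
    have "\<bar>f d - f c\<bar> \<le> C * (d - c)" using lipschitz_onD[OF f, of d c] that by (auto simp: dist_real_def)
    then have "- (C * (d - c)) \<le> f d - f c" by linarith
    moreover have "0 \<le> \<bar>p\<bar> * (d - c)" using that by simp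
    ultimately show ?thesis by (simp add: h_def M_def algebra_simps)
  qed
  have h_mono: "strict_mono h"
  proof (rule strict_monoI)
    fix x y :: real assume "x < y"
    then show "h x < h y" using slope[of x y] by linarith
  qed
  have fc: "continuous_on UNIV f" using f by (rule lipschitz_on_continuous_on)
  have hc: "continuous_on UNIV h" unfolding h_def by (intro continuous_intros fc)
  have "\<exists>x. h x = y" for y
  proof -
    have "h 0 - \<bar>y - h 0\<bar> \<ge> h (- \<bar>y - h 0\<bar>)" using slope[of "- \<bar>y - h 0\<bar>" 0] by auto
    moreover have "h 0 + \<bar>y - h 0\<bar> \<le> h \<bar>y - h 0\<bar>" using slope[of 0 "\<bar>y - h 0\<bar>"] by auto
    ultimately have "\<exists>x\<ge>- \<bar>y - h 0\<bar>. x \<le> \<bar>y - h 0\<bar> \<and> h x = y"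
      by (intro IVT' continuous_on_subset[OF hc]) auto
    then show ?thesis by auto
  qed
  then obtain g where fg: "\<And>y. h (g y) = y" by metis
  have gf: "g (h x) = x" for x using fg[of "h x"] h_mono by (simp add: strict_mono_eq)
  have "1-lipschitz_on UNIV g"
  proof (rule lipschitz_onI)
    fix x y show "dist (g x) (g y) \<le> 1 * dist x y"
      using slope[of "g x" "g y"] slope[of "g y" "g x"] by (cases "g x \<le> g y") (simp_all add: fg dist_real_def)
  qed simp
  then have gc: "continuous_on UNIV g" by (rule lipschitz_on_continuous_on)
  have g_mono: "strict_mono g"
    by (rule strict_monoI) (metis fg h_mono strict_mono_less)
  have p': "p + M > 0" and q': "q + M > 0" using C pq by (auto simp: M_def)
  define X where "X = upper_slope f q \<inter> upper_slope (\<lambda>x. - f x) (- p)"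
  have X: "X \<in> sets borel" unfolding X_def by (intro sets.Int upper_slope_borel)
  \<comment> \<open>Cutting to a bounded interval makes the measure finite, so that it can be
    cancelled in the final comparison.\<close>
  have zero: "emeasure lborel (X \<inter> {-real n..real n}) = 0" for n
  proof -
    let ?E = "X \<inter> {-real n..real n}"
    have E: "?E \<in> sets borel" using X by auto
    have "?E \<subseteq> upper_slope h (q + M)"
      unfolding X_def upper_slope_def h_def by (auto simp: algebra_simps)
    then have 1: "ennreal (q + M) * emeasure lborel ?E \<le> emeasure lborel (g -` ?E)"
      using q' by (intro measure_upper_slope_le[OF h_mono hc gc gf fg E]) auto
    have gE: "g -` ?E \<in> sets borel" using measurable_sets[OF borel_measurable_continuous_onI[OF gc] E] by simp
    \<comment> \<open>A chord of \<open>h\<close> around \<open>g y\<close> with slope below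
      \<open>p + M\<close> becomes, with the axes exchanged, a chord of \<open>g\<close> around
      \<open>y\<close> with slope above \<open>1 / (p + M)\<close>; starting from a base shorter
      than \<open>\<delta> / (p + M)\<close> keeps the new base shorter than \<delta>.\<close>
    have "g -` ?E \<subseteq> upper_slope g (inverse (p + M))"
    proof
      fix y assume "y \<in> g -` ?E"
      then have y: "g y \<in> upper_slope (\<lambda>x. - f x) (- p)" by (auto simp: X_def)
      show "y \<in> upper_slope g (inverse (p + M))"
        unfolding upper_slope_def mem_Collect_eq
      proof (intro allI impI)
        fix \<delta> :: real assume "\<delta> > 0"
        then have "\<delta> / (p + M) > 0" using p' by simp
        then obtain c d where cd: "c < g y" "g y < d" "d - c < \<delta> / (p + M)" "- p * (d - c) < - f d - - f c"
          using y unfolding upper_slope_def by blast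
        have *: "h d - h c < (p + M) * (d - c)" using cd(4) by (simp add: h_def algebra_simps)
        moreover have "(p + M) * (d - c) < \<delta>" using cd(3) p' by (simp add: field_simps)
        moreover have "inverse (p + M) * (h d - h c) < d - c" using * p' by (simp add: field_simps)
        moreover have "h c < y" "y < h d" using cd(1,2) h_mono by (metis fg strict_mono_less)+
        ultimately show "\<exists>c d. c < y \<and> y < d \<and> d - c < \<delta> \<and> inverse (p + M) * (d - c) < g d - g c"
          by (intro exI[of _ "h c"] exI[of _ "h d"]) (auto simp: gf)
      qed
    qed
    then have "ennreal (inverse (p + M)) * emeasure lborel (g -` ?E) \<le> emeasure lborel (h -` (g -` ?E))"
      using p' by (intro measure_upper_slope_le[OF g_mono gc hc fg gf gE]) auto
    also have "h -` (g -` ?E) = ?E" by (auto simp: gf)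
    finally have 2: "ennreal (inverse (p + M)) * emeasure lborel (g -` ?E) \<le> emeasure lborel ?E" .
    have "emeasure lborel ?E \<le> emeasure lborel {-real n..real n}" by (intro emeasure_mono) auto
    also have "\<dots> < \<infinity>" by simp
    finally obtain l where l: "emeasure lborel ?E = ennreal l" "l \<ge> 0"
      by (cases "emeasure lborel ?E") auto
    have "ennreal ((inverse (p + M)) * ((q + M) * l)) \<le> ennreal l"
      using order_trans[OF mult_left_mono[OF 1] 2] l p' q' by (simp add: ennreal_mult)
    then have "(inverse (p + M)) * ((q + M) * l) \<le> l" using l by simp
    then have "(q + M) * l \<le> (p + M) * l" using p' by (simp add: field_simps)
    then have "(q - p) * l \<le> 0" by (simp add: algebra_simps)
    then have "l = 0" using pq l(2) by (simp add: mult_le_0_iff)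
    then show ?thesis using l by simp
  qed
  have "X = (\<Union>n. X \<inter> {-real n..real n})"
  proof (intro set_eqI iffI)
    fix x assume "x \<in> X"
    moreover obtain n where "\<bar>x\<bar> \<le> real n" using real_arch_simple by blast
    ultimately show "x \<in> (\<Union>n. X \<inter> {-real n..real n})" by (auto simp: abs_le_iff intro!: exI[of _ n])
  qed auto
  also have "\<dots> \<in> null_sets lborel"
    using zero X by (intro null_sets_UN) (auto simp: null_sets_def)
  finally show ?thesis unfolding X_def .
qed

lemma upper_slope_antimono: "p \<le> q \<Longrightarrow> upper_slope f q \<subseteq> upper_slope f p"
  unfolding upper_slope_def
proof (intro subsetI, unfold mem_Collect_eq, intro allI impI)
  fix x \<delta> :: real
  assume "p \<le> q" and *: "\<forall>\<delta>>0. \<exists>c d. c < x \<and> x < d \<and> d - c < \<delta> \<and> q * (d - c) < f d - f c" and "0 < \<delta>"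
  from * \<open>0 < \<delta>\<close> obtain c d where "c < x" "x < d" "d - c < \<delta>" "q * (d - c) < f d - f c"
    by blast
  moreover from this have "p * (d - c) \<le> q * (d - c)" using \<open>p \<le> q\<close> by (intro mult_right_mono) auto
  ultimately show "\<exists>c d. c < x \<and> x < d \<and> d - c < \<delta> \<and> p * (d - c) < f d - f c"
    using le_less_trans by blast
qed

text \<open>\<open>upper_slope\<close> speaks only of intervals with \<open>x\<close> strictly
  inside. By continuity the near endpoint may tend to \<open>x\<close>, which bounds the difference
  quotients on both sides of \<open>x\<close>.\<close>

lemma slope_le_if_not_upper_slope:
  assumes f: "continuous_on UNIV f" and x: "x \<notin> upper_slope f q"
  shows "\<forall>\<^sub>F t in at 0. (f (x + t) - f x) / t \<le> q"
proof -
  obtain \<delta> where \<delta>: "\<delta> > 0" "\<And>c d. c < x \<Longrightarrow> x < d \<Longrightarrow> d - c < \<delta> \<Longrightarrow> f d - f c \<le> q * (d - c)"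
    using x unfolding upper_slope_def by (auto simp: not_less) (metis not_less)
  have cont: "isCont f y" for y using f by (simp add: continuous_on_eq_continuous_at)
  have pos: "(f (x + t) - f x) / t \<le> q" if t: "0 < t" "t < \<delta>" for t
  proof -
    have "f (x + t) - f x \<le> q * (x + t - x)"
    proof (rule tendsto_le)
      show "((\<lambda>c. q * (x + t - c)) \<longlongrightarrow> q * (x + t - x)) (at_left x)" by (intro tendsto_intros)
      show "((\<lambda>c. f (x + t) - f c) \<longlongrightarrow> f (x + t) - f x) (at_left x)"
        using cont[of x] by (intro tendsto_intros) (auto simp: isCont_def intro: tendsto_mono[OF at_le])
      have "\<forall>\<^sub>F c in at_left x. c \<in> {x + t - \<delta><..<x}"
        using t by (intro eventually_at_leftI[of "x + t - \<delta>"]) auto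
      then show "\<forall>\<^sub>F c in at_left x. f (x + t) - f c \<le> q * (x + t - c)"
        by eventually_elim (use \<delta>(2) t in auto)
    qed simp
    then show ?thesis using t by (simp add: field_simps)
  qed
  have neg: "(f (x + t) - f x) / t \<le> q" if t: "t < 0" "- t < \<delta>" for t
  proof -
    have "f x - f (x + t) \<le> q * (x - (x + t))"
    proof (rule tendsto_le)
      show "((\<lambda>d. q * (d - (x + t))) \<longlongrightarrow> q * (x - (x + t))) (at_right x)" by (intro tendsto_intros)
      show "((\<lambda>d. f d - f (x + t)) \<longlongrightarrow> f x - f (x + t)) (at_right x)"
        using cont[of x] by (intro tendsto_intros) (auto simp: isCont_def intro: tendsto_mono[OF at_le])
      have "\<forall>\<^sub>F d in at_right x. d \<in> {x<..<x + t + \<delta>}"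
        using t by (intro eventually_at_rightI[of _ "x + t + \<delta>"]) auto
      then show "\<forall>\<^sub>F d in at_right x. f d - f (x + t) \<le> q * (d - (x + t))"
        by eventually_elim (use \<delta>(2) t in auto)
    qed simp
    then show ?thesis using t by (simp add: field_simps)
  qed
  have "(f (x + t) - f x) / t \<le> q" if "t \<noteq> 0" "\<bar>t\<bar> < \<delta>" for t
    using that pos[of t] neg[of t] by (cases "t > 0") auto
  then show ?thesis
    unfolding eventually_at using \<delta>(1) by (intro exI[of _ \<delta>]) (simp add: dist_real_def)
qed

text \<open>The null sets for rational \<open>p < q\<close> are discarded. At any other point the
  derivative is \<open>Sup Q\<close>: numbers above it bound the quotients from above; just below it
  there are rationals \<open>p < q\<close> with \<open>q\<close> in \<open>Q\<close>, and since the
  point cannot also have slopes below \<open>p\<close>, that \<open>p\<close> bounds the quotients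
  from below.\<close>

theorem lipschitz_real_slopes_converge_AE:
  fixes f :: "real \<Rightarrow> real"
  assumes f: "C-lipschitz_on UNIV f"
  shows "AE x in lborel. \<exists>L. ((\<lambda>t. (f (x + t) - f x) / t) \<longlongrightarrow> L) (at 0)"
proof -
  have fc: "continuous_on UNIV f" using f by (rule lipschitz_on_continuous_on)
  have C: "0 \<le> C" using f by (rule lipschitz_on_nonneg)
  have bd: "\<bar>f d - f c\<bar> \<le> C * (d - c)" if "c \<le> d" for c d
    using lipschitz_onD[OF f, of d c] that by (auto simp: dist_real_def)
  have "AE x in lborel. \<forall>p\<in>\<rat>. \<forall>q\<in>\<rat>. p < q \<longrightarrow> x \<notin> upper_slope f q \<inter> upper_slope (\<lambda>x. - f x) (- p)"
    using null_upper_lower_slope[OF f]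
    by (intro AE_ball_countable[THEN iffD2] ballI countable_rat AE_impI AE_not_in) auto
  then show ?thesis
  proof eventually_elim
    case (elim x)
    define Q where "Q = {q. x \<in> upper_slope f q}"
    \<comment> \<open>Every chord has slope at least \<open>- C\<close>, so \<open>Q\<close> is
      nonempty; the 1 makes the inequality strict.\<close>
    have "- C - 1 \<in> Q"
      unfolding Q_def upper_slope_def mem_Collect_eq
    proof (intro allI impI)
      fix \<delta> :: real assume "\<delta> > 0"
      define c where "c = x - \<delta> / 3"
      define d where "d = x + \<delta> / 3"
      have cd: "c < x" "x < d" "d - c < \<delta>" using \<open>\<delta> > 0\<close> by (auto simp: c_def d_def)
      have "\<bar>f d - f c\<bar> \<le> C * (d - c)" using cd by (intro bd) simp
      moreover have "(- C - 1) * (d - c) = - (C * (d - c)) - (d - c)"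
        by (simp add: algebra_simps)
      ultimately have "(- C - 1) * (d - c) < f d - f c" using cd by linarith
      with cd show "\<exists>c d. c < x \<and> x < d \<and> d - c < \<delta> \<and> (- C - 1) * (d - c) < f d - f c"
        by blast
    qed
    moreover have Qle: "q \<le> C" if "q \<in> Q" for q
    proof -
      obtain c d where cd: "c < x" "x < d" "q * (d - c) < f d - f c"
        using \<open>q \<in> Q\<close> unfolding Q_def upper_slope_def using zero_less_one by blast
      then have "q * (d - c) < C * (d - c)" using bd[of c d] by linarith
      then show ?thesis using cd by (simp add: mult_less_cancel_right)
    qed
    ultimately have Q: "Q \<noteq> {}" "bdd_above Q" by (auto simp: bdd_above_def)
    have "((\<lambda>t. (f (x + t) - f x) / t) \<longlongrightarrow> Sup Q) (at 0)"
    proof (rule tendstoI)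
      fix e :: real assume e: "e > 0"
      have "Sup Q + e / 2 \<notin> Q" using cSup_upper[OF _ Q(2), of "Sup Q + e/2"] e by auto
      then have up: "\<forall>\<^sub>F t in at 0. (f (x + t) - f x) / t \<le> Sup Q + e / 2"
        using slope_le_if_not_upper_slope[OF fc] by (auto simp: Q_def)
      obtain r where r: "r \<in> Q" "Sup Q - e / 2 < r" using less_cSupD[OF Q(1), of "Sup Q - e/2"] e by auto
      obtain q where q: "q \<in> \<rat>" "Sup Q - e / 2 < q" "q < r" using Rats_dense_in_real[OF r(2)] by auto
      obtain p where p: "p \<in> \<rat>" "Sup Q - e / 2 < p" "p < q" using Rats_dense_in_real[OF q(2)] by auto
      have "x \<in> upper_slope f q" using r q upper_slope_antimono[of q r f] by (auto simp: Q_def)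
      then have "x \<notin> upper_slope (\<lambda>x. - f x) (- p)" using elim p q by auto
      then have "\<forall>\<^sub>F t in at 0. (- f (x + t) - - f x) / t \<le> - p"
        using fc by (intro slope_le_if_not_upper_slope continuous_intros)
      then show "\<forall>\<^sub>F t in at 0. dist ((f (x + t) - f x) / t) (Sup Q) < e"
        using up
      proof eventually_elim
        case (elim t)
        have "(- f (x + t) - - f x) / t = - ((f (x + t) - f x) / t)" by (simp add: diff_divide_distrib)
        then show ?case using elim p e by (auto simp: dist_real_def)
      qed
    qed
    then show ?case by blast
  qed
qed

section \<open>Rademacher's theorem\<close>

text \<open>The measure of the exceptional set equals the average over \<open>t\<close> in
  \<open>{0..1}\<close> of the measures of its translates by \<open>- t *\<^sub>R e\<close>.
  Exchanging the integrals leaves integrals along lines in direction \<open>e\<close>, which vanish.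
  No rotation of coordinates is needed to make \<open>e\<close> an axis.\<close>

lemma AE_if_AE_lines:
  fixes e :: "'a::euclidean_space"
  assumes P: "{x. P x} \<in> sets borel" and lines: "\<And>x. AE t in lborel. P (x + t *\<^sub>R e)"
  shows "AE x in lborel. P x"
proof -
  define A where "A = {x. \<not> P x}"
  have "A = UNIV - {x. P x}" unfolding A_def by auto
  then have [measurable]: "A \<in> sets borel" using P by auto
  have "emeasure lborel A = (\<integral>\<^sup>+t. (\<integral>\<^sup>+x. indicator {0..1::real} t * indicator A (x + t *\<^sub>R e) \<partial>lborel) \<partial>lborel)"
  proof -
    have "(\<integral>\<^sup>+x. indicator A (x + t *\<^sub>R e) \<partial>lborel) = emeasure lborel A" for t
    proof -
      have "(\<integral>\<^sup>+x. indicator A (x + t *\<^sub>R e) \<partial>lborel) = (\<integral>\<^sup>+x. indicator A x \<partial>distr lborel borel ((+) (t *\<^sub>R e)))"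
        by (subst nn_integral_distr) (auto simp: add.commute)
      then show ?thesis by (simp only: lborel_distr_plus) simp
    qed
    then show ?thesis by (simp add: nn_integral_cmult nn_integral_multc)
  qed
  also have "\<dots> = (\<integral>\<^sup>+x. (\<integral>\<^sup>+t. indicator {0..1::real} t * indicator A (x + t *\<^sub>R e) \<partial>lborel) \<partial>lborel)"
    by (rule lborel_pair.Fubini'[symmetric]) measurable
  also have "\<dots> = (\<integral>\<^sup>+x. 0 \<partial>(lborel :: 'a measure))"
  proof (rule nn_integral_cong)
    fix x
    have "AE t in lborel. indicator {0..1::real} t * indicator A (x + t *\<^sub>R e) = (0::ennreal)"
      using lines[of x] by eventually_elim (auto simp: A_def)
    then show "(\<integral>\<^sup>+t. indicator {0..1::real} t * indicator A (x + t *\<^sub>R e) \<partial>lborel) = (0::ennreal)"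
      by (subst nn_integral_0_iff_AE) auto
  qed
  finally have "A \<in> null_sets lborel" by auto
  then show ?thesis by (rule AE_I'[where N = A]) (auto simp: A_def)
qed

text \<open>The step is \<open>1 / n\<close>, with a factor in place of a division. At
  \<open>n = 0\<close> the factor gives the value 0, so the Lipschitz bound holds for every
  \<open>n\<close>.\<close>

definition diff_quot :: "('a::euclidean_space \<Rightarrow> real) \<Rightarrow> 'a \<Rightarrow> nat \<Rightarrow> 'a \<Rightarrow> real" where
  "diff_quot u e n x = real n * (u (x + (1 / real n) *\<^sub>R e) - u x)"

lemma diff_quot_bound:
  assumes "C-lipschitz_on UNIV u"
  shows "\<bar>diff_quot u e n x\<bar> \<le> C * norm e"
proof (cases "n = 0")
  case False
  have "\<bar>u (x + (1 / real n) *\<^sub>R e) - u x\<bar> \<le> C * (norm e / real n)"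
    using lipschitz_onD[OF assms, of "x + (1 / real n) *\<^sub>R e" x] by (simp add: dist_norm)
  then have "real n * \<bar>u (x + (1 / real n) *\<^sub>R e) - u x\<bar> \<le> C * norm e"
    using False by (simp add: field_simps)
  then show ?thesis by (simp add: diff_quot_def abs_mult)
qed (use lipschitz_on_nonneg[OF assms] in \<open>auto simp: diff_quot_def\<close>)

lemma borel_measurable_lipschitz:
  fixes u :: "'a::euclidean_space \<Rightarrow> real"
  assumes "C-lipschitz_on UNIV u"
  shows "u \<in> borel_measurable borel"
  using lipschitz_on_continuous_on[OF assms] by (rule borel_measurable_continuous_onI)

lemma borel_measurable_diff_quot:
  assumes "C-lipschitz_on UNIV u"
  shows "diff_quot u e n \<in> borel_measurable borel"
proof -
  note [measurable] = borel_measurable_lipschitz[OF assms]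
  show ?thesis unfolding diff_quot_def by measurable
qed

text \<open>
  Reducing the derivative to the steps \<open>1 / n\<close> makes the set of points where a directional
  derivative exists visibly Borel.
\<close>

lemma tendsto_at_right_slope_if_seq:
  fixes f :: "real \<Rightarrow> real"
  assumes f: "K-lipschitz_on UNIV f" and L: "(\<lambda>n. real n * (f (1 / real n) - f 0)) \<longlonglongrightarrow> L"
  shows "((\<lambda>t. (f t - f 0) / t) \<longlongrightarrow> L) (at_right 0)"
proof -
  have K: "0 \<le> K" using f by (rule lipschitz_on_nonneg)
  \<comment> \<open>For \<open>t < 1\<close>, \<open>1 / m t\<close> is the least step of the form
    \<open>1 / n\<close> that is at least \<open>t\<close>; the reciprocals of \<open>t\<close> and
    of this step differ by at most 1.\<close>
  define m where "m t = nat \<lfloor>1 / t\<rfloor>" for t :: real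
  define a where "a n = real n * (f (1 / real n) - f 0)" for n
  have m: "filterlim m sequentially (at_right 0)"
    unfolding m_def
    by (intro filterlim_compose[OF filterlim_nat_sequentially] filterlim_compose[OF filterlim_floor_sequentially])
       (simp add: filterlim_inverse_at_top_right flip: inverse_eq_divide)
  have am: "((\<lambda>t. a (m t)) \<longlongrightarrow> L) (at_right 0)"
    using filterlim_compose[OF L m] by (simp add: a_def)
  have "((\<lambda>t. (f t - f 0) / t - a (m t)) \<longlongrightarrow> 0) (at_right 0)"
  proof (rule Lim_null_comparison)
    have "(\<lambda>n. 2 * K / real n) \<longlonglongrightarrow> 0" by real_asymp
    then show "((\<lambda>t. 2 * K / real (m t)) \<longlongrightarrow> 0) (at_right 0)" using m by (rule filterlim_compose)
    have "\<forall>\<^sub>F t in at_right 0. t \<in> {0<..<1::real}" by (rule eventually_at_right_real) simp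
    then show "\<forall>\<^sub>F t in at_right 0. norm ((f t - f 0) / t - a (m t)) \<le> 2 * K / real (m t)"
    proof eventually_elim
      case (elim t)
      have t1: "1 \<le> 1 / t" using elim by simp
      define k where "k = \<lfloor>1 / t\<rfloor>"
      have "1 \<le> k" using t1 by (simp add: k_def le_floor_iff)
      then have m1: "1 \<le> m t" and mr: "real (m t) = of_int \<lfloor>1 / t\<rfloor>"
        unfolding m_def k_def[symmetric] by auto
      define h where "h = 1 / real (m t)"
      have h: "0 < h" "1 / h = real (m t)" using m1 by (auto simp: h_def)
      have le: "1 / h \<le> 1 / t" "1 / t - 1 / h \<le> 1" using mr h by linarith+
      then have "t * real (m t) \<le> 1" using elim h by (simp add: field_simps)
      then have th: "t \<le> h" unfolding h_def using m1 by (simp add: pos_le_divide_eq)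
      have "\<bar>f t - f h\<bar> \<le> K * (h - t)"
        using lipschitz_onD[OF f, of t h] th by (simp add: dist_real_def)
      then have "\<bar>(f t - f h) / t\<bar> \<le> K * (h - t) / t"
        using elim by (simp add: divide_right_mono)
      also have "\<dots> = K * h * (1 / t - 1 / h)" using elim h by (simp add: field_simps)
      also have "\<dots> \<le> K * h * 1" using le K h by (intro mult_left_mono) auto
      finally have 1: "\<bar>(f t - f h) / t\<bar> \<le> K * h" by simp
      have "\<bar>f h - f 0\<bar> \<le> K * h"
        using lipschitz_onD[OF f, of h 0] h by (simp add: dist_real_def)
      then have "\<bar>(f h - f 0) * (1 / t - 1 / h)\<bar> \<le> (K * h) * 1"
        unfolding abs_mult using le by (intro mult_mono) auto
      moreover have amt: "a (m t) = (f h - f 0) / h"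
        by (simp add: a_def h_def mult.commute)
      \<comment> \<open>Passing from \<open>t\<close> to \<open>h = 1 / m t\<close>, the change of
        the numerator and the change of the denominator each contribute at most
        \<open>K * h\<close>.\<close>
      have "(f t - f 0) / t - a (m t) = (f t - f h) / t + (f h - f 0) * (1 / t - 1 / h)"
        unfolding amt using elim h(1) by (simp add: field_simps)
      ultimately have "\<bar>(f t - f 0) / t - a (m t)\<bar> \<le> K * h + K * h"
        using 1 abs_triangle_ineq[of "(f t - f h) / t" "(f h - f 0) * (1 / t - 1 / h)"] by linarith
      then show ?case by (simp add: h_def)
    qed
  qed
  from tendsto_add[OF this am] show ?thesis by simp
qed

section \<open>Directional derivatives of Lipschitz functions\<close>

definition has_dir_deriv :: "('a::euclidean_space \<Rightarrow> real) \<Rightarrow> 'a \<Rightarrow> 'a \<Rightarrow> real \<Rightarrow> bool" where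
  "has_dir_deriv u e x L \<longleftrightarrow> ((\<lambda>t. (u (x + t *\<^sub>R e) - u x) / t) \<longlongrightarrow> L) (at 0)"

lemma diff_quot_tendsto:
  assumes "has_dir_deriv u e x L"
  shows "(\<lambda>n. diff_quot u e n x) \<longlonglongrightarrow> L"
proof -
  have *: "filterlim (\<lambda>n. 1 / real n) (at 0) sequentially"
    by (rule filterlim_atI) (real_asymp, auto simp: eventually_sequentially intro!: exI[of _ 1])
  have "(\<lambda>n. (u (x + (1 / real n) *\<^sub>R e) - u x) / (1 / real n)) \<longlonglongrightarrow> L"
    using filterlim_compose[OF assms[unfolded has_dir_deriv_def] *] .
  then show ?thesis by (simp add: diff_quot_def mult.commute)
qed

lemma lipschitz_on_line:
  fixes u :: "'a::real_normed_vector \<Rightarrow> real"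
  assumes u: "C-lipschitz_on UNIV u"
  shows "(C * norm e)-lipschitz_on UNIV (\<lambda>t. u (x + t *\<^sub>R e))"
proof (rule lipschitz_onI)
  fix s t :: real
  have *: "dist (x + s *\<^sub>R e) (x + t *\<^sub>R e) = norm e * dist s t"
    by (simp add: dist_norm flip: scaleR_left_diff_distrib)
  then show "dist (u (x + s *\<^sub>R e)) (u (x + t *\<^sub>R e)) \<le> C * norm e * dist s t"
    using lipschitz_onD[OF u, of "x + s *\<^sub>R e" "x + t *\<^sub>R e"] unfolding * by (simp add: mult.assoc)
qed (use lipschitz_on_nonneg[OF u] in auto)

text \<open>The left-hand derivative along \<open>e\<close> is the negative of the right-hand one
  along \<open>- e\<close>, and right-hand derivatives are decided by the steps
  \<open>1 / n\<close>.\<close>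

lemma has_dir_deriv_iff_seq:
  assumes u: "C-lipschitz_on UNIV u"
  shows "has_dir_deriv u e x L \<longleftrightarrow>
    (\<lambda>n. diff_quot u e n x) \<longlonglongrightarrow> L \<and> (\<lambda>n. diff_quot u (- e) n x) \<longlonglongrightarrow> - L"
proof
  have neg: "has_dir_deriv u (- e) x (- L)" if "has_dir_deriv u e x L"
  proof -
    have "((\<lambda>t. (u (x + (- t) *\<^sub>R e) - u x) / (- t)) \<longlongrightarrow> L) (at 0)"
      using that unfolding has_dir_deriv_def
      by (rule filterlim_compose) (auto simp: filterlim_at intro!: tendsto_eq_intros eventually_neq_at_within)
    from tendsto_minus[OF this] show ?thesis by (simp add: has_dir_deriv_def)
  qed
  assume "has_dir_deriv u e x L"
  with neg show "(\<lambda>n. diff_quot u e n x) \<longlonglongrightarrow> L \<and> (\<lambda>n. diff_quot u (- e) n x) \<longlonglongrightarrow> - L"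
    by (auto intro: diff_quot_tendsto)
next
  assume *: "(\<lambda>n. diff_quot u e n x) \<longlonglongrightarrow> L \<and> (\<lambda>n. diff_quot u (- e) n x) \<longlonglongrightarrow> - L"
  have 1: "((\<lambda>t. (u (x + t *\<^sub>R e) - u x) / t) \<longlongrightarrow> L) (at_right 0)"
    using tendsto_at_right_slope_if_seq[OF lipschitz_on_line[OF u, of e x]] * by (simp add: diff_quot_def)
  have "((\<lambda>t. (u (x + t *\<^sub>R (- e)) - u x) / t) \<longlongrightarrow> - L) (at_right 0)"
    using tendsto_at_right_slope_if_seq[OF lipschitz_on_line[OF u, of "- e" x]] * by (simp add: diff_quot_def)
  from tendsto_minus[OF this] have "((\<lambda>t. (u (x + t *\<^sub>R e) - u x) / t) \<longlongrightarrow> L) (at_left 0)"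
    by (subst filterlim_at_left_to_right) simp
  with 1 show "has_dir_deriv u e x L"
    unfolding has_dir_deriv_def by (rule filterlim_split_at[rotated])
qed

lemma has_dir_deriv_exists_AE:
  assumes u: "C-lipschitz_on UNIV u"
  shows "AE x in lborel. \<exists>L. has_dir_deriv u e x L"
proof (rule AE_if_AE_lines)
  note [measurable] = borel_measurable_diff_quot[OF u]
  \<comment> \<open>The quantifier over \<open>L\<close> is uncountable; expressed by
    \<open>convergent\<close> and \<open>lim\<close>, the condition is visibly Borel, as
    \<open>AE_if_AE_lines\<close> requires.\<close>
  have "(\<exists>L. has_dir_deriv u e x L) \<longleftrightarrow> convergent (\<lambda>n. diff_quot u e n x) \<and>
      convergent (\<lambda>n. diff_quot u (- e) n x) \<and>
      lim (\<lambda>n. diff_quot u (- e) n x) = - lim (\<lambda>n. diff_quot u e n x)" for x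
    unfolding has_dir_deriv_iff_seq[OF u] by (metis convergent_def limI)
  moreover have [measurable]: "{x. convergent (\<lambda>n. diff_quot u d n x)} \<in> sets borel" for d
    using sets_Collect_Cauchy[of "diff_quot u d" borel] by (simp add: Cauchy_convergent_iff)
  then have "{x. convergent (\<lambda>n. diff_quot u e n x)} \<inter> {x. convergent (\<lambda>n. diff_quot u (- e) n x)} \<inter>
      {x. lim (\<lambda>n. diff_quot u (- e) n x) = - lim (\<lambda>n. diff_quot u e n x)} \<in> sets borel"
    by (intro sets.Int) measurable
  ultimately show "{x. \<exists>L. has_dir_deriv u e x L} \<in> sets borel" by (simp add: Int_def)
  fix x
  have "(u (x + (t + s) *\<^sub>R e) - u (x + t *\<^sub>R e)) = u (x + t *\<^sub>R e + s *\<^sub>R e) - u (x + t *\<^sub>R e)" for t s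
    by (simp add: algebra_simps)
  then show "AE t in lborel. \<exists>L. has_dir_deriv u e (x + t *\<^sub>R e) L"
    using lipschitz_real_slopes_converge_AE[OF lipschitz_on_line[OF u, of e x]]
    by (simp add: has_dir_deriv_def)
qed

lemma has_dir_deriv_scaleR:
  assumes "has_dir_deriv u e x L"
  shows "has_dir_deriv u (c *\<^sub>R e) x (c * L)"
proof (cases "c = 0")
  case False
  have "filterlim (\<lambda>t. t * c) (at 0) (at 0)"
    using False by (auto simp: filterlim_at eventually_at_filter intro!: tendsto_eq_intros)
  then have "((\<lambda>t. (u (x + (t * c) *\<^sub>R e) - u x) / (t * c)) \<longlongrightarrow> L) (at 0)"
    by (rule filterlim_compose[OF assms[unfolded has_dir_deriv_def]])
  from tendsto_mult_left[OF this, of c] show ?thesis using False by (simp add: has_dir_deriv_def)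
qed (simp add: has_dir_deriv_def)

text \<open>As the limit of a sequence of Borel functions it is Borel on the whole space; where the
  derivative does not exist, the value carries no information.\<close>

definition dir_deriv :: "('a::euclidean_space \<Rightarrow> real) \<Rightarrow> 'a \<Rightarrow> 'a \<Rightarrow> real" where
  "dir_deriv u e x = lim (\<lambda>n. diff_quot u e n x)"

lemma dir_deriv_eqI: "has_dir_deriv u e x L \<Longrightarrow> dir_deriv u e x = L"
  unfolding dir_deriv_def by (intro limI diff_quot_tendsto)

lemma has_dir_deriv_AE:
  assumes "C-lipschitz_on UNIV u"
  shows "AE x in lborel. has_dir_deriv u e x (dir_deriv u e x)"
  using has_dir_deriv_exists_AE[OF assms, of e] by eventually_elim (auto simp: dir_deriv_eqI)

lemma borel_measurable_dir_deriv:
  assumes "C-lipschitz_on UNIV u"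
  shows "dir_deriv u e \<in> borel_measurable borel"
proof -
  note [measurable] = borel_measurable_diff_quot[OF assms]
  show ?thesis unfolding dir_deriv_def by measurable
qed

text \<open>\<open>\<psi>\<close> is a nonnegative density whose measure gives every box its
  Lebesgue volume. Such a measure is Lebesgue measure, and densities are unique almost everywhere,
  so \<open>\<psi>\<close> is 1. Scaling by \<open>M + 1\<close> keeps \<open>\<psi>\<close>
  nonnegative and avoids dividing by 0 when \<open>M = 0\<close>.\<close>

lemma AE_zero_if_integral_box_zero:
  fixes \<phi> :: "'a::euclidean_space \<Rightarrow> real"
  assumes [measurable]: "\<phi> \<in> borel_measurable borel" and bound: "\<And>x. \<bar>\<phi> x\<bar> \<le> M"
    and zero: "\<And>l u. (\<integral>x. indicator (box l u) x * \<phi> x \<partial>lborel) = 0"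
  shows "AE x in lborel. \<phi> x = 0"
proof -
  have M: "0 \<le> M" using bound[of undefined] by linarith
  define \<psi> where "\<psi> x = 1 + \<phi> x / (M + 1)" for x
  have [measurable]: "\<psi> \<in> borel_measurable borel" unfolding \<psi>_def by measurable
  have \<psi>: "0 \<le> \<psi> x" for x using bound[of x] M by (simp add: \<psi>_def field_simps)
  have "lborel = density lborel (\<lambda>x. ennreal (\<psi> x))"
  proof (rule lborel_eqI)
    fix l u :: 'a assume lu: "\<And>b. b \<in> Basis \<Longrightarrow> l \<bullet> b \<le> u \<bullet> b"
    have i1: "integrable lborel (indicator (box l u) :: 'a \<Rightarrow> real)"
      by (intro integrable_real_indicator emeasure_lborel_box_finite) auto
    have i2: "integrable lborel (\<lambda>x. indicator (box l u) x * \<phi> x)"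
      using bound
      by (intro Bochner_Integration.integrable_bound[OF integrable_mult_right[OF i1, of M]]) (auto simp: indicator_def M)
    have i3: "integrable lborel (\<lambda>x. indicator (box l u) x * \<psi> x)"
      using i1 i2 by (simp add: \<psi>_def distrib_left)
    have "emeasure (density lborel (\<lambda>x. ennreal (\<psi> x))) (box l u) = (\<integral>\<^sup>+x. ennreal (indicator (box l u) x * \<psi> x) \<partial>lborel)"
      by (simp add: emeasure_density) (intro nn_integral_cong, auto simp: indicator_def)
    also have "\<dots> = ennreal (\<integral>x. indicator (box l u) x * \<psi> x \<partial>lborel)"
      using i3 \<psi> by (intro nn_integral_eq_integral) auto
    also have "(\<integral>x. indicator (box l u) x * \<psi> x \<partial>lborel) =
        (\<integral>x. indicator (box l u) x \<partial>lborel) + (\<integral>x. indicator (box l u) x * \<phi> x \<partial>lborel) / (M + 1)"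
      using i1 i2 by (simp add: \<psi>_def distrib_left)
    also have "\<dots> = (\<Prod>b\<in>Basis. (u - l) \<bullet> b)"
      using lu by (simp add: zero measure_lborel_box_eq)
    finally show "emeasure (density lborel (\<lambda>x. ennreal (\<psi> x))) (box l u) = ennreal (\<Prod>b\<in>Basis. (u - l) \<bullet> b)" .
  qed simp
  then have "density lborel (\<lambda>x. 1) = density lborel (\<lambda>x. ennreal (\<psi> x))" by (simp add: density_1)
  then have "AE x in lborel. 1 = ennreal (\<psi> x)"
    by (intro sigma_finite_measure.density_unique[OF sigma_finite_lborel]) auto
  then show ?thesis
  proof eventually_elim
    case (elim x)
    then have "\<psi> x = 1" using \<psi>[of x] by (metis ennreal_1 ennreal_inj zero_le_one)
    then show ?case using M by (simp add: \<psi>_def)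
  qed
qed

lemma dir_deriv_bound:
  assumes u: "C-lipschitz_on UNIV u" and "has_dir_deriv u e x (dir_deriv u e x)"
  shows "\<bar>dir_deriv u e x\<bar> \<le> C * norm e"
  using tendsto_rabs[OF diff_quot_tendsto[OF assms(2)]] 
  by (rule tendsto_upperbound) (auto simp: diff_quot_bound[OF u])

lemma lborel_integral_shift:
  fixes c :: "'a::euclidean_space" and f :: "'a \<Rightarrow> real"
  assumes [measurable]: "f \<in> borel_measurable borel"
  shows "(\<integral>x. f (x + c) \<partial>lborel) = (\<integral>x. f x \<partial>lborel)"
proof -
  have "(\<integral>x. f x \<partial>lborel) = (\<integral>x. f x \<partial>distr lborel borel ((+) c))" by (simp only: lborel_distr_plus)
  then show ?thesis by (simp add: integral_distr add.commute)
qed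

text \<open>
  Integrated over a box, the difference quotients are additive in the direction up to a translation
  of the box, which disappears in the limit; so the derivatives are additive almost everywhere.
\<close>

lemma dir_deriv_add_AE:
  fixes u :: "'a::euclidean_space \<Rightarrow> real"
  assumes u: "C-lipschitz_on UNIV u"
  shows "AE x in lborel. dir_deriv u (e + e') x = dir_deriv u e x + dir_deriv u e' x"
proof -
  note [measurable] = borel_measurable_diff_quot[OF u] borel_measurable_dir_deriv[OF u]
  have C: "0 \<le> C" using u by (rule lipschitz_on_nonneg)
  define \<phi> where "\<phi> x = dir_deriv u (e + e') x - dir_deriv u e x - dir_deriv u e' x" for x
  define M where "M = C * norm (e + e') + C * norm e + C * norm e'"
  have AE: "AE x in lborel. has_dir_deriv u (e + e') x (dir_deriv u (e + e') x) \<and>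
      has_dir_deriv u e x (dir_deriv u e x) \<and> has_dir_deriv u e' x (dir_deriv u e' x)"
    using has_dir_deriv_AE[OF u, of "e + e'"] has_dir_deriv_AE[OF u, of e] has_dir_deriv_AE[OF u, of e']
    by eventually_elim auto
  \<comment> \<open>\<open>\<phi>\<close> is known to be bounded by \<open>M\<close> only where the
    derivatives exist; clipping makes the bound hold everywhere and changes \<open>\<phi>\<close> on
    a null set only.\<close>
  define \<phi>' where "\<phi>' x = max (- M) (min M (\<phi> x))" for x
  have M: "0 \<le> M" using C by (simp add: M_def)
  have eq: "AE x in lborel. \<phi>' x = \<phi> x"
    using AE
  proof eventually_elim
    case (elim x)
    then have "\<bar>dir_deriv u (e + e') x\<bar> \<le> C * norm (e + e')" "\<bar>dir_deriv u e x\<bar> \<le> C * norm e"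
      "\<bar>dir_deriv u e' x\<bar> \<le> C * norm e'" by (auto intro: dir_deriv_bound[OF u])
    then show ?case unfolding \<phi>'_def \<phi>_def M_def by linarith
  qed
  have [measurable]: "\<phi> \<in> borel_measurable borel" "\<phi>' \<in> borel_measurable borel"
    unfolding \<phi>'_def \<phi>_def by measurable
  have "AE x in lborel. \<phi>' x = 0"
  proof (rule AE_zero_if_integral_box_zero)
    show "\<bar>\<phi>' x\<bar> \<le> M" for x using M by (auto simp: \<phi>'_def)
    fix l r :: 'a
    define I where "I = (indicator (box l r) :: 'a \<Rightarrow> real)"
    have [measurable]: "I \<in> borel_measurable borel" unfolding I_def by measurable
    have Iint: "integrable lborel I" unfolding I_def
      by (intro integrable_real_indicator emeasure_lborel_box_finite) auto
    have bd: "bounded (box l r)" by (rule bounded_box)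
    then obtain \<rho> where \<rho>: "box l r \<subseteq> ball 0 \<rho>" using bounded_subset_ballD by blast
    \<comment> \<open>The ball contains every translate of the box by at most
      \<open>norm e'\<close>, so \<open>J\<close> dominates all the shifted indicators.\<close>
    define J where "J = (indicator (ball 0 (\<rho> + norm e')) :: 'a \<Rightarrow> real)"
    have J: "integrable lborel J" unfolding J_def
      by (intro integrable_real_indicator emeasure_lborel_ball_finite) auto
    have "negligible (frontier (box l r))"
      by (intro negligible_convex_frontier convex_box)
    then have "AE x in lborel. x \<notin> frontier (box l r)"
      by (intro AE_not_in) (auto simp: negligible_iff_null_sets null_sets_completion_iff)
    then have Iconv: "AE x in lborel. (\<lambda>n. I (x - (1 / real n) *\<^sub>R e')) \<longlonglongrightarrow> I x"
    proof eventually_elim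
      case (elim x)
      then have "isCont I x" unfolding I_def by (simp add: isCont_indicator)
      moreover have "(\<lambda>n. x - (1 / real n) *\<^sub>R e') \<longlonglongrightarrow> x - 0 *\<^sub>R e'"
        by (intro tendsto_intros lim_1_over_n)
      ultimately show ?case using isCont_tendsto_compose by fastforce
    qed
    have IJ: "\<bar>I (x - (1 / real n) *\<^sub>R e')\<bar> \<le> J x" for n x
    proof (cases "x - (1 / real n) *\<^sub>R e' \<in> box l r")
      case True
      then have "norm (x - (1 / real n) *\<^sub>R e') < \<rho>" using \<rho> by auto
      moreover have "norm ((1 / real n) *\<^sub>R e') \<le> norm e'"
        by (cases "n = 0") (auto simp: divide_le_eq mult_le_cancel_left1)
      ultimately have "norm x < \<rho> + norm e'"
        using norm_triangle_sub[of x "(1 / real n) *\<^sub>R e'"] by linarith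
      then show ?thesis by (simp add: I_def J_def indicator_def)
    qed (simp add: I_def J_def)
    have IJ': "\<bar>I x\<bar> \<le> J x" for x using IJ[of x 0] by simp
    have l1: "(\<lambda>n. \<integral>x. I x * diff_quot u d n x \<partial>lborel) \<longlonglongrightarrow> (\<integral>x. I x * dir_deriv u d x \<partial>lborel)" for d
    proof (rule integral_dominated_convergence[where w = "\<lambda>x. J x * (C * norm d)"])
      show "AE x in lborel. (\<lambda>n. I x * diff_quot u d n x) \<longlonglongrightarrow> I x * dir_deriv u d x"
        using has_dir_deriv_AE[OF u, of d]
        by eventually_elim (intro tendsto_intros diff_quot_tendsto)
      show "AE x in lborel. norm (I x * diff_quot u d n x) \<le> J x * (C * norm d)" for n
        using IJ' diff_quot_bound[OF u] by (auto simp: abs_mult intro!: mult_mono order_trans[OF abs_ge_zero IJ'])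
    qed (use J in auto)
    have l2: "(\<lambda>n. \<integral>x. I (x - (1 / real n) *\<^sub>R e') * diff_quot u e n x \<partial>lborel) \<longlonglongrightarrow> (\<integral>x. I x * dir_deriv u e x \<partial>lborel)"
    proof (rule integral_dominated_convergence[where w = "\<lambda>x. J x * (C * norm e)"])
      show "AE x in lborel. (\<lambda>n. I (x - (1 / real n) *\<^sub>R e') * diff_quot u e n x) \<longlonglongrightarrow> I x * dir_deriv u e x"
        using has_dir_deriv_AE[OF u, of e] Iconv
        by eventually_elim (intro tendsto_intros diff_quot_tendsto)
      show "AE x in lborel. norm (I (x - (1 / real n) *\<^sub>R e') * diff_quot u e n x) \<le> J x * (C * norm e)" for n
        using IJ diff_quot_bound[OF u] by (auto simp: abs_mult intro!: mult_mono order_trans[OF abs_ge_zero IJ'])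
    qed (use J in auto)
    have int: "integrable lborel (\<lambda>x. I x * v x)" if "v \<in> borel_measurable borel" "AE x in lborel. \<bar>v x\<bar> \<le> K" for v K
      using that(2) that(1)
      by (intro Bochner_Integration.integrable_bound[OF integrable_mult_left[OF Iint, of K]]) (auto simp: I_def indicator_def elim: eventually_mono)
    have "(\<integral>x. I x * diff_quot u (e + e') n x \<partial>lborel) =
        (\<integral>x. I (x - (1 / real n) *\<^sub>R e') * diff_quot u e n x \<partial>lborel) + (\<integral>x. I x * diff_quot u e' n x \<partial>lborel)" for n
    proof -
      \<comment> \<open>The increment goes first along \<open>e'\<close> and then along
        \<open>e\<close>; a substitution will move the shift by \<open>e' / n\<close> from the
        quotient to the indicator.\<close>
      have "diff_quot u (e + e') n x = diff_quot u e n (x + (1 / real n) *\<^sub>R e') + diff_quot u e' n x" for x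
        by (simp add: diff_quot_def algebra_simps)
      then have "(\<integral>x. I x * diff_quot u (e + e') n x \<partial>lborel) =
         (\<integral>x. I x * diff_quot u e n (x + (1 / real n) *\<^sub>R e') + I x * diff_quot u e' n x \<partial>lborel)"
        by (simp add: distrib_left)
      also have "\<dots> = (\<integral>x. I x * diff_quot u e n (x + (1 / real n) *\<^sub>R e') \<partial>lborel) + (\<integral>x. I x * diff_quot u e' n x \<partial>lborel)"
        using diff_quot_bound[OF u] by (intro Bochner_Integration.integral_add int) auto
      also have "(\<integral>x. I x * diff_quot u e n (x + (1 / real n) *\<^sub>R e') \<partial>lborel) =
          (\<integral>x. I (x - (1 / real n) *\<^sub>R e') * diff_quot u e n x \<partial>lborel)"
        using lborel_integral_shift[of "\<lambda>x. I (x - (1 / real n) *\<^sub>R e') * diff_quot u e n x" "(1 / real n) *\<^sub>R e'"] by simp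
      finally show ?thesis .
    qed
    then have "(\<lambda>n. \<integral>x. I x * diff_quot u (e + e') n x \<partial>lborel) \<longlonglongrightarrow>
        (\<integral>x. I x * dir_deriv u e x \<partial>lborel) + (\<integral>x. I x * dir_deriv u e' x \<partial>lborel)"
      using tendsto_add[OF l2 l1[of e']] by simp
    then have sum: "(\<integral>x. I x * dir_deriv u (e + e') x \<partial>lborel) =
        (\<integral>x. I x * dir_deriv u e x \<partial>lborel) + (\<integral>x. I x * dir_deriv u e' x \<partial>lborel)"
      using l1[of "e + e'"] LIMSEQ_unique by blast
    have dint: "integrable lborel (\<lambda>x. I x * dir_deriv u d x)" for d
      using has_dir_deriv_AE[OF u, of d]
      by (intro int[where K = "C * norm d"]) (auto intro: dir_deriv_bound[OF u] elim!: eventually_mono)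
    have "(\<integral>x. I x * \<phi>' x \<partial>lborel) = (\<integral>x. I x * \<phi> x \<partial>lborel)"
      using eq by (intro integral_cong_AE) (auto elim!: eventually_mono)
    also have "\<dots> = (\<integral>x. I x * dir_deriv u (e + e') x \<partial>lborel) - (\<integral>x. I x * dir_deriv u e x \<partial>lborel) - (\<integral>x. I x * dir_deriv u e' x \<partial>lborel)"
      using dint by (simp add: \<phi>_def right_diff_distrib)
    also have "\<dots> = 0" using sum by simp
    finally show "(\<integral>x. indicator (box l r) x * \<phi>' x \<partial>lborel) = 0" unfolding I_def .
  qed simp
  with eq show ?thesis by eventually_elim (simp add: \<phi>_def)
qed

lemma has_dir_deriv_inner_AE:
  fixes u :: "'a::euclidean_space \<Rightarrow> real"
  assumes u: "C-lipschitz_on UNIV u"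
  shows "AE x in lborel. has_dir_deriv u e x (\<Sum>b\<in>Basis. (e \<bullet> b) * dir_deriv u b x)"
proof -
  have "AE x in lborel. has_dir_deriv u (\<Sum>b\<in>B. (e \<bullet> b) *\<^sub>R b) x (\<Sum>b\<in>B. (e \<bullet> b) * dir_deriv u b x)"
    if "finite B" for B :: "'a set"
    using that
  proof (induction B rule: finite_induct)
    case empty
    then show ?case by (simp add: has_dir_deriv_def)
  next
    case (insert b B)
    let ?d = "\<Sum>b\<in>B. (e \<bullet> b) *\<^sub>R b"
    show ?case
      using insert.IH has_dir_deriv_AE[OF u, of b] has_dir_deriv_AE[OF u, of "(e \<bullet> b) *\<^sub>R b + ?d"]
        dir_deriv_add_AE[OF u, of "(e \<bullet> b) *\<^sub>R b" ?d]
    proof eventually_elim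
      case (elim x)
      have "dir_deriv u ?d x = (\<Sum>b\<in>B. (e \<bullet> b) * dir_deriv u b x)"
        "dir_deriv u ((e \<bullet> b) *\<^sub>R b) x = (e \<bullet> b) * dir_deriv u b x"
        using elim by (auto intro: dir_deriv_eqI has_dir_deriv_scaleR)
      with elim insert.hyps show ?case by simp
    qed
  qed
  from this[of Basis] show ?thesis by (simp add: euclidean_representation)
qed

text \<open>By compactness, finitely many directions of the dense set \<open>D\<close> come within
  \<eta> of every unit vector, and for finitely many directions the limits are uniform. The
  Lipschitz condition transfers the estimate to all other directions.\<close>

lemma has_derivative_if_dir_derivs:
  fixes u :: "'a::euclidean_space \<Rightarrow> real"
  assumes u: "C-lipschitz_on UNIV u"
    and dense: "\<And>X::'a set. open X \<Longrightarrow> X \<noteq> {} \<Longrightarrow> \<exists>d\<in>D. d \<in> X"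
    and D: "\<And>d. d \<in> D \<Longrightarrow> has_dir_deriv u d x (d \<bullet> g)"
  shows "GDERIV u x :> g"
  unfolding gderiv_def has_derivative_at'
proof (intro conjI allI impI)
  show "bounded_linear (\<lambda>h. h \<bullet> g)" by (rule bounded_linear_inner_left)
  fix \<epsilon> :: real assume \<epsilon>: "0 < \<epsilon>"
  have C: "0 \<le> C" using u by (rule lipschitz_on_nonneg)
  \<comment> \<open>Replacing a direction by one at distance below \<eta> costs at most
    \<open>C * \<eta>\<close> in the quotient and \<open>\<eta> * norm g\<close> in the linear part,
    together at most \<open>\<epsilon> / 2\<close>; the 1 keeps the denominator positive.\<close>
  define \<eta> where "\<eta> = \<epsilon> / (2 * (C + norm g + 1))"
  have \<eta>: "0 < \<eta>" using \<epsilon> C by (simp add: \<eta>_def add_nonneg_pos)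
  have "sphere (0::'a) 1 \<subseteq> (\<Union>d\<in>D. ball d \<eta>)"
  proof
    fix s :: 'a
    obtain d where "d \<in> D" "d \<in> ball s \<eta>" using dense[of "ball s \<eta>"] \<eta> by auto
    then show "s \<in> (\<Union>d\<in>D. ball d \<eta>)" by (auto simp: dist_commute)
  qed
  then obtain B where B: "B \<subseteq> D" "finite B" "sphere (0::'a) 1 \<subseteq> (\<Union>d\<in>B. ball d \<eta>)"
    using compactE_image[OF compact_sphere, of D "\<lambda>d. ball d \<eta>"] by (metis open_ball)
  have "\<forall>\<^sub>F t in at 0. \<forall>d\<in>B. dist ((u (x + t *\<^sub>R d) - u x) / t) (d \<bullet> g) < \<epsilon> / 2"
    using B(1,2) \<epsilon> D unfolding has_dir_deriv_def
    by (intro eventually_ball_finite ballI tendstoD) auto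
  then obtain \<delta> where \<delta>: "\<delta> > 0"
    "\<And>t d. t \<noteq> 0 \<Longrightarrow> \<bar>t\<bar> < \<delta> \<Longrightarrow> d \<in> B \<Longrightarrow> dist ((u (x + t *\<^sub>R d) - u x) / t) (d \<bullet> g) < \<epsilon> / 2"
    unfolding eventually_at by (auto simp: dist_real_def)
  show "\<exists>\<delta>>0. \<forall>y. 0 < norm (y - x) \<and> norm (y - x) < \<delta> \<longrightarrow>
      norm (u y - u x - (y - x) \<bullet> g) / norm (y - x) < \<epsilon>"
  proof (intro exI[of _ \<delta>] conjI allI impI)
    fix y assume y: "0 < norm (y - x) \<and> norm (y - x) < \<delta>"
    define t where "t = norm (y - x)"
    define s where "s = (y - x) /\<^sub>R t"
    have t: "0 < t" "t < \<delta>" using y by (auto simp: t_def)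
    have "norm s = 1" using t by (simp add: s_def t_def)
    then obtain d where d: "d \<in> B" "norm (d - s) < \<eta>" using B(3) by (auto simp: dist_norm)
    have ys: "y = x + t *\<^sub>R s" using t by (simp add: s_def)
    have "\<bar>u (x + t *\<^sub>R s) - u (x + t *\<^sub>R d)\<bar> \<le> C * (t * norm (d - s))"
      using lipschitz_onD[OF u, of "x + t *\<^sub>R s" "x + t *\<^sub>R d"] t
      by (simp add: dist_norm norm_minus_commute[of s] flip: scaleR_right_diff_distrib)
    also have "\<dots> \<le> C * (t * \<eta>)" using d C t by (intro mult_left_mono) auto
    finally have 1: "\<bar>u y - u (x + t *\<^sub>R d)\<bar> \<le> C * (t * \<eta>)" by (simp add: ys)
    have "\<bar>(u (x + t *\<^sub>R d) - u x) / t - d \<bullet> g\<bar> < \<epsilon> / 2"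
      using \<delta>(2)[of t d] t d by (simp add: dist_real_def)
    moreover have "u (x + t *\<^sub>R d) - u x - t * (d \<bullet> g) = t * ((u (x + t *\<^sub>R d) - u x) / t - d \<bullet> g)"
      using t by (simp add: field_simps)
    ultimately have 2: "\<bar>u (x + t *\<^sub>R d) - u x - t * (d \<bullet> g)\<bar> < t * (\<epsilon> / 2)"
      using t by (simp only: abs_mult abs_of_pos mult_strict_left_mono)
    have "\<bar>(d - s) \<bullet> g\<bar> \<le> norm (d - s) * norm g" by (rule Cauchy_Schwarz_ineq2)
    also have "\<dots> \<le> \<eta> * norm g" using d by (intro mult_right_mono) auto
    finally have 3: "\<bar>t * ((d - s) \<bullet> g)\<bar> \<le> t * (\<eta> * norm g)" using t by (simp add: abs_mult)
    have "u y - u x - (y - x) \<bullet> g = (u y - u (x + t *\<^sub>R d)) + (u (x + t *\<^sub>R d) - u x - t * (d \<bullet> g)) + t * ((d - s) \<bullet> g)"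
      by (simp add: ys algebra_simps inner_diff_left)
    then have "\<bar>u y - u x - (y - x) \<bullet> g\<bar> < C * (t * \<eta>) + t * (\<epsilon> / 2) + t * (\<eta> * norm g)"
      using 1 2 3 by linarith
    also have "\<dots> = t * (\<eta> * (C + norm g) + \<epsilon> / 2)" by (simp add: algebra_simps)
    also have "\<dots> \<le> t * (\<eta> * (C + norm g + 1) + \<epsilon> / 2)" using t \<eta> by (intro mult_left_mono add_right_mono) auto
    also have "\<eta> * (C + norm g + 1) = \<epsilon> / 2"
      using C norm_ge_zero[of g] by (simp add: \<eta>_def field_simps add_nonneg_eq_0_iff)
    finally have "\<bar>u y - u x - (y - x) \<bullet> g\<bar> < t * \<epsilon>" by simp
    then show "norm (u y - u x - (y - x) \<bullet> g) / norm (y - x) < \<epsilon>"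
      using t unfolding t_def[symmetric] by (simp add: field_simps)
  qed (rule \<delta>(1))
qed

text \<open>The exceptional null set for linearity depends on the direction. A countable dense set
  of directions leaves one null set, off which density suffices for full differentiability.\<close>

theorem Rademacher:
  fixes u :: "'a::euclidean_space \<Rightarrow> real"
  assumes u: "C-lipschitz_on UNIV u"
  shows "AE x in lborel. GDERIV u x :> (\<Sum>b\<in>Basis. dir_deriv u b x *\<^sub>R b)"
proof -
  obtain D :: "'a set" where D: "countable D" "\<And>X. open X \<Longrightarrow> X \<noteq> {} \<Longrightarrow> \<exists>d\<in>D. d \<in> X"
    by (rule countable_dense_setE) blast
  have "AE x in lborel. \<forall>d\<in>D. has_dir_deriv u d x (\<Sum>b\<in>Basis. (d \<bullet> b) * dir_deriv u b x)"
    using has_dir_deriv_inner_AE[OF u] D(1) by (simp add: AE_ball_countable)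
  then show ?thesis
  proof eventually_elim
    case (elim x)
    then show ?case
      by (intro has_derivative_if_dir_derivs[OF u D(2)]) (auto simp: inner_sum_right mult.commute)
  qed
qed

section \<open>Lipschitz functions and their gradients\<close>

text \<open>McShane's formula: the infimum of the cones \<open>v y + C * dist x y\<close>, each
  \<open>C\<close>-Lipschitz in \<open>x\<close>. Any point of \<open>A\<close> provides the lower
  bound that keeps the infimum finite.\<close>

lemma lipschitz_extension_UNIV:
  fixes v :: "'a::metric_space \<Rightarrow> real"
  assumes v: "C-lipschitz_on A v"
  obtains V where "C-lipschitz_on UNIV V" "\<And>x. x \<in> A \<Longrightarrow> V x = v x"
proof (cases "A = {}")
  case True
  show ?thesis
    by (rule that[of "\<lambda>_. 0"]) (use True lipschitz_on_nonneg[OF v] in \<open>auto simp: lipschitz_on_def\<close>)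
next
  case False
  have C: "0 \<le> C" using v by (rule lipschitz_on_nonneg)
  define V where "V x = (INF y\<in>A. v y + C * dist x y)" for x
  have bdd: "bdd_below ((\<lambda>y. v y + C * dist x y) ` A)" for x
  proof -
    obtain z where z: "z \<in> A" using False by blast
    have "v z - C * dist z x \<le> v y + C * dist x y" if "y \<in> A" for y
    proof -
      have "v z - v y \<le> C * dist z y"
        using lipschitz_onD[OF v z that] by (simp add: dist_real_def)
      also have "\<dots> \<le> C * (dist z x + dist x y)" using C by (intro mult_left_mono dist_triangle)
      finally show ?thesis by (simp add: algebra_simps)
    qed
    then show ?thesis by (auto simp: bdd_below_def)
  qed
  have le: "V x \<le> V z + C * dist x z" for x z
  proof -
    have "V x - C * dist x z \<le> V z"
      unfolding V_def[of z]
    proof (rule cINF_greatest[OF False])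
      fix y assume y: "y \<in> A"
      have "V x \<le> v y + C * dist x y" unfolding V_def by (rule cINF_lower[OF bdd y])
      also have "\<dots> \<le> v y + C * (dist x z + dist z y)"
        using C by (intro add_left_mono mult_left_mono dist_triangle)
      finally show "V x - C * dist x z \<le> v y + C * dist z y" by (simp add: algebra_simps)
    qed
    then show ?thesis by simp
  qed
  have "C-lipschitz_on UNIV V"
  proof (rule lipschitz_onI[OF _ C])
    fix x z show "dist (V x) (V z) \<le> C * dist x z"
      using le[of x z] le[of z x] by (auto simp: dist_real_def dist_commute abs_le_iff)
  qed
  moreover have "V x = v x" if x: "x \<in> A" for x
  proof (rule antisym)
    show "V x \<le> v x" using cINF_lower[OF bdd x, of x] by (simp add: V_def)
    show "v x \<le> V x"
      unfolding V_def
    proof (rule cINF_greatest[OF False])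
      fix y assume "y \<in> A"
      then show "v x \<le> v y + C * dist x y"
        using lipschitz_onD[OF v x, of y] by (simp add: dist_real_def abs_le_iff)
    qed
  qed
  ultimately show ?thesis by (rule that)
qed

section \<open>Locality and measurability of the gradient\<close>

lemma GDERIV_unique:
  assumes "GDERIV v x :> D" "GDERIV v x :> E"
  shows "D = E"
proof -
  have "(\<lambda>h. h \<bullet> D) = (\<lambda>h. h \<bullet> E)"
    using assms unfolding gderiv_def by (rule has_derivative_unique)
  then have "(D - E) \<bullet> D = (D - E) \<bullet> E" by metis
  then have "(D - E) \<bullet> (D - E) = 0" by (simp add: inner_diff_right)
  then show ?thesis by simp
qed

lemma gradient_eqI: "GDERIV v x :> D \<Longrightarrow> \<nabla> v x = D"
  unfolding gradient_def using GDERIV_unique by (metis the_equality)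

lemma GDERIV_cong_open:
  assumes "open \<Omega>" "x \<in> \<Omega>" "\<And>y. y \<in> \<Omega> \<Longrightarrow> v y = w y"
  shows "GDERIV v x :> D \<longleftrightarrow> GDERIV w x :> D"
  unfolding gderiv_def using assms
  by (auto elim!: has_derivative_transform_within_open)

lemma gradient_cong_open:
  assumes "open \<Omega>" "x \<in> \<Omega>" "\<And>y. y \<in> \<Omega> \<Longrightarrow> v y = w y"
  shows "\<nabla> v x = \<nabla> w x"
proof -
  have "gderiv v x = gderiv w x"
  proof
    fix D show "GDERIV v x :> D \<longleftrightarrow> GDERIV w x :> D" using assms by (rule GDERIV_cong_open)
  qed
  then show ?thesis unfolding gradient_def by (simp only:)
qed

lemma has_dir_deriv_if_GDERIV:
  assumes "GDERIV u x :> D"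
  shows "has_dir_deriv u e x (D \<bullet> e)"
proof -
  have "((\<lambda>t. x + t *\<^sub>R e) has_derivative (\<lambda>t. t *\<^sub>R e)) (at 0)"
    by (auto intro!: derivative_eq_intros)
  moreover have "(u has_derivative (\<lambda>h. h \<bullet> D)) (at (x + 0 *\<^sub>R e))"
    using assms by (simp add: gderiv_def)
  ultimately have "((\<lambda>t. u (x + t *\<^sub>R e)) has_derivative (\<lambda>t. (t *\<^sub>R e) \<bullet> D)) (at 0)"
    by (rule has_derivative_compose)
  then have "((\<lambda>t. u (x + t *\<^sub>R e)) has_field_derivative (D \<bullet> e)) (at 0)"
    unfolding has_field_derivative_def by (rule has_derivative_eq_rhs) (auto simp: fun_eq_iff inner_commute)
  then show ?thesis by (simp add: has_dir_deriv_def DERIV_def)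
qed

lemma GDERIV_gradient_AE:
  fixes v :: "'a::euclidean_space \<Rightarrow> real"
  assumes "C-lipschitz_on UNIV v"
  shows "AE x in lborel. GDERIV v x :> \<nabla> v x"
  using Rademacher[OF assms] by eventually_elim (auto simp: gradient_eqI)

lemma borel_measurable_gradient:
  fixes v :: "'a::euclidean_space \<Rightarrow> real"
  assumes "C-lipschitz_on UNIV v"
  shows "\<nabla> v \<in> borel_measurable lebesgue"
proof -
  note [measurable] = borel_measurable_dir_deriv[OF assms]
  define D where "D x = (\<Sum>b\<in>Basis. dir_deriv v b x *\<^sub>R b)" for x
  have "D \<in> borel_measurable lborel" unfolding D_def by measurable
  then have "D \<in> borel_measurable lebesgue" by (rule measurable_completion)
  moreover have "AE x in lebesgue. D x = \<nabla> v x"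
    using Rademacher[OF assms] by (intro AE_completion) (auto simp: D_def gradient_eqI elim: eventually_mono)
  ultimately show ?thesis
    by (rule borel_measurable_AE)
qed

section \<open>Energies of difference quotients\<close>

lemma nn_integral_lborel_shift:
  fixes c :: "'a::euclidean_space"
  assumes [measurable]: "f \<in> borel_measurable borel"
  shows "(\<integral>\<^sup>+x. f (x + c) \<partial>lborel) = (\<integral>\<^sup>+x. f x \<partial>lborel)"
proof -
  have "(\<integral>\<^sup>+x. f (x + c) \<partial>lborel) = (\<integral>\<^sup>+x. f x \<partial>distr lborel borel ((+) c))"
    by (subst nn_integral_distr) (auto simp: add.commute)
  then show ?thesis by (simp only: lborel_distr_plus)
qed

text \<open>A quotient with step \<open>1 / n\<close> is the mean of two quotients with half the
  step, one of them shifted; convexity of the square and translation invariance do the rest.\<close>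

lemma nn_integral_diff_quot_double:
  fixes w :: "'a::euclidean_space \<Rightarrow> real"
  assumes w: "C-lipschitz_on UNIV w" and n: "0 < n"
  shows "(\<integral>\<^sup>+x. ennreal ((diff_quot w e n x)\<^sup>2) \<partial>lborel) \<le> (\<integral>\<^sup>+x. ennreal ((diff_quot w e (2 * n) x)\<^sup>2) \<partial>lborel)"
proof -
  note [measurable] = borel_measurable_diff_quot[OF w]
  define c where "c = (1 / real (2 * n)) *\<^sub>R e"
  let ?q = "\<lambda>x. ennreal ((diff_quot w e (2 * n) x)\<^sup>2)"
  have "(1 / real n) *\<^sub>R e = c + c" using n by (simp add: c_def flip: scaleR_left_distrib)
  then have split: "diff_quot w e n x = (diff_quot w e (2 * n) x + diff_quot w e (2 * n) (x + c)) / 2" for x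
    using n unfolding diff_quot_def \<open>(1 / real n) *\<^sub>R e = c + c\<close> c_def[symmetric] by (simp add: algebra_simps)
  have "ennreal ((diff_quot w e n x)\<^sup>2) \<le> ennreal (1/2) * (?q x + ?q (x + c))" for x
  proof -
    let ?p = "diff_quot w e (2 * n) x" and ?r = "diff_quot w e (2 * n) (x + c)"
    have "((?p + ?r) / 2)\<^sup>2 \<le> 1/2 * (?p\<^sup>2 + ?r\<^sup>2)"
      using zero_le_power2[of "?p - ?r"] by (simp add: power2_eq_square algebra_simps)
    then have "ennreal ((diff_quot w e n x)\<^sup>2) \<le> ennreal (1/2 * (?p\<^sup>2 + ?r\<^sup>2))"
      unfolding split by (rule ennreal_leI)
    also have "\<dots> = ennreal (1/2) * (?q x + ?q (x + c))"
      by (subst ennreal_mult) auto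
    finally show ?thesis .
  qed
  then have "(\<integral>\<^sup>+x. ennreal ((diff_quot w e n x)\<^sup>2) \<partial>lborel) \<le> (\<integral>\<^sup>+x. ennreal (1/2) * (?q x + ?q (x + c)) \<partial>lborel)"
    by (rule nn_integral_mono)
  also have "\<dots> = ennreal (1/2) * ((\<integral>\<^sup>+x. ?q x \<partial>lborel) + (\<integral>\<^sup>+x. ?q (x + c) \<partial>lborel))"
    by (simp add: nn_integral_cmult nn_integral_add)
  also have "(\<integral>\<^sup>+x. ?q (x + c) \<partial>lborel) = (\<integral>\<^sup>+x. ?q x \<partial>lborel)"
    by (rule nn_integral_lborel_shift) measurable
  also have "ennreal (1/2) * ((\<integral>\<^sup>+x. ?q x \<partial>lborel) + (\<integral>\<^sup>+x. ?q x \<partial>lborel)) = (\<integral>\<^sup>+x. ?q x \<partial>lborel)"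
  proof -
    have "ennreal (1/2) * (y + y) = y" for y :: ennreal
    proof -
      have "ennreal (1/2) * (y + y) = (ennreal (1/2) * 2) * y" by (simp add: mult_2 distrib_left distrib_right mult.assoc)
      also have "ennreal (1/2) * ennreal 2 = ennreal 1" by (subst ennreal_mult[symmetric]) auto
      then have "ennreal (1/2) * 2 = 1" by (simp only: ennreal_numeral ennreal_1)
      finally show ?thesis by simp
    qed
    then show ?thesis .
  qed
  finally show ?thesis .
qed

lemma nn_integral_diff_quot_mult_power2:
  fixes w :: "'a::euclidean_space \<Rightarrow> real"
  assumes w: "C-lipschitz_on UNIV w" and n: "0 < n"
  shows "(\<integral>\<^sup>+x. ennreal ((diff_quot w e n x)\<^sup>2) \<partial>lborel) \<le> (\<integral>\<^sup>+x. ennreal ((diff_quot w e (2 ^ k * n) x)\<^sup>2) \<partial>lborel)"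
proof (induction k)
  case (Suc k)
  show ?case
    using order_trans[OF Suc nn_integral_diff_quot_double[OF w, of "2 ^ k * n"]] n by (simp add: mult.assoc)
qed simp

lemma filterlim_power2_mult_nat: "0 < n \<Longrightarrow> filterlim (\<lambda>k. 2 ^ k * n :: nat) sequentially sequentially"
proof (rule filterlim_at_top_mono[OF filterlim_ident])
  assume n: "0 < n"
  have "k \<le> 2 ^ k * n" for k
  proof -
    have "k * 1 \<le> 2 ^ k * n" using n by (intro mult_mono) (auto intro: less_imp_le[OF less_exp])
    then show ?thesis by simp
  qed
  then show "\<forall>\<^sub>F k in sequentially. k \<le> 2 ^ k * n" by (rule always_eventually[OF allI])
qed

text \<open>
  Halving steps, the energy of a difference quotient is dominated by that of ever finer ones,
  hence by the Dirichlet energy; this needs no Fubini argument on lines. Truncating \<open>w\<close> near \<open>0\<close>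
  avoids any assumption on the measure of the boundary.
\<close>

lemma nn_integral_diff_quot_le:
  fixes w :: "'a::euclidean_space \<Rightarrow> real"
  assumes w: "C-lipschitz_on UNIV w" and \<Omega>: "open \<Omega>" "bounded \<Omega>" and zero: "\<And>x. x \<notin> \<Omega> \<Longrightarrow> w x = 0" and n: "0 < n"
  shows "(\<integral>\<^sup>+x. ennreal ((diff_quot w e n x)\<^sup>2) \<partial>lborel) \<le> (\<integral>\<^sup>+x. ennreal ((dir_deriv w e x)\<^sup>2) * indicator \<Omega> x \<partial>lborel)"
proof -
  have C: "0 \<le> C" using w by (rule lipschitz_on_nonneg)
  have [measurable]: "\<Omega> \<in> sets borel" using \<Omega> by simp
  have wc: "continuous_on UNIV w" using w by (rule lipschitz_on_continuous_on)
  obtain \<rho> where \<rho>: "\<Omega> \<subseteq> ball 0 \<rho>" using \<Omega>(2) bounded_subset_ballD by blast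
  \<comment> \<open>Soft thresholding: a 1-Lipschitz function of the value of \<open>w\<close> that
    vanishes where \<open>\<bar>w x\<bar> \<le> \<delta>\<close>, so difference quotients do not
    grow.\<close>
  define trunc where "trunc \<delta> x = w x - max (- \<delta>) (min \<delta> (w x))" for \<delta> x
  have trunc_le: "\<bar>trunc \<delta> x - trunc \<delta> y\<bar> \<le> \<bar>w x - w y\<bar>" if "0 < \<delta>" for \<delta> x y
    using that unfolding trunc_def by linarith
  have dq_le: "\<bar>diff_quot (trunc \<delta>) e m x\<bar> \<le> \<bar>diff_quot w e m x\<bar>" if "0 < \<delta>" for \<delta> m x
    unfolding diff_quot_def abs_mult using trunc_le[OF that] by (intro mult_left_mono) auto
  have dq2: "(diff_quot (trunc \<delta>) e m x)\<^sup>2 \<le> (C * norm e)\<^sup>2" "(diff_quot w e m x)\<^sup>2 \<le> (C * norm e)\<^sup>2" if "0 < \<delta>" for \<delta> m x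
    using dq_le[OF that, of m x] diff_quot_bound[OF w, of e m x] C
    by (auto intro!: abs_le_square_iff[THEN iffD1])
  have trunc_lip: "C-lipschitz_on UNIV (trunc \<delta>)" if "0 < \<delta>" for \<delta>
  proof (rule lipschitz_onI[OF _ C])
    fix x y show "dist (trunc \<delta> x) (trunc \<delta> y) \<le> C * dist x y"
      using trunc_le[OF that, of x y] lipschitz_onD[OF w, of x y] by (simp add: dist_real_def)
  qed
  have bound: "(\<integral>\<^sup>+x. ennreal ((diff_quot (trunc \<delta>) e n x)\<^sup>2) \<partial>lborel) \<le> (\<integral>\<^sup>+x. ennreal ((dir_deriv w e x)\<^sup>2) * indicator \<Omega> x \<partial>lborel)"
    if \<delta>: "0 < \<delta>" for \<delta>
  proof -
    note [measurable] = borel_measurable_diff_quot[OF trunc_lip[OF \<delta>]] borel_measurable_diff_quot[OF w]  borel_measurable_dir_deriv[OF w]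
    let ?m = "\<lambda>k. 2 ^ k * n"
    have m: "filterlim ?m sequentially sequentially" using n by (rule filterlim_power2_mult_nat)
    define a where "a k = (\<integral>\<^sup>+x. ennreal ((diff_quot w e (?m k) x)\<^sup>2) * indicator \<Omega> x \<partial>lborel)" for k
    \<comment> \<open>Off \<Omega>, \<open>w\<close> is 0 at \<open>x\<close> and, for small steps,
      smaller than \<delta> at the shifted point. So the quotients of \<open>trunc \<delta>\<close>
      are eventually 0 there, and \<open>b\<close> tends to 0.\<close>
    define b where "b k = (\<integral>\<^sup>+x. ennreal ((diff_quot (trunc \<delta>) e (?m k) x)\<^sup>2) * indicator (- \<Omega>) x \<partial>lborel)" for k
    have [measurable]: "ball (0::'a) r \<in> sets borel" for r by simp
    have "(\<integral>\<^sup>+x. ennreal ((diff_quot (trunc \<delta>) e n x)\<^sup>2) \<partial>lborel) \<le> a k + b k" for k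
    proof -
      have "(\<integral>\<^sup>+x. ennreal ((diff_quot (trunc \<delta>) e n x)\<^sup>2) \<partial>lborel) \<le> (\<integral>\<^sup>+x. ennreal ((diff_quot (trunc \<delta>) e (?m k) x)\<^sup>2) \<partial>lborel)"
        using nn_integral_diff_quot_mult_power2[OF trunc_lip[OF \<delta>] n] .
      also have "\<dots> \<le> (\<integral>\<^sup>+x. ennreal ((diff_quot w e (?m k) x)\<^sup>2) * indicator \<Omega> x +
          ennreal ((diff_quot (trunc \<delta>) e (?m k) x)\<^sup>2) * indicator (- \<Omega>) x \<partial>lborel)"
        using dq_le[OF \<delta>]
        by (intro nn_integral_mono) (auto simp: indicator_def abs_le_square_iff intro!: ennreal_leI)
      also have "\<dots> = a k + b k" unfolding a_def b_def by (intro nn_integral_add) measurable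
      finally show ?thesis .
    qed
    moreover have "a \<longlonglongrightarrow> (\<integral>\<^sup>+x. ennreal ((dir_deriv w e x)\<^sup>2) * indicator \<Omega> x \<partial>lborel)"
      unfolding a_def
    proof (rule nn_integral_dominated_convergence[where w = "\<lambda>x. ennreal ((C * norm e)\<^sup>2) * indicator \<Omega> x"])
      show "(\<integral>\<^sup>+x. ennreal ((C * norm e)\<^sup>2) * indicator \<Omega> x \<partial>lborel) < \<infinity>"
        using emeasure_bounded_finite[OF \<Omega>(2)] by (simp add: nn_integral_cmult ennreal_mult_less_top)
      show "AE x in lborel. (\<lambda>k. ennreal ((diff_quot w e (?m k) x)\<^sup>2) * indicator \<Omega> x) \<longlonglongrightarrow> ennreal ((dir_deriv w e x)\<^sup>2) * indicator \<Omega> x"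
        using has_dir_deriv_AE[OF w, of e]
      proof eventually_elim
        case (elim x)
        have "(\<lambda>k. ennreal ((diff_quot w e (?m k) x)\<^sup>2)) \<longlonglongrightarrow> ennreal ((dir_deriv w e x)\<^sup>2)"
          by (intro tendsto_ennrealI tendsto_power filterlim_compose[OF diff_quot_tendsto[OF elim] m])
        then show ?case by (cases "x \<in> \<Omega>") auto
      qed
    qed (use dq2[OF \<delta>] in \<open>auto simp: indicator_def intro!: ennreal_leI\<close>)
    moreover have "b \<longlonglongrightarrow> (\<integral>\<^sup>+x. 0 \<partial>(lborel :: 'a measure))"
      unfolding b_def
    \<comment> \<open>With a step of at most 1, a quotient vanishes unless \<open>x\<close> or the
      shifted point lies in \<Omega>; hence all quotients are supported in this ball.\<close>
    proof (rule nn_integral_dominated_convergence[where w = "\<lambda>x. ennreal ((C * norm e)\<^sup>2) * indicator (ball 0 (\<rho> + norm e)) x"])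
      show "(\<integral>\<^sup>+x. ennreal ((C * norm e)\<^sup>2) * indicator (ball (0::'a) (\<rho> + norm e)) x \<partial>lborel) < \<infinity>"
        using emeasure_bounded_finite[OF bounded_ball, of "0::'a" "\<rho> + norm e"]
        by (subst nn_integral_cmult_indicator) (simp_all add: ennreal_mult_less_top)
      show "AE x in lborel. ennreal ((diff_quot (trunc \<delta>) e (?m k) x)\<^sup>2) * indicator (- \<Omega>) x
          \<le> ennreal ((C * norm e)\<^sup>2) * indicator (ball 0 (\<rho> + norm e)) x" for k
      proof (rule AE_I2)
        fix x :: 'a
        show "ennreal ((diff_quot (trunc \<delta>) e (?m k) x)\<^sup>2) * indicator (- \<Omega>) x
          \<le> ennreal ((C * norm e)\<^sup>2) * indicator (ball 0 (\<rho> + norm e)) x"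
        proof (cases "x \<in> ball 0 (\<rho> + norm e)")
          case True
          then show ?thesis using dq2[OF \<delta>] by (auto simp: indicator_def intro!: ennreal_leI)
        next
          case False
          have m1: "1 \<le> real (?m k)" using n by (simp add: Suc_leI flip: of_nat_mult of_nat_power)
          have "norm ((1 / real (?m k)) *\<^sub>R e) \<le> norm e"
            using m1 by (simp add: divide_le_eq mult_le_cancel_left1)
          then have "\<not> norm (x + (1 / real (?m k)) *\<^sub>R e) < \<rho>" "\<not> norm x < \<rho>"
            using False norm_triangle_ineq4[of "x + (1 / real (?m k)) *\<^sub>R e" "(1 / real (?m k)) *\<^sub>R e"] norm_ge_zero[of e]
            unfolding mem_ball dist_norm add_diff_cancel_right' diff_0 norm_minus_cancel by linarith+
          then have "w (x + (1 / real (?m k)) *\<^sub>R e) = 0" "w x = 0" using \<rho> by (auto intro!: zero)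
          then have "diff_quot (trunc \<delta>) e (?m k) x = 0" by (simp add: diff_quot_def trunc_def)
          then show ?thesis by simp
        qed
      qed
      show "AE x in lborel. (\<lambda>k. ennreal ((diff_quot (trunc \<delta>) e (?m k) x)\<^sup>2) * indicator (- \<Omega>) x) \<longlonglongrightarrow> 0"
      proof (rule AE_I2)
        fix x :: 'a
        show "(\<lambda>k. ennreal ((diff_quot (trunc \<delta>) e (?m k) x)\<^sup>2) * indicator (- \<Omega>) x) \<longlonglongrightarrow> 0"
        proof (cases "x \<in> \<Omega>")
          case False
          have "(\<lambda>k. w (x + (1 / real (?m k)) *\<^sub>R e)) \<longlonglongrightarrow> w (x + 0 *\<^sub>R e)"
            using wc by (intro continuous_on_tendsto_compose[OF wc] tendsto_intros filterlim_compose[OF lim_1_over_n m]) auto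
          then have "(\<lambda>k. w (x + (1 / real (?m k)) *\<^sub>R e)) \<longlonglongrightarrow> 0" using zero[OF False] by simp
          then have "\<forall>\<^sub>F k in sequentially. \<bar>w (x + (1 / real (?m k)) *\<^sub>R e)\<bar> < \<delta>"
            using \<delta> by (auto dest: tendstoD simp: dist_real_def)
          then have "\<forall>\<^sub>F k in sequentially. diff_quot (trunc \<delta>) e (?m k) x = 0"
            by eventually_elim (use zero[OF False] \<delta> in \<open>auto simp: diff_quot_def trunc_def\<close>)
          then have "\<forall>\<^sub>F k in sequentially. ennreal ((diff_quot (trunc \<delta>) e (?m k) x)\<^sup>2) * indicator (- \<Omega>) x = 0"
            by eventually_elim simp
          then show ?thesis by (rule tendsto_eventually)
        qed simp
      qed
    qed auto
    ultimately show ?thesis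
      by (intro tendsto_lowerbound[of "\<lambda>k. a k + b k" "(\<integral>\<^sup>+x. ennreal ((dir_deriv w e x)\<^sup>2) * indicator \<Omega> x \<partial>lborel)" sequentially])
        (auto intro: tendsto_eq_intros always_eventually)
  qed
  \<comment> \<open>The bound does not depend on \<delta>, and \<open>trunc \<delta>\<close> tends
    to \<open>w\<close> pointwise as \<delta> tends to 0, so Fatou's lemma removes the
    truncation.\<close>
  define \<epsilon> where "\<epsilon> j = inverse (real (Suc j))" for j
  have \<epsilon>: "0 < \<epsilon> j" for j by (simp add: \<epsilon>_def)
  have \<epsilon>0: "\<epsilon> \<longlonglongrightarrow> 0" unfolding \<epsilon>_def by (rule LIMSEQ_inverse_real_of_nat)
  have "(\<lambda>j. trunc (\<epsilon> j) x) \<longlonglongrightarrow> w x - max (- 0) (min 0 (w x))" for x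
    unfolding trunc_def by (intro tendsto_intros \<epsilon>0)
  moreover have "max (- 0) (min 0 r) = 0" for r :: real by (simp add: max_def min_def)
  ultimately have tr: "(\<lambda>j. trunc (\<epsilon> j) x) \<longlonglongrightarrow> w x" for x by (metis diff_zero)
  have "(\<integral>\<^sup>+x. ennreal ((diff_quot w e n x)\<^sup>2) \<partial>lborel) = (\<integral>\<^sup>+x. liminf (\<lambda>j. ennreal ((diff_quot (trunc (\<epsilon> j)) e n x)\<^sup>2)) \<partial>lborel)"
  proof (rule nn_integral_cong)
    fix x
    have "(\<lambda>j. ennreal ((diff_quot (trunc (\<epsilon> j)) e n x)\<^sup>2)) \<longlonglongrightarrow> ennreal ((diff_quot w e n x)\<^sup>2)"
      unfolding diff_quot_def by (intro tendsto_intros tendsto_ennrealI tr)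
    then show "ennreal ((diff_quot w e n x)\<^sup>2) = liminf (\<lambda>j. ennreal ((diff_quot (trunc (\<epsilon> j)) e n x)\<^sup>2))"
      by (rule lim_imp_Liminf[OF sequentially_bot, symmetric])
  qed
  also have "\<dots> \<le> liminf (\<lambda>j. \<integral>\<^sup>+x. ennreal ((diff_quot (trunc (\<epsilon> j)) e n x)\<^sup>2) \<partial>lborel)"
    using borel_measurable_diff_quot[OF trunc_lip[OF \<epsilon>]]
    by (intro nn_integral_liminf measurable_compose[OF _ measurable_ennreal] borel_measurable_power) simp
  also have "\<dots> \<le> liminf (\<lambda>j::nat. \<integral>\<^sup>+x. ennreal ((dir_deriv w e x)\<^sup>2) * indicator \<Omega> x \<partial>lborel)"
    by (intro Liminf_mono always_eventually allI bound \<epsilon>)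
  also have "\<dots> = (\<integral>\<^sup>+x. ennreal ((dir_deriv w e x)\<^sup>2) * indicator \<Omega> x \<partial>lborel)"
    by (simp add: Liminf_const)
  finally show ?thesis .
qed

text \<open>At a fixed step the quotients of \<open>wm m\<close> converge pointwise and have energy
  at most \<open>K\<close> by \<open>nn_integral_diff_quot_le\<close>, so Fatou's lemma gives the
  same bound for \<open>w\<close>. Fatou's lemma once more, as the step tends to 0, reaches the
  derivative of \<open>w\<close>; convergence of the derivatives themselves never enters.\<close>

lemma dir_deriv_energy_lsc:
  fixes w :: "'a::euclidean_space \<Rightarrow> real" and wm :: "nat \<Rightarrow> 'a \<Rightarrow> real" and C :: "nat \<Rightarrow> real"
  assumes \<Omega>: "open \<Omega>" "bounded \<Omega>"
    and wm: "\<And>m. (C m)-lipschitz_on UNIV (wm m)" and zero: "\<And>m x. x \<notin> \<Omega> \<Longrightarrow> wm m x = 0"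
    and w: "C'-lipschitz_on UNIV w" and lim: "\<And>x. (\<lambda>m. wm m x) \<longlonglongrightarrow> w x"
    and K: "\<forall>\<^sub>F m in sequentially. (\<integral>\<^sup>+x. ennreal ((dir_deriv (wm m) e x)\<^sup>2) * indicator \<Omega> x \<partial>lborel) \<le> K"
  shows "(\<integral>\<^sup>+x. ennreal ((dir_deriv w e x)\<^sup>2) * indicator \<Omega> x \<partial>lborel) \<le> K"
proof -
  note [measurable] = borel_measurable_diff_quot[OF w] borel_measurable_diff_quot[OF wm] borel_measurable_dir_deriv[OF w]
  have [measurable]: "\<Omega> \<in> sets borel" using \<Omega> by simp
  have dq: "(\<integral>\<^sup>+x. ennreal ((diff_quot w e n x)\<^sup>2) \<partial>lborel) \<le> K" if n: "0 < n" for n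
  proof -
    have "(\<integral>\<^sup>+x. ennreal ((diff_quot w e n x)\<^sup>2) \<partial>lborel) = (\<integral>\<^sup>+x. liminf (\<lambda>m. ennreal ((diff_quot (wm m) e n x)\<^sup>2)) \<partial>lborel)"
    proof (rule nn_integral_cong)
      fix x
      have "(\<lambda>m. ennreal ((diff_quot (wm m) e n x)\<^sup>2)) \<longlonglongrightarrow> ennreal ((diff_quot w e n x)\<^sup>2)"
        unfolding diff_quot_def by (intro tendsto_intros tendsto_ennrealI lim)
      then show "ennreal ((diff_quot w e n x)\<^sup>2) = liminf (\<lambda>m. ennreal ((diff_quot (wm m) e n x)\<^sup>2))"
        by (rule lim_imp_Liminf[OF sequentially_bot, symmetric])
    qed
    also have "\<dots> \<le> liminf (\<lambda>m. \<integral>\<^sup>+x. ennreal ((diff_quot (wm m) e n x)\<^sup>2) \<partial>lborel)"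
      by (intro nn_integral_liminf) measurable
    also have "\<dots> \<le> liminf (\<lambda>m::nat. K)"
      using K
      by (intro Liminf_mono) (auto elim!: eventually_mono intro: order_trans[OF nn_integral_diff_quot_le[OF wm \<Omega> zero n]])
    also have "\<dots> = K" by (simp add: Liminf_const)
    finally show ?thesis .
  qed
  have "(\<integral>\<^sup>+x. ennreal ((dir_deriv w e x)\<^sup>2) * indicator \<Omega> x \<partial>lborel) \<le> (\<integral>\<^sup>+x. ennreal ((dir_deriv w e x)\<^sup>2) \<partial>lborel)"
    by (intro nn_integral_mono) (auto simp: indicator_def)
  also have "\<dots> = (\<integral>\<^sup>+x. liminf (\<lambda>n. ennreal ((diff_quot w e (Suc n) x)\<^sup>2)) \<partial>lborel)"
  proof (rule nn_integral_cong_AE)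
    show "AE x in lborel. ennreal ((dir_deriv w e x)\<^sup>2) = liminf (\<lambda>n. ennreal ((diff_quot w e (Suc n) x)\<^sup>2))"
      using has_dir_deriv_AE[OF w, of e]
    proof eventually_elim
      case (elim x)
      have "(\<lambda>n. ennreal ((diff_quot w e (Suc n) x)\<^sup>2)) \<longlonglongrightarrow> ennreal ((dir_deriv w e x)\<^sup>2)"
        by (intro tendsto_ennrealI tendsto_power LIMSEQ_Suc diff_quot_tendsto elim)
      then show ?case by (rule lim_imp_Liminf[OF sequentially_bot, symmetric])
    qed
  qed
  also have "\<dots> \<le> liminf (\<lambda>n. \<integral>\<^sup>+x. ennreal ((diff_quot w e (Suc n) x)\<^sup>2) \<partial>lborel)"
    by (intro nn_integral_liminf) measurable
  also have "\<dots> \<le> liminf (\<lambda>n::nat. K)"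
    by (intro Liminf_mono always_eventually allI dq) simp
  also have "\<dots> = K" by (simp add: Liminf_const)
  finally show ?thesis .
qed

text \<open>Zero energy makes the quotients with step 1 vanish, so \<open>w\<close> is almost
  everywhere invariant under translation by \<open>e\<close>. A vector of length
  \<open>2 * \<bar>\<rho>\<bar>\<close> moves \<Omega> off itself, to where \<open>w\<close> is 0;
  by continuity \<open>w\<close> is then 0 everywhere.\<close>

lemma zero_if_dir_deriv_zero:
  fixes w :: "'a::euclidean_space \<Rightarrow> real"
  assumes w: "C-lipschitz_on UNIV w" and \<Omega>: "open \<Omega>" "bounded \<Omega>" and zero: "\<And>x. x \<notin> \<Omega> \<Longrightarrow> w x = 0"
    and dd: "\<And>e. AE x in lborel. x \<in> \<Omega> \<longrightarrow> dir_deriv w e x = 0"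
  shows "w x = 0"
proof (rule ccontr)
  assume wx: "w x \<noteq> 0"
  note [measurable] = borel_measurable_diff_quot[OF w] borel_measurable_dir_deriv[OF w]
  obtain \<rho> where \<rho>: "\<Omega> \<subseteq> ball 0 \<rho>" using \<Omega>(2) bounded_subset_ballD by blast
  obtain b :: 'a where b: "b \<in> Basis" using nonempty_Basis by blast
  define e where "e = (2 * \<bar>\<rho>\<bar>) *\<^sub>R b"
  have [measurable]: "\<Omega> \<in> sets borel" using \<Omega> by simp
  have "(\<integral>\<^sup>+x. ennreal ((dir_deriv w e x)\<^sup>2) * indicator \<Omega> x \<partial>lborel) = (\<integral>\<^sup>+x. 0 \<partial>(lborel :: 'a measure))"
    using dd[of e] by (intro nn_integral_cong_AE) (auto simp: indicator_def elim!: eventually_mono)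
  then have "(\<integral>\<^sup>+x. ennreal ((diff_quot w e 1 x)\<^sup>2) \<partial>lborel) = 0"
    using nn_integral_diff_quot_le[OF w \<Omega> zero, of 1 e] by simp
  then have "AE x in lborel. ennreal ((diff_quot w e 1 x)\<^sup>2) = 0"
    by (subst (asm) nn_integral_0_iff_AE) auto
  then have AE: "AE x in lborel. w (x + e) = w x"
    by eventually_elim (simp add: diff_quot_def ennreal_eq_0_iff)
  define U where "U = {x. w x \<noteq> 0}"
  have "open U" unfolding U_def
    using lipschitz_on_continuous_on[OF w] by (intro open_Collect_neq continuous_on_const)
  have "AE x in lborel. x \<notin> U"
    using AE
  proof eventually_elim
    case (elim x)
    show ?case
    proof
      assume "x \<in> U"
      then have "x \<in> \<Omega>" "x + e \<in> \<Omega>" using elim zero unfolding U_def by fastforce+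
      then have "norm x < \<rho>" "norm (x + e) < \<rho>" using \<rho> by auto
      moreover have "norm e = 2 * \<bar>\<rho>\<bar>" using b by (simp add: e_def)
      ultimately show False using norm_triangle_ineq4[of "x + e" x] by simp
    qed
  qed
  then have "U \<in> null_sets lborel"
    using \<open>open U\<close> by (subst AE_iff_null_sets) auto
  then have "negligible U" using \<open>open U\<close> by (simp add: negligible_iff_null_sets null_sets_completion_iff)
  then have "U = {}" using \<open>open U\<close> open_not_negligible by blast
  then show False using wx by (auto simp: U_def)
qed

text \<open>
  The increment over the segment is the mean of \<open>n\<close> difference quotients at shifted points; averaged
  over a small ball their excess over \<open>s\<close> is at most an integral over \<open>\<Omega>\<close> that tends to \<open>0\<close>.
\<close>

lemma segment_bound:
  fixes v :: "'a::euclidean_space \<Rightarrow> real"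
  assumes v: "C-lipschitz_on UNIV v" and \<Omega>: "open \<Omega>" "bounded \<Omega>" and seg: "closed_segment x (x + e) \<subseteq> \<Omega>"
    and bd: "AE x in lborel. x \<in> \<Omega> \<longrightarrow> \<bar>dir_deriv v e x\<bar> \<le> s"
  shows "\<bar>v (x + e) - v x\<bar> \<le> s"
proof (rule ccontr)
  assume "\<not> \<bar>v (x + e) - v x\<bar> \<le> s"
  then have gt: "s < \<bar>v (x + e) - v x\<bar>" by simp
  note [measurable] = borel_measurable_diff_quot[OF v] borel_measurable_dir_deriv[OF v] borel_measurable_lipschitz[OF v]
  have vc: "continuous_on UNIV v" using v by (rule lipschitz_on_continuous_on)
  have [measurable]: "\<Omega> \<in> sets borel" using \<Omega> by simp
  have "compact (closed_segment x (x + e))" "closed (- \<Omega>)" "closed_segment x (x + e) \<inter> - \<Omega> = {}"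
    using \<Omega> seg by auto
  \<comment> \<open>Translating the segment by less than \<open>r0\<close> keeps it inside \<Omega>,
    so all the sample points \<open>z + c k\<close> below lie there.\<close>
  then obtain r0 where r0: "r0 > 0" "\<And>y z. y \<in> closed_segment x (x + e) \<Longrightarrow> z \<in> - \<Omega> \<Longrightarrow> r0 \<le> dist y z"
    using separate_compact_closed by metis
  \<comment> \<open>Midway: above \<open>s\<close>, so that the excess stays positive, and below the
    assumed increment, so that the violation persists for starting points in a ball around
    \<open>x\<close>.\<close>
  define s' where "s' = (s + \<bar>v (x + e) - v x\<bar>) / 2"
  have "s' < \<bar>v (x + e) - v x\<bar>" using gt by (simp add: s'_def)
  then have "x \<in> {z. s' < \<bar>v (z + e) - v z\<bar>}" by simp
  moreover have "continuous_on UNIV (\<lambda>z. \<bar>v (z + e) - v z\<bar>)"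
    by (intro continuous_intros continuous_on_compose2[OF vc]) auto
  then have "open {z. s' < \<bar>v (z + e) - v z\<bar>}" by (intro open_Collect_less continuous_on_const)
  ultimately obtain r1 where r1: "r1 > 0" "ball x r1 \<subseteq> {z. s' < \<bar>v (z + e) - v z\<bar>}"
    using openE by blast
  define B where "B = ball x (min r0 r1)"
  have [measurable]: "B \<in> sets borel" by (simp add: B_def)
  have Bne: "emeasure lborel B \<noteq> 0"
  proof
    assume "emeasure lborel B = 0"
    then have "negligible B" by (simp add: negligible_iff_null_sets null_sets_completion_iff null_setsI)
    moreover have "open B" "x \<in> B" using r0 r1 by (auto simp: B_def)
    ultimately show False using open_not_negligible[of B] by auto
  qed
  have Bfin: "emeasure lborel B < \<infinity>" unfolding B_def by (rule emeasure_lborel_ball_finite)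
  \<comment> \<open>The excess is cut off at 0: being nonnegative, its integral only grows when a
    translated ball is enlarged to \<Omega>.\<close>
  define p where "p n y = max 0 (\<bar>diff_quot v e n y\<bar> - s)" for n y
  have [measurable]: "p n \<in> borel_measurable borel" for n unfolding p_def by measurable
  have "(\<lambda>n. \<integral>\<^sup>+y. ennreal (p n y) * indicator \<Omega> y \<partial>lborel) \<longlonglongrightarrow> (\<integral>\<^sup>+y. 0 \<partial>(lborel :: 'a measure))"
  proof (rule nn_integral_dominated_convergence[where w = "\<lambda>y. ennreal (C * norm e + \<bar>s\<bar>) * indicator \<Omega> y"])
    show "(\<integral>\<^sup>+y. ennreal (C * norm e + \<bar>s\<bar>) * indicator \<Omega> y \<partial>lborel) < \<infinity>"
      using emeasure_bounded_finite[OF \<Omega>(2)] by (simp add: nn_integral_cmult ennreal_mult_less_top)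
    show "AE y in lborel. ennreal (p n y) * indicator \<Omega> y \<le> ennreal (C * norm e + \<bar>s\<bar>) * indicator \<Omega> y" for n
    proof (rule AE_I2)
      fix y
      have "p n y \<le> C * norm e + \<bar>s\<bar>"
        using diff_quot_bound[OF v, of e n y] unfolding p_def by linarith
      then show "ennreal (p n y) * indicator \<Omega> y \<le> ennreal (C * norm e + \<bar>s\<bar>) * indicator \<Omega> y"
        by (intro mult_right_mono ennreal_leI) auto
    qed
    show "AE y in lborel. (\<lambda>n. ennreal (p n y) * indicator \<Omega> y) \<longlonglongrightarrow> 0"
      using bd has_dir_deriv_AE[OF v, of e]
    proof eventually_elim
      case (elim y)
      show ?case
      proof (cases "y \<in> \<Omega>")
        case True
        have "(\<lambda>n. ennreal (p n y)) \<longlonglongrightarrow> ennreal (max 0 (\<bar>dir_deriv v e y\<bar> - s))"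
          unfolding p_def by (intro tendsto_ennrealI tendsto_intros diff_quot_tendsto elim)
        also have "max 0 (\<bar>dir_deriv v e y\<bar> - s) = 0" using elim True by simp
        finally show ?thesis using True by simp
      qed simp
    qed
  qed auto
  then have plim: "(\<lambda>n. \<integral>\<^sup>+y. ennreal (p n y) * indicator \<Omega> y \<partial>lborel) \<longlonglongrightarrow> 0" by simp
  have le: "ennreal (s' - s) * emeasure lborel B \<le> (\<integral>\<^sup>+y. ennreal (p n y) * indicator \<Omega> y \<partial>lborel)" if n: "0 < n" for n
  proof -
    define c where "c k = (real k / real n) *\<^sub>R e" for k
    have pt: "ennreal (s' - s) * indicator B z \<le> (\<Sum>k<n. ennreal (1 / real n) * (ennreal (p n (z + c k)) * indicator B z))" for z
    proof (cases "z \<in> B")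
      case True
      have cS: "z + c (Suc k) = z + c k + (1 / real n) *\<^sub>R e" for k
        by (simp add: c_def add_divide_distrib scaleR_left_distrib)
      have "(\<Sum>k<n. v (z + c (Suc k)) - v (z + c k)) = v (z + c n) - v (z + c 0)"
        by (rule sum_lessThan_telescope)
      then have "v (z + e) - v z = (\<Sum>k<n. v (z + c (Suc k)) - v (z + c k))"
        using n by (simp add: c_def)
      also have "\<dots> = (\<Sum>k<n. diff_quot v e n (z + c k) / real n)"
        using n unfolding cS by (intro sum.cong) (simp_all add: diff_quot_def)
      finally have "\<bar>v (z + e) - v z\<bar> \<le> (\<Sum>k<n. \<bar>diff_quot v e n (z + c k) / real n\<bar>)" by (simp only: sum_abs)
      also have "\<dots> \<le> (\<Sum>k<n. (s + p n (z + c k)) / real n)"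
        using n by (intro sum_mono) (auto simp: p_def divide_right_mono)
      also have "\<dots> = s + (\<Sum>k<n. 1 / real n * p n (z + c k))"
        using n by (simp add: sum.distrib add_divide_distrib)
      finally have "s' - s \<le> (\<Sum>k<n. 1 / real n * p n (z + c k))"
        using True r1(2) by (auto simp: B_def subset_iff)
      then have "ennreal (s' - s) \<le> ennreal (\<Sum>k<n. 1 / real n * p n (z + c k))" by (rule ennreal_leI)
      also have pnn: "0 \<le> p n y" for y by (simp add: p_def)
      then have "ennreal (\<Sum>k<n. 1 / real n * p n (z + c k)) = (\<Sum>k<n. ennreal (1 / real n * p n (z + c k)))"
        by (intro sum_ennreal[symmetric]) simp
      also have "\<dots> = (\<Sum>k<n. ennreal (1 / real n) * (ennreal (p n (z + c k)) * indicator B z))"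
      proof (intro sum.cong refl)
        fix k show "ennreal (1 / real n * p n (z + c k)) = ennreal (1 / real n) * (ennreal (p n (z + c k)) * indicator B z)"
          using True pnn by (subst ennreal_mult) auto
      qed
      finally show ?thesis using True by simp
    qed simp
    have "ennreal (s' - s) * emeasure lborel B = (\<integral>\<^sup>+z. ennreal (s' - s) * indicator B z \<partial>lborel)"
      by (simp add: nn_integral_cmult)
    also have "\<dots> \<le> (\<integral>\<^sup>+z. (\<Sum>k<n. ennreal (1 / real n) * (ennreal (p n (z + c k)) * indicator B z)) \<partial>lborel)"
      using pt by (rule nn_integral_mono)
    also have "\<dots> = (\<Sum>k<n. ennreal (1 / real n) * (\<integral>\<^sup>+z. ennreal (p n (z + c k)) * indicator B z \<partial>lborel))"
      by (simp add: nn_integral_sum nn_integral_cmult)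
    also have "\<dots> \<le> (\<Sum>k<n. ennreal (1 / real n) * (\<integral>\<^sup>+y. ennreal (p n y) * indicator \<Omega> y \<partial>lborel))"
    proof (intro sum_mono mult_left_mono)
      fix k assume k: "k \<in> {..<n}"
      have "(\<integral>\<^sup>+z. ennreal (p n (z + c k)) * indicator B z \<partial>lborel) \<le> (\<integral>\<^sup>+z. ennreal (p n (z + c k)) * indicator \<Omega> (z + c k) \<partial>lborel)"
      proof (intro nn_integral_mono mult_left_mono)
        fix z
        have "z + c k \<in> \<Omega>" if "z \<in> B"
        proof (rule ccontr)
          assume "z + c k \<notin> \<Omega>"
          moreover have "x + c k \<in> closed_segment x (x + e)"
            using k n unfolding in_segment by (intro exI[of _ "real k / real n"]) (auto simp: c_def algebra_simps)
          ultimately have "r0 \<le> dist (x + c k) (z + c k)" using r0 by blast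
          then show False using that by (simp add: B_def)
        qed
        then show "indicator B z \<le> (indicator \<Omega> (z + c k) :: ennreal)" by (simp add: indicator_def)
      qed simp
      also have "\<dots> = (\<integral>\<^sup>+y. ennreal (p n y) * indicator \<Omega> y \<partial>lborel)"
        by (rule nn_integral_lborel_shift[of "\<lambda>y. ennreal (p n y) * indicator \<Omega> y"]) measurable
      finally show "(\<integral>\<^sup>+z. ennreal (p n (z + c k)) * indicator B z \<partial>lborel) \<le> (\<integral>\<^sup>+y. ennreal (p n y) * indicator \<Omega> y \<partial>lborel)" .
    qed simp
    also have "\<dots> = (ennreal (real n) * ennreal (1 / real n)) * (\<integral>\<^sup>+y. ennreal (p n y) * indicator \<Omega> y \<partial>lborel)"
      by (simp add: mult.assoc ennreal_of_nat_eq_real_of_nat)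
    also have "ennreal (real n) * ennreal (1 / real n) = 1"
      using n by (simp flip: ennreal_mult)
    finally show ?thesis by simp
  qed
  have "ennreal (s' - s) * emeasure lborel B \<le> 0"
    using plim by (rule tendsto_lowerbound) (auto simp: eventually_sequentially intro!: exI[of _ 1] le)
  then show False using Bne gt by (simp add: s'_def ennreal_eq_0_iff)
qed

text \<open>If the segment leaves \<Omega>, its first and last points off \<Omega> cut it into two
  pieces whose open parts lie in \<Omega> and a middle one with both ends on the frontier. The
  lengths add up to \<open>dist x y\<close>, so the constant \<open>s\<close> is not
  enlarged.\<close>

lemma lipschitz_on_closure_if_segments:
  fixes v :: "'a::euclidean_space \<Rightarrow> real"
  assumes v: "continuous_on UNIV v" and \<Omega>: "open \<Omega>" and s: "0 \<le> s"
    and seg: "\<And>x y. closed_segment x y \<subseteq> \<Omega> \<Longrightarrow> \<bar>v x - v y\<bar> \<le> s * dist x y"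
    and bdry: "\<And>x y. x \<in> frontier \<Omega> \<Longrightarrow> y \<in> frontier \<Omega> \<Longrightarrow> \<bar>v x - v y\<bar> \<le> s * dist x y"
  shows "s-lipschitz_on (closure \<Omega>) v"
proof (rule lipschitz_onI[OF _ s])
  \<comment> \<open>The hypothesis concerns closed segments inside \<Omega>, but the outer pieces
    touch the frontier; the segment is shortened at both ends and continuity passes to the
    limit.\<close>
  have oseg: "\<bar>v x - v y\<bar> \<le> s * dist x y" if o: "open_segment x y \<subseteq> \<Omega>" for x y
  proof (cases "x = y")
    case False
    define a where "a t = x + t *\<^sub>R (y - x)" for t
    have in_seg: "a t \<in> open_segment x y" if "0 < t" "t < 1" for t
      using that False unfolding in_segment by (auto simp: a_def algebra_simps intro!: exI[of _ t])
    have "((\<lambda>t. \<bar>v (a t) - v (a (1 - t))\<bar>) \<longlongrightarrow> \<bar>v (a 0) - v (a (1 - 0))\<bar>) (at_right 0)"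
      unfolding a_def by (intro tendsto_intros continuous_on_tendsto_compose[OF v]) auto
    moreover have "((\<lambda>t. s * dist (a t) (a (1 - t))) \<longlongrightarrow> s * dist (a 0) (a (1 - 0))) (at_right 0)"
      unfolding a_def by (intro tendsto_intros)
    moreover have "\<forall>\<^sub>F t in at_right 0. t \<in> {0<..<1/2::real}" by (rule eventually_at_right_real) simp
    then have "\<forall>\<^sub>F t in at_right 0. \<bar>v (a t) - v (a (1 - t))\<bar> \<le> s * dist (a t) (a (1 - t))"
    proof eventually_elim
      case (elim t)
      have "a t \<in> open_segment x y" "a (1 - t) \<in> open_segment x y"
        using elim by (auto intro: in_seg)
      then have "closed_segment (a t) (a (1 - t)) \<subseteq> open_segment x y"
        by (intro closed_segment_subset convex_open_segment)
      with o show ?case by (intro seg) blast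
    qed
    ultimately have "\<bar>v (a 0) - v (a (1 - 0))\<bar> \<le> s * dist (a 0) (a (1 - 0))"
      by (intro tendsto_le[OF trivial_limit_at_right_real])
    then show ?thesis by (simp add: a_def)
  qed simp
  fix x y assume xy: "x \<in> closure \<Omega>" "y \<in> closure \<Omega>"
  define a where "a t = x + t *\<^sub>R (y - x)" for t
  \<comment> \<open>The parameters at which the segment is off \<Omega>: a compact set since
    \<Omega> is open, so a smallest and a largest one exist when it is nonempty.\<close>
  define T where "T = {0..1} \<inter> a -` (- \<Omega>)"
  have ac: "continuous_on UNIV a" unfolding a_def by (intro continuous_intros)
  have T: "compact T" unfolding T_def
    using \<Omega> ac by (intro compact_Int_closed closed_vimage) auto
  have dist_a: "dist (a p) (a q) = \<bar>p - q\<bar> * dist x y" for p q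
  proof -
    have "a p - a q = (p - q) *\<^sub>R (y - x)" by (simp add: a_def algebra_simps)
    then show ?thesis by (simp add: dist_norm norm_minus_commute[of x y])
  qed
  have seg_a: "\<exists>\<tau>. z = a \<tau> \<and> p < \<tau> \<and> \<tau> < q" if z: "z \<in> open_segment (a p) (a q)" and pq: "p \<le> q" for z p q
  proof -
    obtain \<mu> where \<mu>: "0 < \<mu>" "\<mu> < 1" "z = (1 - \<mu>) *\<^sub>R a p + \<mu> *\<^sub>R a q" "a p \<noteq> a q"
      using z unfolding in_segment(2) by metis
    have "p < q" using \<mu>(4) pq by (cases "p = q") auto
    then have "0 < \<mu> * (q - p)" "\<mu> * (q - p) < 1 * (q - p)" using \<mu> by (auto intro: mult_strict_right_mono)
    moreover have "z = a (p + \<mu> * (q - p))" using \<mu>(3) by (simp add: a_def algebra_simps)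
    ultimately show ?thesis by (intro exI[of _ "p + \<mu> * (q - p)"]) auto
  qed
  have fr: "z \<in> frontier \<Omega>" if "z \<notin> \<Omega>" "w \<in> closure \<Omega>" "open_segment w z \<subseteq> \<Omega>" for w z
  proof -
    have "z \<in> closure \<Omega>"
    proof (cases "w = z")
      case False
      then have "z \<in> closure (open_segment w z)" by simp
      then show ?thesis using closure_mono[OF that(3)] by blast
    qed (use that in simp)
    then show ?thesis using that \<Omega> by (simp add: frontier_def interior_open)
  qed
  show "dist (v x) (v y) \<le> s * dist x y"
  proof (cases "T = {}")
    case True
    have "open_segment x y \<subseteq> \<Omega>"
    proof
      fix z assume "z \<in> open_segment x y"
      then have "z \<in> open_segment (a 0) (a 1)" by (simp add: a_def)
      then obtain \<tau> where "z = a \<tau>" "0 < \<tau>" "\<tau> < 1" using seg_a by fastforce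
      moreover have "\<tau> \<notin> T" using True by simp
      ultimately show "z \<in> \<Omega>" by (auto simp: T_def)
    qed
    then show ?thesis using oseg by (simp add: dist_real_def)
  next
    case False
    obtain p where p: "p \<in> T" "\<And>t. t \<in> T \<Longrightarrow> p \<le> t" using compact_attains_inf[OF T False] by blast
    obtain q where q: "q \<in> T" "\<And>t. t \<in> T \<Longrightarrow> t \<le> q" using compact_attains_sup[OF T False] by blast
    have pq: "0 \<le> p" "p \<le> q" "q \<le> 1" using p q by (auto simp: T_def)
    have xp: "open_segment (a 0) (a p) \<subseteq> \<Omega>"
    proof
      fix z assume "z \<in> open_segment (a 0) (a p)"
      then obtain \<tau> where "z = a \<tau>" "0 < \<tau>" "\<tau> < p" using seg_a pq by blast
      then show "z \<in> \<Omega>" using p(2)[of \<tau>] pq by (auto simp: T_def)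
    qed
    have qy: "open_segment (a q) (a 1) \<subseteq> \<Omega>"
    proof
      fix z assume "z \<in> open_segment (a q) (a 1)"
      then obtain \<tau> where "z = a \<tau>" "q < \<tau>" "\<tau> < 1" using seg_a pq by blast
      then show "z \<in> \<Omega>" using q(2)[of \<tau>] pq by (auto simp: T_def)
    qed
    have a01: "a 0 = x" "a 1 = y" by (auto simp: a_def)
    have "a p \<in> frontier \<Omega>" using p(1) xp xy by (intro fr[of "a p" "a 0"]) (auto simp: T_def a01)
    moreover have "a q \<in> frontier \<Omega>"
      using q(1) qy xy by (intro fr[of "a q" "a 1"]) (auto simp: T_def a01 open_segment_commute)
    ultimately have "\<bar>v (a p) - v (a q)\<bar> \<le> s * dist (a p) (a q)" by (rule bdry)
    moreover note oseg[OF xp] oseg[OF qy]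
    ultimately have "\<bar>v (a 0) - v (a 1)\<bar> \<le> s * dist (a 0) (a p) + s * dist (a p) (a q) + s * dist (a q) (a 1)"
      by linarith
    also have "\<dots> = s * dist x y" unfolding dist_a using pq by (simp add: algebra_simps)
    finally show ?thesis by (simp add: a01 dist_real_def)
  qed
qed

section \<open>The functional\<close>

text \<open>The induction step is Chebyshev's sum inequality: \<open>s - t\<close> and
  \<open>s ^ p - t ^ p\<close> never have opposite signs.\<close>

lemma power_midpoint_le:
  fixes s t :: real
  assumes "0 \<le> s" "0 \<le> t"
  shows "((s + t) / 2) ^ p \<le> (s ^ p + t ^ p) / 2"
proof (induction p)
  case (Suc p)
  have "(s - t) * (s ^ p - t ^ p) \<ge> 0"
  proof (cases "s \<le> t")
    case True
    then show ?thesis using assms by (intro mult_nonpos_nonpos) (auto intro: power_mono)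
  next
    case False
    then show ?thesis using assms by (intro mult_nonneg_nonneg) (auto intro: power_mono)
  qed
  then have cheb: "(s + t) * (s ^ p + t ^ p) \<le> 2 * (s ^ Suc p + t ^ Suc p)"
    by (simp add: algebra_simps)
  have "((s + t) / 2) ^ Suc p \<le> (s + t) / 2 * ((s ^ p + t ^ p) / 2)"
    unfolding power_Suc using Suc assms by (intro mult_left_mono) auto
  also have "\<dots> \<le> (s ^ Suc p + t ^ Suc p) / 2" using cheb by simp
  finally show ?case .
qed simp

lemma borel_measurable_\<Phi>: "\<Phi> a \<in> borel_measurable borel"
  unfolding \<Phi>_def by measurable

text \<open>The gain comes from the term \<open>p = 2\<close> alone: its coefficient
  \<open>a 2 / 2\<close> times the factor \<open>1 / 4\<close> of the parallelogram identity gives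
  \<open>a 2 / 8\<close>. The other terms only contribute convexity. With values in
  \<open>ennreal\<close> the inequality also covers infinite \<open>\<Phi>\<close>.\<close>

lemma \<Phi>_midpoint_le:
  fixes \<xi> \<eta> :: "'a::euclidean_space"
  assumes a: "\<And>p. 2 \<le> p \<Longrightarrow> 0 \<le> a p"
  shows "\<Phi> a (norm ((1/2) *\<^sub>R (\<xi> + \<eta>))) + ennreal (a 2 / 8 * (norm (\<xi> - \<eta>))\<^sup>2)
    \<le> ennreal (1/2) * (\<Phi> a (norm \<xi>) + \<Phi> a (norm \<eta>))"
proof -
  define r where "r = norm ((1/2) *\<^sub>R (\<xi> + \<eta>))"
  define c where "c p t = (if 2 \<le> p then ennreal (a p / real p * t ^ p) else 0)" for p :: nat and t :: real
  \<comment> \<open>The quadratic gain as a series with a single nonzero term, so that the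
    inequality can be shown term by term.\<close>
  define d where "d p = (if p = 2 then ennreal (a 2 / 8 * (norm (\<xi> - \<eta>))\<^sup>2) else 0)" for p :: nat
  have r: "r \<le> (norm \<xi> + norm \<eta>) / 2" using norm_triangle_ineq[of \<xi> \<eta>] by (simp add: r_def)
  have r2: "r\<^sup>2 + (norm (\<xi> - \<eta>))\<^sup>2 / 4 = ((norm \<xi>)\<^sup>2 + (norm \<eta>)\<^sup>2) / 2"
    by (simp add: r_def power2_norm_eq_inner inner_simps inner_commute field_simps)
  have le: "c p r + d p \<le> ennreal (1/2) * (c p (norm \<xi>) + c p (norm \<eta>))" for p
  proof (cases "2 \<le> p")
    case True
    define k where "k = a p / real p"
    have k: "0 \<le> k" using a[OF True] by (simp add: k_def)
    define e where "e = (if p = 2 then a 2 / 8 * (norm (\<xi> - \<eta>))\<^sup>2 else 0)"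
    have e: "0 \<le> e" using a[of 2] by (simp add: e_def)
    have "k * r ^ p + e \<le> 1/2 * (k * norm \<xi> ^ p + k * norm \<eta> ^ p)"
    proof (cases "p = 2")
      case p2: True
      have "k * r ^ p + e = k * (r\<^sup>2 + (norm (\<xi> - \<eta>))\<^sup>2 / 4)"
        using p2 by (simp add: k_def e_def field_simps)
      then show ?thesis unfolding r2 using p2 by (simp add: field_simps)
    next
      case False
      have "r ^ p \<le> ((norm \<xi> + norm \<eta>) / 2) ^ p" using r by (intro power_mono) (auto simp: r_def)
      also have "\<dots> \<le> (norm \<xi> ^ p + norm \<eta> ^ p) / 2" by (intro power_midpoint_le) auto
      finally have "k * r ^ p \<le> k * ((norm \<xi> ^ p + norm \<eta> ^ p) / 2)" using k by (rule mult_left_mono)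
      then show ?thesis using False by (simp add: e_def field_simps)
    qed
    then have "ennreal (k * r ^ p + e) \<le> ennreal (1/2 * (k * norm \<xi> ^ p + k * norm \<eta> ^ p))" by (rule ennreal_leI)
    also have "\<dots> = ennreal (1/2) * (ennreal (k * norm \<xi> ^ p) + ennreal (k * norm \<eta> ^ p))"
      using k by (subst ennreal_mult) auto
    also have "ennreal (k * r ^ p + e) = ennreal (k * r ^ p) + ennreal e"
      using k e by (intro ennreal_plus) (auto simp: r_def)
    also have "ennreal e = d p" by (simp add: e_def d_def)
    finally show ?thesis using True by (simp add: c_def k_def)
  qed (simp add: c_def d_def)
  have sd: "suminf d = sum d {2}" by (rule suminf_finite) (auto simp: d_def)
  have "(\<Sum>p. c p r) + (\<Sum>p. d p) = (\<Sum>p. c p r + d p)" by (rule suminf_add) auto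
  also have "\<dots> \<le> (\<Sum>p. ennreal (1/2) * (c p (norm \<xi>) + c p (norm \<eta>)))"
    using le by (intro suminf_le) auto
  also have "\<dots> = ennreal (1/2) * ((\<Sum>p. c p (norm \<xi>)) + (\<Sum>p. c p (norm \<eta>)))"
    by (simp add: suminf_add ennreal_suminf_cmult)
  also have "(\<Sum>p. d p) = ennreal (a 2 / 8 * (norm (\<xi> - \<eta>))\<^sup>2)"
    unfolding sd by (simp add: d_def)
  finally show ?thesis by (simp only: \<Phi>_def c_def r_def)
qed

text \<open>\<open>\<Phi>\<close> is the supremum of its partial sums, each continuous in
  \<open>t\<close>; so lower semicontinuity holds even where it becomes infinite.\<close>

lemma \<Phi>_le_liminf:
  assumes "t \<longlonglongrightarrow> l"
  shows "\<Phi> a l \<le> liminf (\<lambda>n. \<Phi> a (t n))"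
proof -
  define c where "c p t = (if 2 \<le> p then ennreal (a p / real p * t ^ p) else 0)" for p :: nat and t :: real
  have \<Phi>: "\<Phi> a t = (\<Sum>p. c p t)" for t by (simp only: \<Phi>_def c_def)
  have "(\<Sum>p<k. c p l) \<le> liminf (\<lambda>n. \<Phi> a (t n))" for k
  proof -
    have "(\<lambda>n. c p (t n)) \<longlonglongrightarrow> c p l" for p
      unfolding c_def by (cases "2 \<le> p") (auto intro!: tendsto_intros assms)
    then have "(\<lambda>n. \<Sum>p<k. c p (t n)) \<longlonglongrightarrow> (\<Sum>p<k. c p l)" by (intro tendsto_sum)
    then have "(\<Sum>p<k. c p l) = liminf (\<lambda>n. \<Sum>p<k. c p (t n))"
      by (rule lim_imp_Liminf[OF sequentially_bot, symmetric])
    also have "\<dots> \<le> liminf (\<lambda>n. \<Phi> a (t n))"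
      unfolding \<Phi> by (intro Liminf_mono always_eventually allI sum_le_suminf) auto
    finally show ?thesis .
  qed
  then show ?thesis unfolding \<Phi> suminf_eq_SUP by (intro SUP_least)
qed

lemma AE_lebesgue_on_iff:
  fixes \<Omega> :: "'a::euclidean_space set"
  assumes "open \<Omega>"
  shows "(AE x in lebesgue_on \<Omega>. P x) \<longleftrightarrow> (AE x in lborel. x \<in> \<Omega> \<longrightarrow> P x)"
  using assms by (subst AE_restrict_space_iff) (auto simp: AE_completion_iff)

lemma nn_integral_lebesgue_on:
  fixes \<Omega> :: "'a::euclidean_space set"
  assumes "open \<Omega>"
  shows "(\<integral>\<^sup>+x. h x \<partial>lebesgue_on \<Omega>) = (\<integral>\<^sup>+x. h x * indicator \<Omega> x \<partial>lborel)"
  using assms by (subst nn_integral_restrict_space) (auto simp: nn_integral_completion)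

section \<open>Competitors and their differences\<close>

locale power_series_functional =
  fixes \<Omega> :: "'a::euclidean_space set" and a :: "nat \<Rightarrow> real" and f g :: "'a \<Rightarrow> real" and \<sigma> :: real
  assumes bounded_\<Omega>: "bounded \<Omega>" and open_\<Omega>: "open \<Omega>"
    and a_nonneg: "\<And>p. 2 \<le> p \<Longrightarrow> 0 \<le> a p" and a2: "0 < a 2"
    and \<sigma>: "0 < \<sigma>" "conv_radius a = ereal \<sigma>"
    and f_integrable: "integrable (lebesgue_on \<Omega>) f"
    and g_const: "lipschitz_const (frontier \<Omega>) g \<le> ereal \<sigma>"
begin

lemma \<Omega>_lebesgue: "\<Omega> \<in> sets lebesgue"
  using open_\<Omega> by auto

lemma g_lipschitz:
  assumes "x \<in> frontier \<Omega>" "y \<in> frontier \<Omega>"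
  shows "\<bar>g x - g y\<bar> \<le> \<sigma> * dist x y"
proof (cases "x = y")
  case False
  have "ereal (\<bar>g x - g y\<bar> / dist x y) \<le> lipschitz_const (frontier \<Omega>) g"
    unfolding lipschitz_const_def using assms False
    by (intro SUP_upper2[of "(x, y)"]) auto
  then have "\<bar>g x - g y\<bar> / dist x y \<le> \<sigma>" using g_const order_trans by (metis ereal_less_eq(3))
  then show ?thesis using False by (simp add: field_simps)
qed simp

lemma borel_measurable_gradient_lebesgue_on:
  assumes v: "C-lipschitz_on (closure \<Omega>) v"
  shows "\<nabla> v \<in> borel_measurable (lebesgue_on \<Omega>)"
proof -
  obtain V where V: "C-lipschitz_on UNIV V" "\<And>x. x \<in> closure \<Omega> \<Longrightarrow> V x = v x"
    using v by (rule lipschitz_extension_UNIV) blast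
  have "\<nabla> V \<in> borel_measurable (lebesgue_on \<Omega>)"
    using borel_measurable_gradient[OF V(1)] by (rule measurable_restrict_space1)
  moreover have "\<nabla> V x = \<nabla> v x" if "x \<in> \<Omega>" for x
    using open_\<Omega> that V(2) closure_subset by (intro gradient_cong_open) auto
  ultimately show ?thesis by (subst measurable_cong[of _ _ "\<nabla> V"]) auto
qed

lemma GDERIV_gradient_AE_lebesgue_on:
  assumes v: "C-lipschitz_on (closure \<Omega>) v"
  shows "AE x in lebesgue_on \<Omega>. GDERIV v x :> \<nabla> v x \<and> norm (\<nabla> v x) \<le> C"
proof -
  obtain V where V: "C-lipschitz_on UNIV V" "\<And>x. x \<in> closure \<Omega> \<Longrightarrow> V x = v x"
    using v by (rule lipschitz_extension_UNIV) blast
  have eq: "V y = v y" if "y \<in> \<Omega>" for y using that V(2) closure_subset by blast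
  have "AE x in lborel. x \<in> \<Omega> \<longrightarrow> GDERIV v x :> \<nabla> v x \<and> norm (\<nabla> v x) \<le> C"
    using GDERIV_gradient_AE[OF V(1)]
  proof eventually_elim
    case (elim x)
    show ?case
    proof
      assume x: "x \<in> \<Omega>"
      have nab: "\<nabla> V x = \<nabla> v x" using open_\<Omega> x eq by (rule gradient_cong_open)
      have "has_dir_deriv V (\<nabla> V x) x (\<nabla> V x \<bullet> \<nabla> V x)" using elim by (rule has_dir_deriv_if_GDERIV)
      then have "\<bar>\<nabla> V x \<bullet> \<nabla> V x\<bar> \<le> C * norm (\<nabla> V x)"
        using dir_deriv_bound[OF V(1)] by (metis dir_deriv_eqI)
      then have "norm (\<nabla> V x) * norm (\<nabla> V x) \<le> C * norm (\<nabla> V x)"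
        by (simp add: power2_norm_eq_inner flip: power2_eq_square)
      then have "norm (\<nabla> V x) \<le> C"
        using lipschitz_on_nonneg[OF V(1)] by (cases "\<nabla> V x = 0") auto
      moreover have "GDERIV v x :> \<nabla> V x"
        using elim GDERIV_cong_open[OF open_\<Omega> x, of V v] eq by simp
      ultimately show "GDERIV v x :> \<nabla> v x \<and> norm (\<nabla> v x) \<le> C" by (simp add: nab)
    qed
  qed
  then show ?thesis by (simp only: AE_lebesgue_on_iff[OF open_\<Omega>])
qed

text \<open>A Lipschitz condition with constant \<sigma>, unlike an essential bound on the gradient,
  visibly passes to pointwise limits. The constant \<open>C\<close> of the extension
  \<open>V\<close> may exceed \<sigma>; on segments inside \<Omega> the essential bound improves
  it.\<close>

lemma S_iff:
  "v \<in> S \<Omega> a g \<longleftrightarrow>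
    v \<in> extensional (closure \<Omega>) \<and> \<sigma>-lipschitz_on (closure \<Omega>) v \<and> (\<forall>x\<in>frontier \<Omega>. v x = g x)"
proof
  assume v: "v \<in> S \<Omega> a g"
  then obtain C where C: "C-lipschitz_on (closure \<Omega>) v"
    and ext: "v \<in> extensional (closure \<Omega>)" and vg: "\<forall>x\<in>frontier \<Omega>. v x = g x"
    and es: "esssup (lebesgue_on \<Omega>) (\<lambda>x. ereal (norm (\<nabla> v x))) \<le> conv_radius a"
    unfolding S_def lipschitz_space_def by auto
  obtain V where V: "C-lipschitz_on UNIV V" "\<And>x. x \<in> closure \<Omega> \<Longrightarrow> V x = v x"
    using C by (rule lipschitz_extension_UNIV) blast
  have eq: "V y = v y" if "y \<in> \<Omega>" for y using that V(2) closure_subset by blast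
  have fr: "V x = g x" if "x \<in> frontier \<Omega>" for x using that V(2)[of x] vg by (auto simp: frontier_def)
  have "AE x in lebesgue_on \<Omega>. norm (\<nabla> v x) \<le> \<sigma>"
    using esssup_AE[of "\<lambda>x. ereal (norm (\<nabla> v x))" "lebesgue_on \<Omega>"]
  proof eventually_elim
    case (elim x)
    from order_trans[OF this es] show ?case by (simp add: \<sigma>)
  qed
  then have AE: "AE x in lborel. x \<in> \<Omega> \<longrightarrow> norm (\<nabla> v x) \<le> \<sigma>" by (simp only: AE_lebesgue_on_iff[OF open_\<Omega>])
  have "\<sigma>-lipschitz_on (closure \<Omega>) V"
  proof (rule lipschitz_on_closure_if_segments)
    show "continuous_on UNIV V" using V(1) by (rule lipschitz_on_continuous_on)
    show "open \<Omega>" by (rule open_\<Omega>)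
    show "0 \<le> \<sigma>" using \<sigma> by simp
    show "\<bar>V x - V y\<bar> \<le> \<sigma> * dist x y" if "x \<in> frontier \<Omega>" "y \<in> frontier \<Omega>" for x y
      using g_lipschitz[OF that] fr that by simp
    fix x y :: 'a assume seg: "closed_segment x y \<subseteq> \<Omega>"
    define e where "e = y - x"
    have "AE x in lborel. x \<in> \<Omega> \<longrightarrow> \<bar>dir_deriv V e x\<bar> \<le> \<sigma> * norm e"
      using AE GDERIV_gradient_AE[OF V(1)]
    proof eventually_elim
      case (elim z)
      show ?case
      proof
        assume z: "z \<in> \<Omega>"
        have "\<nabla> V z = \<nabla> v z" using open_\<Omega> z eq by (rule gradient_cong_open)
        then have "dir_deriv V e z = \<nabla> v z \<bullet> e"
          using elim by (metis dir_deriv_eqI has_dir_deriv_if_GDERIV)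
        then have "\<bar>dir_deriv V e z\<bar> \<le> norm (\<nabla> v z) * norm e" using Cauchy_Schwarz_ineq2 by metis
        also have "\<dots> \<le> \<sigma> * norm e" using elim z by (intro mult_right_mono) auto
        finally show "\<bar>dir_deriv V e z\<bar> \<le> \<sigma> * norm e" .
      qed
    qed
    then have "\<bar>V (x + e) - V x\<bar> \<le> \<sigma> * norm e"
      using seg by (intro segment_bound[OF V(1) open_\<Omega> bounded_\<Omega>]) (auto simp: e_def)
    then show "\<bar>V x - V y\<bar> \<le> \<sigma> * dist x y" by (simp add: e_def dist_norm norm_minus_commute abs_minus_commute)
  qed
  then have "\<sigma>-lipschitz_on (closure \<Omega>) v" using V(2) by (simp add: lipschitz_on_def)
  with ext vg show "v \<in> extensional (closure \<Omega>) \<and> \<sigma>-lipschitz_on (closure \<Omega>) v \<and> (\<forall>x\<in>frontier \<Omega>. v x = g x)" by simp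
next
  assume v: "v \<in> extensional (closure \<Omega>) \<and> \<sigma>-lipschitz_on (closure \<Omega>) v \<and> (\<forall>x\<in>frontier \<Omega>. v x = g x)"
  then have lip: "\<sigma>-lipschitz_on (closure \<Omega>) v" by simp
  note [measurable] = borel_measurable_gradient_lebesgue_on[OF lip]
  have "esssup (lebesgue_on \<Omega>) (\<lambda>x. ereal (norm (\<nabla> v x))) \<le> ereal \<sigma>"
  proof (rule esssup_I)
    show "(\<lambda>x. ereal (norm (\<nabla> v x))) \<in> borel_measurable (lebesgue_on \<Omega>)" by measurable
    show "AE x in lebesgue_on \<Omega>. ereal (norm (\<nabla> v x)) \<le> ereal \<sigma>"
      using GDERIV_gradient_AE_lebesgue_on[OF lip] by eventually_elim simp
  qed
  then show "v \<in> S \<Omega> a g" using v lip unfolding S_def lipschitz_space_def by (auto simp: \<sigma>)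
qed

lemma S_D:
  assumes "v \<in> S \<Omega> a g"
  shows S_extensional: "v \<in> extensional (closure \<Omega>)"
    and S_lipschitz: "\<sigma>-lipschitz_on (closure \<Omega>) v"
    and S_frontier: "\<And>x. x \<in> frontier \<Omega> \<Longrightarrow> v x = g x"
  using assms by (auto simp: S_iff)

definition diff_ext :: "('a \<Rightarrow> real) \<Rightarrow> ('a \<Rightarrow> real) \<Rightarrow> 'a \<Rightarrow> real" where
  "diff_ext u v x = (if x \<in> \<Omega> then u x - v x else 0)"

text \<open>A segment from inside \<Omega> to outside meets the frontier, where the difference is 0
  because both functions equal \<open>g\<close>; so extending by 0 keeps the constant
  \<open>2 * \<sigma>\<close>, the sum of the two constants.\<close>

lemma diff_ext_lipschitz:
  assumes u: "u \<in> S \<Omega> a g" and v: "v \<in> S \<Omega> a g"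
  shows "(2 * \<sigma>)-lipschitz_on UNIV (diff_ext u v)"
proof -
  have sub: "\<Omega> \<subseteq> closure \<Omega>" by (rule closure_subset)
  have cl: "\<bar>(u x - v x) - (u y - v y)\<bar> \<le> 2 * \<sigma> * dist x y" if "x \<in> closure \<Omega>" "y \<in> closure \<Omega>" for x y
    using lipschitz_onD[OF S_lipschitz[OF u] that] lipschitz_onD[OF S_lipschitz[OF v] that]
    by (simp add: dist_real_def)
  have io: "\<bar>u x - v x\<bar> \<le> 2 * \<sigma> * dist x y" if x: "x \<in> \<Omega>" and y: "y \<notin> \<Omega>" for x y
  proof -
    have "closed_segment x y \<inter> frontier \<Omega> \<noteq> {}"
      using x y by (intro connected_Int_frontier) auto
    then obtain z where z: "z \<in> closed_segment x y" "z \<in> frontier \<Omega>" by blast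
    have "z \<in> closure \<Omega>" using z by (simp add: frontier_def)
    moreover have "u z - v z = 0" using S_frontier[OF u z(2)] S_frontier[OF v z(2)] by simp
    ultimately have "\<bar>u x - v x\<bar> \<le> 2 * \<sigma> * dist x z" using cl[of x z] x sub by auto
    also have "\<dots> \<le> 2 * \<sigma> * dist x y"
      using dist_in_closed_segment[OF z(1)] \<sigma> by (intro mult_left_mono) (auto simp: dist_commute)
    finally show ?thesis .
  qed
  show ?thesis
  proof (rule lipschitz_onI)
    fix x y
    show "dist (diff_ext u v x) (diff_ext u v y) \<le> 2 * \<sigma> * dist x y"
      using cl[of x y] io[of x y] io[of y x] sub \<sigma>
      by (auto simp: diff_ext_def dist_real_def dist_commute)
  qed (use \<sigma> in auto)
qed

text \<open>The link between the whole-space notion used for difference quotients and the gradients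
  in \<open>F\<close>: near a point of the open set \<Omega> the zero extension is
  \<open>u - v\<close>.\<close>

lemma energy_diff_ext:
  assumes u: "u \<in> S \<Omega> a g" and v: "v \<in> S \<Omega> a g"
  shows "(\<integral>\<^sup>+x. ennreal ((dir_deriv (diff_ext u v) e x)\<^sup>2) * indicator \<Omega> x \<partial>lborel) =
    (\<integral>\<^sup>+x. ennreal (((\<nabla> u x - \<nabla> v x) \<bullet> e)\<^sup>2) \<partial>lebesgue_on \<Omega>)"
proof -
  have "AE x in lborel. x \<in> \<Omega> \<longrightarrow> GDERIV u x :> \<nabla> u x \<and> norm (\<nabla> u x) \<le> \<sigma>"
    using GDERIV_gradient_AE_lebesgue_on[OF S_lipschitz[OF u]] by (simp only: AE_lebesgue_on_iff[OF open_\<Omega>])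
  moreover have "AE x in lborel. x \<in> \<Omega> \<longrightarrow> GDERIV v x :> \<nabla> v x \<and> norm (\<nabla> v x) \<le> \<sigma>"
    using GDERIV_gradient_AE_lebesgue_on[OF S_lipschitz[OF v]] by (simp only: AE_lebesgue_on_iff[OF open_\<Omega>])
  ultimately have "AE x in lborel. ennreal ((dir_deriv (diff_ext u v) e x)\<^sup>2) * indicator \<Omega> x =
      ennreal (((\<nabla> u x - \<nabla> v x) \<bullet> e)\<^sup>2) * indicator \<Omega> x"
  proof eventually_elim
    case (elim x)
    show ?case
    proof (cases "x \<in> \<Omega>")
      case True
      have "GDERIV (\<lambda>y. u y - v y) x :> \<nabla> u x - \<nabla> v x" using elim True by (intro GDERIV_diff) auto
      then have "GDERIV (diff_ext u v) x :> \<nabla> u x - \<nabla> v x"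
        using GDERIV_cong_open[OF open_\<Omega> True, of "diff_ext u v" "\<lambda>y. u y - v y"] by (simp add: diff_ext_def)
      then have "dir_deriv (diff_ext u v) e x = (\<nabla> u x - \<nabla> v x) \<bullet> e"
        by (intro dir_deriv_eqI has_dir_deriv_if_GDERIV)
      then show ?thesis by simp
    qed simp
  qed
  then show ?thesis unfolding nn_integral_lebesgue_on[OF open_\<Omega>] by (rule nn_integral_cong_AE)
qed

section \<open>Energy, load and gradient distance\<close>

definition energy :: "('a \<Rightarrow> real) \<Rightarrow> ennreal" where
  "energy v = (\<integral>\<^sup>+x. \<Phi> a (norm (\<nabla> v x)) \<partial>lebesgue_on \<Omega>)"

definition load :: "('a \<Rightarrow> real) \<Rightarrow> real" where
  "load v = (LINT x|lebesgue_on \<Omega>. f x * v x)"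

text \<open>The squared L2 distance of the gradients, left squared because this is the gain in the
  midpoint inequality.\<close>

definition grad_dist :: "('a \<Rightarrow> real) \<Rightarrow> ('a \<Rightarrow> real) \<Rightarrow> ennreal" where
  "grad_dist u v = (\<integral>\<^sup>+x. ennreal ((norm (\<nabla> u x - \<nabla> v x))\<^sup>2) \<partial>lebesgue_on \<Omega>)"

text \<open>On \<open>S\<close> the gradient has norm at most \<sigma> almost everywhere, so the
  infinite branch of \<open>G\<close> is met on a null set only.\<close>

lemma F_eq:
  assumes v: "v \<in> S \<Omega> a g"
  shows "F \<Omega> a f v = enn2ereal (energy v) - ereal (load v)"
proof -
  have "(\<integral>\<^sup>+x. G a (\<nabla> v x) \<partial>lebesgue_on \<Omega>) = energy v"
    unfolding energy_def
  proof (rule nn_integral_cong_AE)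
    show "AE x in lebesgue_on \<Omega>. G a (\<nabla> v x) = \<Phi> a (norm (\<nabla> v x))"
      using GDERIV_gradient_AE_lebesgue_on[OF S_lipschitz[OF v]]
      by eventually_elim (simp add: G_def \<sigma>)
  qed
  then show ?thesis by (simp add: F_def load_def)
qed

lemma F_real:
  assumes v: "v \<in> S \<Omega> a g" and fin: "F \<Omega> a f v < \<infinity>"
  shows "energy v = ennreal (enn2real (energy v))" "F \<Omega> a f v = ereal (enn2real (energy v) - load v)"
proof -
  have "energy v \<noteq> top" using fin by (auto simp: F_eq[OF v])
  then show "energy v = ennreal (enn2real (energy v))" by (simp add: less_top)
  then have "enn2ereal (energy v) = ereal (enn2real (energy v))"
    by (metis enn2ereal_ennreal enn2real_nonneg)
  then show "F \<Omega> a f v = ereal (enn2real (energy v) - load v)" by (simp add: F_eq[OF v])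
qed

lemma grad_dist_eq_sum:
  assumes u: "u \<in> S \<Omega> a g" and v: "v \<in> S \<Omega> a g"
  shows "grad_dist u v = (\<Sum>b\<in>Basis. \<integral>\<^sup>+x. ennreal (((\<nabla> u x - \<nabla> v x) \<bullet> b)\<^sup>2) \<partial>lebesgue_on \<Omega>)"
proof -
  note [measurable] = borel_measurable_gradient_lebesgue_on[OF S_lipschitz[OF u]] borel_measurable_gradient_lebesgue_on[OF S_lipschitz[OF v]]
  have "ennreal ((norm z)\<^sup>2) = (\<Sum>b\<in>Basis. ennreal ((z \<bullet> b)\<^sup>2))" for z :: 'a
    by (simp add: sum_ennreal power2_norm_eq_inner euclidean_inner[of z z] flip: power2_eq_square)
  then have "grad_dist u v = (\<integral>\<^sup>+x. (\<Sum>b\<in>Basis. ennreal (((\<nabla> u x - \<nabla> v x) \<bullet> b)\<^sup>2)) \<partial>lebesgue_on \<Omega>)"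
    unfolding grad_dist_def by (simp only:)
  also have "\<dots> = (\<Sum>b\<in>Basis. \<integral>\<^sup>+x. ennreal (((\<nabla> u x - \<nabla> v x) \<bullet> b)\<^sup>2) \<partial>lebesgue_on \<Omega>)"
    by (rule nn_integral_sum) measurable
  finally show ?thesis .
qed

definition midpt :: "('a \<Rightarrow> real) \<Rightarrow> ('a \<Rightarrow> real) \<Rightarrow> 'a \<Rightarrow> real" where
  "midpt u v = restrict (\<lambda>x. (u x + v x) / 2) (closure \<Omega>)"

lemma midpt_S:
  assumes u: "u \<in> S \<Omega> a g" and v: "v \<in> S \<Omega> a g"
  shows "midpt u v \<in> S \<Omega> a g"
  unfolding S_iff
proof (intro conjI ballI)
  show "midpt u v \<in> extensional (closure \<Omega>)" by (simp add: midpt_def)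
  show "\<sigma>-lipschitz_on (closure \<Omega>) (midpt u v)"
  proof (rule lipschitz_onI)
    fix x y assume xy: "x \<in> closure \<Omega>" "y \<in> closure \<Omega>"
    have eq: "(u x + v x) / 2 - (u y + v y) / 2 = ((u x - u y) + (v x - v y)) / 2" by (simp add: field_simps)
    have "\<bar>(u x + v x) / 2 - (u y + v y) / 2\<bar> \<le> \<sigma> * dist x y"
      using lipschitz_onD[OF S_lipschitz[OF u] xy] lipschitz_onD[OF S_lipschitz[OF v] xy]
        abs_triangle_ineq[of "u x - u y" "v x - v y"]
      unfolding eq abs_divide dist_real_def by simp
    then show "dist (midpt u v x) (midpt u v y) \<le> \<sigma> * dist x y"
      using xy by (simp add: midpt_def dist_real_def)
  qed (use \<sigma> in simp)
  fix x assume x: "x \<in> frontier \<Omega>"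
  then show "midpt u v x = g x"
    using S_frontier[OF u x] S_frontier[OF v x] by (simp add: midpt_def frontier_def)
qed

lemma energy_midpt:
  assumes u: "u \<in> S \<Omega> a g" and v: "v \<in> S \<Omega> a g"
  shows "energy (midpt u v) + ennreal (a 2 / 8) * grad_dist u v \<le> ennreal (1/2) * (energy u + energy v)"
proof -
  note m = midpt_S[OF u v]
  note [measurable] = borel_measurable_gradient_lebesgue_on[OF S_lipschitz[OF u]] borel_measurable_gradient_lebesgue_on[OF S_lipschitz[OF v]]
    borel_measurable_gradient_lebesgue_on[OF S_lipschitz[OF m]]  borel_measurable_\<Phi>[of a]
  have \<Phi>m: "(\<lambda>x. \<Phi> a (norm (h x))) \<in> borel_measurable (lebesgue_on \<Omega>)"
    if "h \<in> borel_measurable (lebesgue_on \<Omega>)" for h :: "'a \<Rightarrow> 'a"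
    using measurable_compose[OF measurable_compose[OF that borel_measurable_norm] borel_measurable_\<Phi>] .
  have AE: "AE x in lebesgue_on \<Omega>. \<nabla> (midpt u v) x = (1/2) *\<^sub>R (\<nabla> u x + \<nabla> v x)"
    using GDERIV_gradient_AE_lebesgue_on[OF S_lipschitz[OF u]] GDERIV_gradient_AE_lebesgue_on[OF S_lipschitz[OF v]]
      AE_space[of "lebesgue_on \<Omega>"]
  proof eventually_elim
    case (elim x)
    then have x: "x \<in> \<Omega>" by simp
    have "((\<lambda>y. (u y + v y) / 2) has_derivative (\<lambda>h. (h \<bullet> \<nabla> u x + h \<bullet> \<nabla> v x) / 2)) (at x)"
      using elim unfolding gderiv_def by (auto intro!: derivative_eq_intros)
    then have "GDERIV (\<lambda>y. (u y + v y) / 2) x :> (1/2) *\<^sub>R (\<nabla> u x + \<nabla> v x)"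
      unfolding gderiv_def by (rule has_derivative_eq_rhs) (auto simp: inner_add_right)
    moreover have "midpt u v y = (u y + v y) / 2" if "y \<in> \<Omega>" for y
      using that closure_subset[of \<Omega>] by (auto simp: midpt_def)
    ultimately have "GDERIV (midpt u v) x :> (1/2) *\<^sub>R (\<nabla> u x + \<nabla> v x)"
      using GDERIV_cong_open[OF open_\<Omega> x, of "midpt u v" "\<lambda>y. (u y + v y) / 2"] by simp
    then show ?case by (rule gradient_eqI)
  qed
  have "energy (midpt u v) + ennreal (a 2 / 8) * grad_dist u v =
      (\<integral>\<^sup>+x. \<Phi> a (norm (\<nabla> (midpt u v) x)) + ennreal (a 2 / 8) * ennreal ((norm (\<nabla> u x - \<nabla> v x))\<^sup>2) \<partial>lebesgue_on \<Omega>)"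
    unfolding energy_def grad_dist_def by (subst nn_integral_add) (auto simp: nn_integral_cmult intro!: \<Phi>m)
  also have "\<dots> \<le> (\<integral>\<^sup>+x. ennreal (1/2) * (\<Phi> a (norm (\<nabla> u x)) + \<Phi> a (norm (\<nabla> v x))) \<partial>lebesgue_on \<Omega>)"
  proof (rule nn_integral_mono_AE)
    show "AE x in lebesgue_on \<Omega>. \<Phi> a (norm (\<nabla> (midpt u v) x)) + ennreal (a 2 / 8) * ennreal ((norm (\<nabla> u x - \<nabla> v x))\<^sup>2)
        \<le> ennreal (1/2) * (\<Phi> a (norm (\<nabla> u x)) + \<Phi> a (norm (\<nabla> v x)))"
      using AE
    proof eventually_elim
      case (elim x)
      have "ennreal (a 2 / 8) * ennreal ((norm (\<nabla> u x - \<nabla> v x))\<^sup>2) = ennreal (a 2 / 8 * (norm (\<nabla> u x - \<nabla> v x))\<^sup>2)"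
        using a2 by (subst ennreal_mult) auto
      with \<Phi>_midpoint_le[of a "\<nabla> u x" "\<nabla> v x"] a_nonneg show ?case unfolding elim by simp
    qed
  qed
  also have "\<dots> = ennreal (1/2) * (energy u + energy v)"
    unfolding energy_def
    by (subst nn_integral_cmult, intro borel_measurable_add \<Phi>m, measurable, subst nn_integral_add)
      (auto intro!: \<Phi>m)
  finally show ?thesis .
qed

text \<open>Comparison with the fixed \<open>w\<close>: the zero extension of \<open>v - w\<close>
  is \<open>2 * \<sigma>\<close>-Lipschitz and vanishes at \<open>\<rho> *\<^sub>R b\<close>, a
  point outside \<Omega> within \<open>2 * \<rho>\<close> of every point of \<Omega>. The resulting
  bound is the same for all \<open>v\<close>.\<close>

lemma S_uniformly_bounded:
  assumes w: "w \<in> S \<Omega> a g"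
  obtains K where "0 \<le> K" "\<And>v x. v \<in> S \<Omega> a g \<Longrightarrow> x \<in> closure \<Omega> \<Longrightarrow> \<bar>v x\<bar> \<le> K"
proof -
  obtain \<rho> where \<rho>: "0 < \<rho>" "\<Omega> \<subseteq> ball 0 \<rho>" using bounded_\<Omega> bounded_subset_ballD by blast
  have "compact (closure \<Omega>)" using bounded_\<Omega> by simp
  moreover have "continuous_on (closure \<Omega>) w" using S_lipschitz[OF w] by (rule lipschitz_on_continuous_on)
  ultimately have "bounded (w ` closure \<Omega>)" by (intro compact_imp_bounded compact_continuous_image)
  then obtain B where B: "\<And>x. x \<in> closure \<Omega> \<Longrightarrow> \<bar>w x\<bar> \<le> B" by (auto simp: bounded_real)
  obtain b :: 'a where b: "b \<in> Basis" using nonempty_Basis by blast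
  have b\<Omega>: "\<rho> *\<^sub>R b \<notin> \<Omega>" using \<rho> b by (auto simp: subset_iff)
  show ?thesis
  proof (rule that[of "\<bar>B\<bar> + 2 * \<sigma> * (2 * \<rho>)"])
    show "0 \<le> \<bar>B\<bar> + 2 * \<sigma> * (2 * \<rho>)" using \<rho> \<sigma> by simp
    fix v x assume v: "v \<in> S \<Omega> a g" and x: "x \<in> closure \<Omega>"
    have "\<bar>v x - w x\<bar> \<le> 2 * \<sigma> * (2 * \<rho>)"
    proof (cases "x \<in> \<Omega>")
      case True
      have "\<bar>v x - w x\<bar> = dist (diff_ext v w x) (diff_ext v w (\<rho> *\<^sub>R b))"
        using True b\<Omega> by (simp add: diff_ext_def dist_real_def)
      also have "\<dots> \<le> 2 * \<sigma> * dist x (\<rho> *\<^sub>R b)" using lipschitz_onD[OF diff_ext_lipschitz[OF v w]] by simp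
      also have "dist x (\<rho> *\<^sub>R b) \<le> norm x + norm (\<rho> *\<^sub>R b)" unfolding dist_norm by (rule norm_triangle_ineq4)
      also have "norm x + norm (\<rho> *\<^sub>R b) \<le> 2 * \<rho>" using True \<rho> b by auto
      finally show ?thesis using \<sigma> by simp
    next
      case False
      then have "x \<in> frontier \<Omega>" using x open_\<Omega> by (simp add: frontier_def interior_open)
      then show ?thesis using S_frontier[OF v] S_frontier[OF w] \<rho> \<sigma> by simp
    qed
    then show "\<bar>v x\<bar> \<le> \<bar>B\<bar> + 2 * \<sigma> * (2 * \<rho>)" using B[OF x] by linarith
  qed
qed

lemma S_borel_measurable:
  assumes v: "v \<in> S \<Omega> a g"
  shows "v \<in> borel_measurable (lebesgue_on \<Omega>)"
proof -
  obtain V where V: "\<sigma>-lipschitz_on UNIV V" "\<And>x. x \<in> closure \<Omega> \<Longrightarrow> V x = v x"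
    using S_lipschitz[OF v] by (rule lipschitz_extension_UNIV) blast
  have "V \<in> borel_measurable lborel" using borel_measurable_lipschitz[OF V(1)] by simp
  then have "V \<in> borel_measurable (lebesgue_on \<Omega>)" by (intro measurable_restrict_space1 measurable_completion)
  moreover have "V x = v x" if "x \<in> \<Omega>" for x using that V(2) closure_subset by blast
  ultimately show ?thesis by (subst measurable_cong[of _ _ V]) auto
qed

lemma load_integrable:
  assumes v: "v \<in> S \<Omega> a g"
  shows "integrable (lebesgue_on \<Omega>) (\<lambda>x. f x * v x)"
proof -
  note [measurable] = S_borel_measurable[OF v] borel_measurable_integrable[OF f_integrable]
  obtain K where K: "0 \<le> K" "\<And>v x. v \<in> S \<Omega> a g \<Longrightarrow> x \<in> closure \<Omega> \<Longrightarrow> \<bar>v x\<bar> \<le> K"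
    using S_uniformly_bounded[OF v] by blast
  show ?thesis
  proof (rule Bochner_Integration.integrable_bound)
    show "integrable (lebesgue_on \<Omega>) (\<lambda>x. f x * K)" using f_integrable by simp
    show "AE x in lebesgue_on \<Omega>. norm (f x * v x) \<le> norm (f x * K)"
    proof (rule AE_I2)
      fix x assume "x \<in> space (lebesgue_on \<Omega>)"
      then have "\<bar>v x\<bar> \<le> K" using K(2)[OF v] closure_subset[of \<Omega>] by auto
      then show "norm (f x * v x) \<le> norm (f x * K)" using K(1) by (simp add: abs_mult mult_left_mono)
    qed
  qed measurable
qed

lemma load_diff_le:
  assumes u: "u \<in> S \<Omega> a g" and v: "v \<in> S \<Omega> a g" and le: "\<And>x. x \<in> \<Omega> \<Longrightarrow> \<bar>u x - v x\<bar> \<le> \<epsilon>"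
  shows "\<bar>load u - load v\<bar> \<le> \<epsilon> * (LINT x|lebesgue_on \<Omega>. \<bar>f x\<bar>)"
proof -
  have int: "integrable (lebesgue_on \<Omega>) (\<lambda>x. f x * u x - f x * v x)"
    using load_integrable[OF u] load_integrable[OF v] by (rule Bochner_Integration.integrable_diff)
  have "load u - load v = (LINT x|lebesgue_on \<Omega>. f x * u x - f x * v x)"
    unfolding load_def by (intro Bochner_Integration.integral_diff[symmetric] load_integrable u v)
  then have "\<bar>load u - load v\<bar> \<le> (LINT x|lebesgue_on \<Omega>. \<bar>f x * u x - f x * v x\<bar>)"
    by (simp only: integral_abs_bound)
  also have "\<dots> \<le> (LINT x|lebesgue_on \<Omega>. \<epsilon> * \<bar>f x\<bar>)"
  proof (rule integral_mono)
    show "integrable (lebesgue_on \<Omega>) (\<lambda>x. \<bar>f x * u x - f x * v x\<bar>)" using int by (rule integrable_abs)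
    show "integrable (lebesgue_on \<Omega>) (\<lambda>x. \<epsilon> * \<bar>f x\<bar>)" using f_integrable by simp
    fix x assume "x \<in> space (lebesgue_on \<Omega>)"
    then have "\<bar>f x\<bar> * \<bar>u x - v x\<bar> \<le> \<bar>f x\<bar> * \<epsilon>" by (intro mult_left_mono le) auto
    then show "\<bar>f x * u x - f x * v x\<bar> \<le> \<epsilon> * \<bar>f x\<bar>"
      by (simp only: abs_mult mult.commute flip: right_diff_distrib)
  qed
  finally show ?thesis by simp
qed

lemma load_midpt:
  assumes u: "u \<in> S \<Omega> a g" and v: "v \<in> S \<Omega> a g"
  shows "load (midpt u v) = (load u + load v) / 2"
proof -
  have "load (midpt u v) = (LINT x|lebesgue_on \<Omega>. (f x * u x + f x * v x) / 2)"
    unfolding load_def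
  proof (rule Bochner_Integration.integral_cong)
    fix x assume "x \<in> space (lebesgue_on \<Omega>)"
    then have "x \<in> closure \<Omega>" using closure_subset[of \<Omega>] by auto
    then show "f x * midpt u v x = (f x * u x + f x * v x) / 2" by (simp add: midpt_def distrib_left)
  qed simp
  also have "\<dots> = (load u + load v) / 2"
    unfolding load_def using load_integrable[OF u] load_integrable[OF v] by simp
  finally show ?thesis .
qed

text \<open>The midpoint of two near-minimizers is a competitor with value at least
  \<open>m\<close>, so the gain \<open>a 2 / 8 * grad_dist u v\<close> cannot exceed the mean
  \<open>(\<epsilon> + \<delta>) / 2\<close> of the two excesses; hence the constant
  \<open>4 / a 2\<close>. Zero excesses give uniqueness, a minimizing sequence gives the Cauchy
  property.\<close>

lemma grad_dist_gap:
  assumes u: "u \<in> S \<Omega> a g" and v: "v \<in> S \<Omega> a g"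
    and inf: "\<And>w. w \<in> S \<Omega> a g \<Longrightarrow> ereal m \<le> F \<Omega> a f w"
    and u_le: "F \<Omega> a f u \<le> ereal (m + \<epsilon>)" and v_le: "F \<Omega> a f v \<le> ereal (m + \<delta>)"
  shows "grad_dist u v \<le> ennreal (4 / a 2 * (\<epsilon> + \<delta>))"
proof -
  note mid = midpt_S[OF u v]
  have uf: "F \<Omega> a f u < \<infinity>" and vf: "F \<Omega> a f v < \<infinity>" using u_le v_le by (auto simp: le_less_trans)
  note Eu = F_real[OF u uf] and Ev = F_real[OF v vf]
  define p where "p = enn2real (energy u)"
  define q where "q = enn2real (energy v)"
  have pq: "0 \<le> p" "0 \<le> q" by (auto simp: p_def q_def)
  have half: "ennreal (1/2) * (energy u + energy v) = ennreal ((p + q) / 2)"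
  proof -
    have "ennreal (1/2) * (energy u + energy v) = ennreal (1/2) * ennreal (p + q)"
      using Eu(1) Ev(1) pq by (simp add: p_def q_def)
    also have "\<dots> = ennreal (1/2 * (p + q))" using pq by (subst ennreal_mult) auto
    finally show ?thesis by simp
  qed
  have main: "energy (midpt u v) + ennreal (a 2 / 8) * grad_dist u v \<le> ennreal ((p + q) / 2)"
    using energy_midpt[OF u v] unfolding half .
  have fin1: "energy (midpt u v) < top" and fin2: "ennreal (a 2 / 8) * grad_dist u v < top"
    using main by (auto intro: le_less_trans[OF order_trans[OF _ main]])
  have "F \<Omega> a f (midpt u v) < \<infinity>"
    using fin1 unfolding F_eq[OF mid] by (cases "energy (midpt u v)") (auto simp: enn2ereal_ennreal)
  note Em = F_real[OF mid this]
  define r where "r = enn2real (energy (midpt u v))"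
  have r: "0 \<le> r" "energy (midpt u v) = ennreal r" using Em(1) by (auto simp: r_def)
  have "grad_dist u v < top" using fin2 a2 by (auto simp: ennreal_mult_less_top)
  then obtain d where d: "0 \<le> d" "grad_dist u v = ennreal d" by (cases "grad_dist u v") auto
  have "ennreal (a 2 / 8 * d) = ennreal (a 2 / 8) * ennreal d" using d a2 by (intro ennreal_mult) auto
  moreover have "ennreal (r + a 2 / 8 * d) = ennreal r + ennreal (a 2 / 8 * d)"
    using r d a2 by (intro ennreal_plus) auto
  ultimately have "ennreal (r + a 2 / 8 * d) = energy (midpt u v) + ennreal (a 2 / 8) * grad_dist u v"
    by (simp only: r(2) d(2))
  then have "ennreal (r + a 2 / 8 * d) \<le> ennreal ((p + q) / 2)" using main by simp
  then have 1: "r + a 2 / 8 * d \<le> (p + q) / 2" using pq by (simp add: ennreal_le_iff)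
  have "m \<le> r - (load u + load v) / 2" using inf[OF mid] unfolding Em(2) load_midpt[OF u v] r_def by simp
  moreover have "p - load u \<le> m + \<epsilon>" using u_le unfolding Eu(2) p_def by simp
  moreover have "q - load v \<le> m + \<delta>" using v_le unfolding Ev(2) q_def by simp
  ultimately have "a 2 / 8 * d \<le> (\<epsilon> + \<delta>) / 2" using 1 by (simp add: field_simps)
  then have "d \<le> 4 / a 2 * (\<epsilon> + \<delta>)" using a2 by (simp add: field_simps)
  then show ?thesis unfolding d(2) by (rule ennreal_leI)
qed

text \<open>All directional derivatives of the zero extension of \<open>u - v\<close> vanish, so it
  is 0; on the frontier both functions equal \<open>g\<close>. Equality as total functions follows
  because both are \<open>undefined\<close> off the closure.\<close>

lemma eq_if_grad_dist_zero:
  assumes u: "u \<in> S \<Omega> a g" and v: "v \<in> S \<Omega> a g" and zero: "grad_dist u v = 0"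
  shows "u = v"
proof (rule extensionalityI[OF S_extensional[OF u] S_extensional[OF v]])
  note [measurable] = borel_measurable_gradient_lebesgue_on[OF S_lipschitz[OF u]] borel_measurable_gradient_lebesgue_on[OF S_lipschitz[OF v]]
  have "AE x in lebesgue_on \<Omega>. ennreal ((norm (\<nabla> u x - \<nabla> v x))\<^sup>2) = 0"
    using zero unfolding grad_dist_def by (subst (asm) nn_integral_0_iff_AE) auto
  then have eq: "AE x in lebesgue_on \<Omega>. \<nabla> u x - \<nabla> v x = 0"
    by eventually_elim (simp add: ennreal_eq_0_iff)
  have dd: "AE x in lborel. x \<in> \<Omega> \<longrightarrow> dir_deriv (diff_ext u v) e x = 0" for e
  proof -
    note [measurable] = borel_measurable_dir_deriv[OF diff_ext_lipschitz[OF u v]]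
    have [measurable]: "\<Omega> \<in> sets borel" using open_\<Omega> by simp
    have "(\<integral>\<^sup>+x. ennreal ((dir_deriv (diff_ext u v) e x)\<^sup>2) * indicator \<Omega> x \<partial>lborel) = (\<integral>\<^sup>+x. 0 \<partial>lebesgue_on \<Omega>)"
      unfolding energy_diff_ext[OF u v] using eq by (intro nn_integral_cong_AE) (auto elim: eventually_mono)
    then have "(\<integral>\<^sup>+x. ennreal ((dir_deriv (diff_ext u v) e x)\<^sup>2) * indicator \<Omega> x \<partial>lborel) = 0" by simp
    then have "AE x in lborel. ennreal ((dir_deriv (diff_ext u v) e x)\<^sup>2) * indicator \<Omega> x = 0"
      by (subst (asm) nn_integral_0_iff_AE) auto
    then show ?thesis by eventually_elim (auto simp: ennreal_eq_0_iff)
  qed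
  fix x assume x: "x \<in> closure \<Omega>"
  show "u x = v x"
  proof (cases "x \<in> \<Omega>")
    case True
    have "diff_ext u v x = 0"
      by (rule zero_if_dir_deriv_zero[OF diff_ext_lipschitz[OF u v] open_\<Omega> bounded_\<Omega> _ dd]) (simp add: diff_ext_def)
    then show ?thesis using True by (simp add: diff_ext_def)
  next
    case False
    then have "x \<in> frontier \<Omega>" using x open_\<Omega> by (simp add: frontier_def interior_open)
    then show ?thesis using S_frontier[OF u] S_frontier[OF v] by simp
  qed
qed

section \<open>Compactness and lower semicontinuity\<close>

lemma S_uniform_limit_subseq:
  assumes us: "\<And>n. us n \<in> S \<Omega> a g"
  obtains u k where "u \<in> S \<Omega> a g" "strict_mono (k :: nat \<Rightarrow> nat)"
    "\<forall>\<epsilon>>0. \<exists>N. \<forall>n\<ge>N. \<forall>x\<in>closure \<Omega>. \<bar>us (k n) x - u x\<bar> < \<epsilon>"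
proof -
  obtain K where K: "0 \<le> K" "\<And>v x. v \<in> S \<Omega> a g \<Longrightarrow> x \<in> closure \<Omega> \<Longrightarrow> \<bar>v x\<bar> \<le> K"
    using S_uniformly_bounded[OF us[of 0]] by blast
  have equi: "\<exists>d>0. \<forall>n y. y \<in> closure \<Omega> \<and> norm (x - y) < d \<longrightarrow> norm (us n x - us n y) < e"
    if x: "x \<in> closure \<Omega>" and e: "0 < e" for x e
  proof (intro exI[of _ "e / \<sigma>"] conjI allI impI)
    show "0 < e / \<sigma>" using e \<sigma> by simp
    fix n y assume y: "y \<in> closure \<Omega> \<and> norm (x - y) < e / \<sigma>"
    have "norm (us n x - us n y) \<le> \<sigma> * norm (x - y)"
      using lipschitz_onD[OF S_lipschitz[OF us], of x y n] x y by (simp add: dist_norm)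
    also have "\<dots> < e" using y \<sigma> by (simp add: field_simps)
    finally show "norm (us n x - us n y) < e" .
  qed
  obtain u0 :: "'a \<Rightarrow> real" and k where k: "strict_mono (k :: nat \<Rightarrow> nat)"
    and lim: "\<And>e. 0 < e \<Longrightarrow> \<exists>N. \<forall>n x. n \<ge> N \<and> x \<in> closure \<Omega> \<longrightarrow> norm (us (k n) x - u0 x) < e"
  proof (rule Arzela_Ascoli[of "closure \<Omega>" us K])
    show "compact (closure \<Omega>)" using bounded_\<Omega> by (simp add: compact_closure)
    show "norm (us n x) \<le> K" if "x \<in> closure \<Omega>" for n x using K(2)[OF us that] by simp
    show "\<exists>d. 0 < d \<and> (\<forall>n y. y \<in> closure \<Omega> \<and> norm (x - y) < d \<longrightarrow> norm (us n x - us n y) < e)"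
      if "x \<in> closure \<Omega>" "0 < e" for x e using equi[OF that] .
  qed (rule that)
  \<comment> \<open>Arzela--Ascoli determines the limit on the closure only; membership in
    \<open>S\<close> asks for \<open>undefined\<close> elsewhere.\<close>
  define u where "u = restrict u0 (closure \<Omega>)"
  have lim': "\<exists>N. \<forall>n\<ge>N. \<forall>x\<in>closure \<Omega>. \<bar>us (k n) x - u x\<bar> < \<epsilon>" if "0 < \<epsilon>" for \<epsilon>
    using lim[OF that] by (auto simp: u_def)
  have ptw: "(\<lambda>n. us (k n) x) \<longlonglongrightarrow> u x" if "x \<in> closure \<Omega>" for x
    using lim' that unfolding LIMSEQ_def dist_real_def by blast
  have "u \<in> S \<Omega> a g"
    unfolding S_iff
  proof (intro conjI ballI)
    show "u \<in> extensional (closure \<Omega>)" by (simp add: u_def)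
    show "\<sigma>-lipschitz_on (closure \<Omega>) u"
    proof (rule lipschitz_onI)
      fix x y assume xy: "x \<in> closure \<Omega>" "y \<in> closure \<Omega>"
      have "(\<lambda>n. dist (us (k n) x) (us (k n) y)) \<longlonglongrightarrow> dist (u x) (u y)" using xy by (intro tendsto_dist ptw)
      then show "dist (u x) (u y) \<le> \<sigma> * dist x y"
        by (rule tendsto_upperbound) (auto intro!: always_eventually lipschitz_onD[OF S_lipschitz[OF us]] xy)
    qed (use \<sigma> in simp)
    fix x assume x: "x \<in> frontier \<Omega>"
    then have "(\<lambda>n. us (k n) x) \<longlonglongrightarrow> u x" by (intro ptw) (simp add: frontier_def)
    moreover have "us n x = g x" for n using S_frontier[OF us x] .
    ultimately show "u x = g x" by (simp add: LIMSEQ_const_iff)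
  qed
  moreover have "\<forall>\<epsilon>>0. \<exists>N. \<forall>n\<ge>N. \<forall>x\<in>closure \<Omega>. \<bar>us (k n) x - u x\<bar> < \<epsilon>" using lim' by simp
  ultimately show ?thesis using that k by metis
qed

text \<open>Lower semicontinuity is applied to each coordinate of the gradient, whose energy is at
  most the whole; summing the coordinates costs the factor \<open>DIM('a)\<close>, harmless when
  \<open>K\<close> tends to 0.\<close>

lemma grad_dist_limit:
  assumes us: "\<And>n. us n \<in> S \<Omega> a g" and u: "u \<in> S \<Omega> a g" and v: "v \<in> S \<Omega> a g"
    and ptw: "\<And>x. x \<in> \<Omega> \<Longrightarrow> (\<lambda>n. us n x) \<longlonglongrightarrow> u x"
    and le: "\<forall>\<^sub>F n in sequentially. grad_dist (us n) v \<le> K"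
  shows "grad_dist u v \<le> of_nat DIM('a) * K"
proof -
  have "(\<integral>\<^sup>+x. ennreal (((\<nabla> u x - \<nabla> v x) \<bullet> b)\<^sup>2) \<partial>lebesgue_on \<Omega>) \<le> K" if b: "b \<in> Basis" for b
    unfolding energy_diff_ext[OF u v, symmetric]
  proof (rule dir_deriv_energy_lsc[OF open_\<Omega> bounded_\<Omega> diff_ext_lipschitz[OF us v] _ diff_ext_lipschitz[OF u v]])
    show "diff_ext (us n) v x = 0" if "x \<notin> \<Omega>" for n x using that by (simp add: diff_ext_def)
    show "(\<lambda>n. diff_ext (us n) v x) \<longlonglongrightarrow> diff_ext u v x" for x
      by (cases "x \<in> \<Omega>") (auto simp: diff_ext_def intro!: tendsto_intros ptw)
    show "\<forall>\<^sub>F n in sequentially. (\<integral>\<^sup>+x. ennreal ((dir_deriv (diff_ext (us n) v) b x)\<^sup>2) * indicator \<Omega> x \<partial>lborel) \<le> K"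
      using le
    proof eventually_elim
      case (elim n)
      have "(\<integral>\<^sup>+x. ennreal (((\<nabla> (us n) x - \<nabla> v x) \<bullet> b)\<^sup>2) \<partial>lebesgue_on \<Omega>) \<le> grad_dist (us n) v"
        unfolding grad_dist_eq_sum[OF us v] using b by (intro member_le_sum) auto
      with elim show ?case unfolding energy_diff_ext[OF us v] by order
    qed
  qed
  then have "grad_dist u v \<le> (\<Sum>b\<in>(Basis::'a set). K)"
    unfolding grad_dist_eq_sum[OF u v] by (rule sum_mono)
  then show ?thesis by simp
qed

text \<open>After passing to a subsequence the gradients converge almost everywhere, which is what
  the pointwise semicontinuity of \<open>\<Phi>\<close> needs; Fatou's lemma integrates it.\<close>

lemma energy_le_liminf_subseq:
  assumes us: "\<And>n. us n \<in> S \<Omega> a g" and u: "u \<in> S \<Omega> a g"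
    and lim: "(\<lambda>n. grad_dist (us n) u) \<longlonglongrightarrow> 0"
  obtains r where "strict_mono (r :: nat \<Rightarrow> nat)" "energy u \<le> liminf (\<lambda>n. energy (us (r n)))"
proof -
  note [measurable] = borel_measurable_gradient_lebesgue_on[OF S_lipschitz[OF us]] borel_measurable_gradient_lebesgue_on[OF S_lipschitz[OF u]]
  define h where "h n x = (norm (\<nabla> (us n) x - \<nabla> u x))\<^sup>2" for n x
  have [measurable]: "h n \<in> borel_measurable (lebesgue_on \<Omega>)" for n unfolding h_def by measurable
  \<comment> \<open>The squared differences are bounded by the square of \<open>2 * \<sigma>\<close>
    on a set of finite measure; integrability lets the limit of \<open>grad_dist\<close> be read as
    convergence in L1.\<close>
  have h_int: "integrable (lebesgue_on \<Omega>) (h n)" for n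
  proof (rule integrableI_bounded_set[where A = \<Omega> and B = "(2 * \<sigma>)\<^sup>2"])
    show "\<Omega> \<in> sets (lebesgue_on \<Omega>)" using \<Omega>_lebesgue by (simp add: sets_restrict_space_iff)
    show "emeasure (lebesgue_on \<Omega>) \<Omega> < \<infinity>"
      using \<Omega>_lebesgue emeasure_bounded_finite[OF bounded_\<Omega>] open_\<Omega> by (simp add: emeasure_restrict_space)
    show "AE x in lebesgue_on \<Omega>. x \<in> \<Omega> \<longrightarrow> norm (h n x) \<le> (2 * \<sigma>)\<^sup>2"
      using GDERIV_gradient_AE_lebesgue_on[OF S_lipschitz[OF us[of n]]] GDERIV_gradient_AE_lebesgue_on[OF S_lipschitz[OF u]]
    proof eventually_elim
      case (elim x)
      then have "norm (\<nabla> (us n) x - \<nabla> u x) \<le> 2 * \<sigma>"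
        using norm_triangle_ineq4[of "\<nabla> (us n) x" "\<nabla> u x"] by linarith
      then have "(norm (\<nabla> (us n) x - \<nabla> u x))\<^sup>2 \<le> (2 * \<sigma>)\<^sup>2" by (intro power_mono) auto
      then show ?case by (simp add: h_def)
    qed
  qed auto
  have "grad_dist (us n) u = ennreal (\<integral>x. norm (h n x) \<partial>lebesgue_on \<Omega>)" for n
  proof -
    have "grad_dist (us n) u = (\<integral>\<^sup>+x. ennreal (norm (h n x)) \<partial>lebesgue_on \<Omega>)"
      unfolding grad_dist_def by (simp add: h_def)
    also have "\<dots> = ennreal (\<integral>x. norm (h n x) \<partial>lebesgue_on \<Omega>)"
      by (intro nn_integral_eq_integral integrable_norm h_int) simp
    finally show ?thesis .
  qed
  then have "(\<lambda>n. ennreal (\<integral>x. norm (h n x) \<partial>lebesgue_on \<Omega>)) \<longlonglongrightarrow> ennreal 0" using lim by simp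
  then have "(\<lambda>n. \<integral>x. norm (h n x) \<partial>lebesgue_on \<Omega>) \<longlonglongrightarrow> 0"
    by (subst (asm) tendsto_ennreal_iff) auto
  then obtain r where r: "strict_mono (r :: nat \<Rightarrow> nat)" "AE x in lebesgue_on \<Omega>. (\<lambda>n. h (r n) x) \<longlonglongrightarrow> 0"
    using tendsto_L1_AE_subseq[of "lebesgue_on \<Omega>" h, OF h_int] by blast
  have "energy u \<le> (\<integral>\<^sup>+x. liminf (\<lambda>n. \<Phi> a (norm (\<nabla> (us (r n)) x))) \<partial>lebesgue_on \<Omega>)"
    unfolding energy_def
  proof (rule nn_integral_mono_AE)
    show "AE x in lebesgue_on \<Omega>. \<Phi> a (norm (\<nabla> u x)) \<le> liminf (\<lambda>n. \<Phi> a (norm (\<nabla> (us (r n)) x)))"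
      using r(2)
    proof eventually_elim
      case (elim x)
      have "(\<lambda>n. sqrt (h (r n) x)) \<longlonglongrightarrow> sqrt 0" using elim by (rule tendsto_real_sqrt)
      then have "(\<lambda>n. norm (\<nabla> (us (r n)) x - \<nabla> u x)) \<longlonglongrightarrow> 0" by (simp add: h_def)
      then have "(\<lambda>n. \<nabla> (us (r n)) x) \<longlonglongrightarrow> \<nabla> u x"
        by (rule LIM_zero_cancel[OF tendsto_norm_zero_cancel])
      then show ?case by (intro \<Phi>_le_liminf tendsto_norm)
    qed
  qed
  also have "\<dots> \<le> liminf (\<lambda>n. energy (us (r n)))"
    unfolding energy_def
    by (intro nn_integral_liminf measurable_compose[OF measurable_compose[OF _ borel_measurable_norm] borel_measurable_\<Phi>]) measurable
  finally show ?thesis using r(1) by (intro that)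
qed

section \<open>Existence of a minimizer\<close>

lemma F_bounded_below:
  assumes w: "w \<in> S \<Omega> a g"
  obtains m where "\<And>v. v \<in> S \<Omega> a g \<Longrightarrow> ereal m \<le> F \<Omega> a f v"
proof -
  obtain K where K: "0 \<le> K" "\<And>v x. v \<in> S \<Omega> a g \<Longrightarrow> x \<in> closure \<Omega> \<Longrightarrow> \<bar>v x\<bar> \<le> K"
    using S_uniformly_bounded[OF w] by blast
  define D where "D = load w + 2 * K * (LINT x|lebesgue_on \<Omega>. \<bar>f x\<bar>)"
  show ?thesis
  proof (rule that[of "- D"])
    fix v assume v: "v \<in> S \<Omega> a g"
    have "\<bar>load v - load w\<bar> \<le> 2 * K * (LINT x|lebesgue_on \<Omega>. \<bar>f x\<bar>)"
    proof (rule load_diff_le[OF v w])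
      fix x assume "x \<in> \<Omega>"
      then have "x \<in> closure \<Omega>" using closure_subset by blast
      then show "\<bar>v x - w x\<bar> \<le> 2 * K" using K(2)[OF v, of x] K(2)[OF w, of x] by linarith
    qed
    then have "load v \<le> D" unfolding D_def by linarith
    then have "0 + - ereal D \<le> enn2ereal (energy v) + - ereal (load v)" by (intro add_mono) auto
    then show "ereal (- D) \<le> F \<Omega> a f v" by (simp add: F_eq[OF v] minus_ereal_def)
  qed
qed

text \<open>The minimal value is recorded as a real number \<open>m\<close>, the form in which
  \<open>grad_dist_gap\<close> yields uniqueness.\<close>

theorem exists_minimizer:
  assumes w: "w \<in> S \<Omega> a g" and fin: "F \<Omega> a f w < \<infinity>"
  shows "\<exists>u\<in>S \<Omega> a g. \<exists>m. F \<Omega> a f u = ereal m \<and> (\<forall>v\<in>S \<Omega> a g. ereal m \<le> F \<Omega> a f v)"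
proof -
  define I where "I = (INF v\<in>S \<Omega> a g. F \<Omega> a f v)"
  obtain m0 where "\<And>v. v \<in> S \<Omega> a g \<Longrightarrow> ereal m0 \<le> F \<Omega> a f v" using F_bounded_below[OF w] by blast
  then have "ereal m0 \<le> I" unfolding I_def by (intro INF_greatest)
  moreover have "I \<le> F \<Omega> a f w" unfolding I_def using w by (rule INF_lower)
  ultimately obtain m where m: "I = ereal m" using fin by (cases I) auto
  have inf: "ereal m \<le> F \<Omega> a f v" if "v \<in> S \<Omega> a g" for v
    using that unfolding m[symmetric] I_def by (rule INF_lower)
  define \<epsilon> where "\<epsilon> n = inverse (real (Suc n))" for n
  have \<epsilon>: "0 < \<epsilon> n" for n by (simp add: \<epsilon>_def)
  have \<epsilon>0: "\<epsilon> \<longlonglongrightarrow> 0" unfolding \<epsilon>_def by (rule LIMSEQ_inverse_real_of_nat)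
  have \<epsilon>mono: "\<epsilon> j \<le> \<epsilon> i" if "i \<le> j" for i j using that by (simp add: \<epsilon>_def le_imp_inverse_le)
  have "\<exists>v\<in>S \<Omega> a g. F \<Omega> a f v < ereal (m + \<epsilon> n)" for n
    using m \<epsilon>[of n] unfolding I_def by (subst INF_less_iff[symmetric]) simp
  then obtain us where us: "\<And>n. us n \<in> S \<Omega> a g" "\<And>n. F \<Omega> a f (us n) < ereal (m + \<epsilon> n)" by metis
  obtain u k where u: "u \<in> S \<Omega> a g" and k: "strict_mono (k :: nat \<Rightarrow> nat)"
    and unif: "\<forall>\<epsilon>>0. \<exists>N. \<forall>n\<ge>N. \<forall>x\<in>closure \<Omega>. \<bar>us (k n) x - u x\<bar> < \<epsilon>"
    by (rule S_uniform_limit_subseq[OF us(1)])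
  define vs where "vs n = us (k n)" for n
  have vs: "vs n \<in> S \<Omega> a g" for n by (simp add: vs_def us)
  have Fvs: "F \<Omega> a f (vs n) \<le> ereal (m + \<epsilon> n)" for n
  proof -
    have "F \<Omega> a f (vs n) \<le> ereal (m + \<epsilon> (k n))" unfolding vs_def using us(2) by (rule less_imp_le)
    also have "\<dots> \<le> ereal (m + \<epsilon> n)" using \<epsilon>mono[OF strict_mono_imp_increasing[OF k, of n]] by simp
    finally show ?thesis .
  qed
  have ptw: "(\<lambda>n. vs n x) \<longlonglongrightarrow> u x" if "x \<in> closure \<Omega>" for x
    using unif that unfolding LIMSEQ_def dist_real_def vs_def by blast
  \<comment> \<open>With \<open>n\<close> fixed and \<open>j\<close> tending to infinity, the Cauchy
    estimate becomes a bound on the distance to \<open>u\<close>; \<open>8 / a 2\<close> is twice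
    \<open>4 / a 2\<close>, as \<open>\<epsilon> j \<le> \<epsilon> n\<close>.\<close>
  have gd_le: "grad_dist (vs n) u \<le> of_nat DIM('a) * ennreal (8 / a 2 * \<epsilon> n)" for n
  proof -
    have "\<forall>\<^sub>F j in sequentially. grad_dist (vs j) (vs n) \<le> ennreal (8 / a 2 * \<epsilon> n)"
      using eventually_ge_at_top[of n]
    proof eventually_elim
      case (elim j)
      have "grad_dist (vs j) (vs n) \<le> ennreal (4 / a 2 * (\<epsilon> j + \<epsilon> n))"
        by (rule grad_dist_gap[OF vs vs inf Fvs Fvs])
      also have "4 / a 2 * (\<epsilon> j + \<epsilon> n) \<le> 4 / a 2 * (2 * \<epsilon> n)"
        using a2 \<epsilon>mono[OF elim] by (intro mult_left_mono) auto
      finally show ?case by (simp add: ennreal_leI)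
    qed
    then have "grad_dist u (vs n) \<le> of_nat DIM('a) * ennreal (8 / a 2 * \<epsilon> n)"
      using ptw closure_subset[of \<Omega>] by (intro grad_dist_limit[OF vs u vs]) auto
    then show ?thesis by (simp add: grad_dist_def norm_minus_commute)
  qed
  have "(\<lambda>n. of_nat DIM('a) * ennreal (8 / a 2 * \<epsilon> n)) \<longlonglongrightarrow> of_nat DIM('a) * ennreal (8 / a 2 * 0)"
    by (intro ennreal_tendsto_cmult tendsto_ennrealI tendsto_intros \<epsilon>0) (simp add: of_nat_less_top)
  then have up: "(\<lambda>n. of_nat DIM('a) * ennreal (8 / a 2 * \<epsilon> n)) \<longlonglongrightarrow> 0" by simp
  have gd: "(\<lambda>n. grad_dist (vs n) u) \<longlonglongrightarrow> 0"
    by (rule tendsto_sandwich[OF always_eventually always_eventually tendsto_const up]) (use gd_le in simp_all)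
  obtain r where r: "strict_mono (r :: nat \<Rightarrow> nat)" "energy u \<le> liminf (\<lambda>n. energy (vs (r n)))"
    using energy_le_liminf_subseq[OF vs u gd] by blast
  have ld: "(\<lambda>n. load (vs n)) \<longlonglongrightarrow> load u"
  proof (rule LIMSEQ_I)
    fix e :: real assume e: "0 < e"
    define L where "L = (LINT x|lebesgue_on \<Omega>. \<bar>f x\<bar>)"
    have L: "0 \<le> L" by (simp add: L_def)
    define \<eta> where "\<eta> = e / (L + 1)"
    have "0 < \<eta>" using e L by (simp add: \<eta>_def)
    then obtain N where N: "\<forall>n\<ge>N. \<forall>x\<in>closure \<Omega>. \<bar>vs n x - u x\<bar> < \<eta>" using unif unfolding vs_def by blast
    have "norm (load (vs n) - load u) < e" if "n \<ge> N" for n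
    proof -
      have "\<bar>load (vs n) - load u\<bar> \<le> \<eta> * L"
        unfolding L_def using N that closure_subset[of \<Omega>] by (intro load_diff_le[OF vs u]) (auto intro: less_imp_le)
      also have "\<dots> < \<eta> * (L + 1)" using \<open>0 < \<eta>\<close> by simp
      also have "\<dots> = e" using L by (simp add: \<eta>_def)
      finally show ?thesis by simp
    qed
    then show "\<exists>N. \<forall>n\<ge>N. norm (load (vs n) - load u) < e" by blast
  qed
  have En: "energy (vs n) \<le> ennreal (m + \<epsilon> n + load (vs n))" "0 \<le> m + \<epsilon> n + load (vs n)" for n
  proof -
    have "F \<Omega> a f (vs n) < \<infinity>" using Fvs[of n] by (auto simp: le_less_trans)
    note E = F_real[OF vs this]
    have le: "enn2real (energy (vs n)) \<le> m + \<epsilon> n + load (vs n)" using Fvs[of n] unfolding E(2) by simp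
    show "energy (vs n) \<le> ennreal (m + \<epsilon> n + load (vs n))"
      by (subst E(1)) (rule ennreal_leI[OF le])
    show "0 \<le> m + \<epsilon> n + load (vs n)"
      using enn2real_nonneg le by (rule order_trans)
  qed
  have lim: "(\<lambda>n. m + \<epsilon> n + load (vs n)) \<longlonglongrightarrow> m + 0 + load u" by (intro tendsto_intros \<epsilon>0 ld)
  \<comment> \<open>Fatou's bound holds along \<open>r\<close>; the upper bounds for the energies
    converge along the whole sequence, hence also along \<open>r\<close>.\<close>
  note r(2)
  also have "liminf (\<lambda>n. energy (vs (r n))) \<le> liminf (\<lambda>n. ennreal (m + \<epsilon> (r n) + load (vs (r n))))"
    by (intro Liminf_mono always_eventually allI En(1))
  also have "\<dots> = ennreal (m + 0 + load u)"
    using LIMSEQ_subseq_LIMSEQ[OF lim r(1)]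
    by (intro lim_imp_Liminf[OF sequentially_bot] tendsto_ennrealI) (simp add: o_def)
  finally have "energy u \<le> ennreal (m + load u)" by simp
  \<comment> \<open>\<open>ennreal\<close> sends negative reals to 0, so the sign is needed to
    return to extended reals.\<close>
  moreover have "0 \<le> m + load u" using lim En(2) by (intro tendsto_lowerbound[OF lim, of 0, simplified]) auto
  ultimately have "enn2ereal (energy u) \<le> ereal (m + load u)"
    by (metis enn2ereal_ennreal less_eq_ennreal.rep_eq)
  then have "F \<Omega> a f u \<le> ereal m"
    unfolding F_eq[OF u] by (cases "enn2ereal (energy u)") auto
  then have "F \<Omega> a f u = ereal m" using inf[OF u] by (rule antisym)
  then show ?thesis using u inf by blast
qed

end

theorem theorem3p4:
  fixes \<Omega> :: "'a::euclidean_space set"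
    and a :: "nat \<Rightarrow> real"
    and f g :: "'a \<Rightarrow> real"
  assumes "bounded \<Omega>" "connected \<Omega>" "open \<Omega>" "lipschitz_boundary \<Omega>"
    and "\<And>p. p \<ge> 2 \<Longrightarrow> a p \<ge> 0" "a 2 > 0" "infinite {p. p \<ge> 2 \<and> a p \<noteq> 0}"
    and "0 < conv_radius a" "conv_radius a < \<infinity>"
    and "integrable (lebesgue_on \<Omega>) f"
    and "g \<in> C\<^sup>0\<^sup>,\<^sup>1 (frontier \<Omega>)" "lipschitz_const (frontier \<Omega>) g \<le> conv_radius a"
    and "\<exists>gbar \<in> S \<Omega> a g. F \<Omega> a f gbar < \<infinity>"
  shows "\<exists>!u. u \<in> S \<Omega> a g \<and> (\<forall>v \<in> S \<Omega> a g. F \<Omega> a f u \<le> F \<Omega> a f v)"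
proof -
  obtain \<sigma> where \<sigma>: "conv_radius a = ereal \<sigma>" "0 < \<sigma>"
    using assms(8,9) by (cases "conv_radius a") auto
  interpret power_series_functional \<Omega> a f g \<sigma>
  proof
    show "bounded \<Omega>" by (rule assms(1))
    show "open \<Omega>" by (rule assms(3))
    show "0 < a 2" by (rule assms(6))
    show "0 < \<sigma>" "conv_radius a = ereal \<sigma>" by (rule \<sigma>)+
    show "integrable (lebesgue_on \<Omega>) f" by (rule assms(10))
    show "0 \<le> a p" if "2 \<le> p" for p using assms(5)[OF that] .
    show "lipschitz_const (frontier \<Omega>) g \<le> ereal \<sigma>" using assms(12) \<sigma>(1) by simp
  qed
  obtain u m where u: "u \<in> S \<Omega> a g" "F \<Omega> a f u = ereal m" "\<And>v. v \<in> S \<Omega> a g \<Longrightarrow> ereal m \<le> F \<Omega> a f v"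
    using assms(13) exists_minimizer by blast
  show ?thesis
  proof (rule ex1I)
    show "u \<in> S \<Omega> a g \<and> (\<forall>v\<in>S \<Omega> a g. F \<Omega> a f u \<le> F \<Omega> a f v)" using u by simp
    fix v assume v: "v \<in> S \<Omega> a g \<and> (\<forall>w\<in>S \<Omega> a g. F \<Omega> a f v \<le> F \<Omega> a f w)"
    \<comment> \<open>Both minimizers have excess 0, so \<open>grad_dist_gap\<close> makes their
      gradient distance 0.\<close>
    then have "F \<Omega> a f v \<le> ereal (m + 0)" using u(1,2) by auto
    then have "grad_dist v u \<le> ennreal (4 / a 2 * (0 + 0))"
      using u v by (intro grad_dist_gap[of v u m 0 0]) auto
    then show "v = u" using u v by (intro eq_if_grad_dist_zero) auto
  qed
qed

end
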